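(* Let $p=2$ and $r=2$, so $E=C_2^2$ and $S=T_1$. Then for every $X\in\mathrm{Rep}\,E$, the tensor product $S\otimes X$ is isomorphic to a direct sum of copies of $T_1$, $T_2$ and $T_3$.
   Context: $\Bbbk$ is an algebraically closed field of characteristic $2$. $E=C_2^2$ has generators $g_1,g_2$. Fix $\lambda_1,\lambda_2\in\Bbbk$ linearly independent over $\mathbb{F}_2$ and the resulting embedding $E\hookrightarrow SL_2(\Bbbk)$, $g_i\mapsto\begin{pmatrix}1&0\\ \lambda_i&1\end{pmatrix}$, along which $SL_2$-modules are restricted to $E$. $\mathrm{Rep}\,E$ is the category of finite-dimensional $\Bbbk E$-modules. $T_i$ is the restriction to $E$ of the indecomposable tilting $SL_2$-module of highest weight $i$. *)

theory Defs
  imports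
    "HOL-Algebra.Elementary_Groups"
    "HOL-Computational_Algebra.Polynomial"
    "Jordan_Normal_Form.Determinant"
    "Jordan_Normal_Form.Matrix_Kernel"
begin

section \<open>Finite-dimensional representations\<close>

text \<open>
  A finite-dimensional \<open>kG\<close>-module is given in coordinates: \<open>rdim M\<close> is its dimension \<open>n\<close> and
  \<open>act M g\<close> is the \<open>n \<times> n\<close> matrix by which \<open>g\<close> acts on column vectors. Dimension 0 is allowed.
\<close>

record ('g, 'k) rep =
  rdim :: nat
  act :: "'g \<Rightarrow> 'k mat"

definition is_rep :: "'g monoid \<Rightarrow> ('g, 'k::field) rep \<Rightarrow> bool" where
  "is_rep G M \<longleftrightarrow>
     (\<forall>g\<in>carrier G. act M g \<in> carrier_mat (rdim M) (rdim M)) \<and>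
     act M \<one>\<^bsub>G\<^esub> = 1\<^sub>m (rdim M) \<and>
     (\<forall>g\<in>carrier G. \<forall>h\<in>carrier G. act M (g \<otimes>\<^bsub>G\<^esub> h) = act M g * act M h)"

definition rep_hom :: "'g monoid \<Rightarrow> ('g, 'k::field) rep \<Rightarrow> ('g, 'k) rep \<Rightarrow> 'k mat set" where
  "rep_hom G M N =
     {A \<in> carrier_mat (rdim N) (rdim M). \<forall>g\<in>carrier G. A * act M g = act N g * A}"

definition rep_iso :: "'g monoid \<Rightarrow> ('g, 'k::field) rep \<Rightarrow> ('g, 'k) rep \<Rightarrow> bool" where
  "rep_iso G M N \<longleftrightarrow> (\<exists>A\<in>rep_hom G M N. invertible_mat A)"

definition zero_rep :: "('g, 'k::field) rep" where
  "zero_rep = \<lparr>rdim = 0, act = (\<lambda>g. 1\<^sub>m 0)\<rparr>"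

definition rep_sum :: "('g, 'k::field) rep \<Rightarrow> ('g, 'k) rep \<Rightarrow> ('g, 'k) rep" where
  "rep_sum M N =
     \<lparr>rdim = rdim M + rdim N,
      act = (\<lambda>g. four_block_mat (act M g) (0\<^sub>m (rdim M) (rdim N))
                               (0\<^sub>m (rdim N) (rdim M)) (act N g))\<rparr>"

definition rep_direct_sum :: "('g, 'k::field) rep list \<Rightarrow> ('g, 'k) rep" where
  "rep_direct_sum Ms = foldr rep_sum Ms zero_rep"

text \<open>
  The Kronecker product, i.e. the matrix of \<open>A \<otimes> B\<close> in the basis \<open>e\<^sub>i \<otimes> f\<^sub>j\<close> ordered lexicographically.
\<close>

definition kronecker_mat :: "'k::field mat \<Rightarrow> 'k mat \<Rightarrow> 'k mat" where
  "kronecker_mat A B =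
     mat (dim_row A * dim_row B) (dim_col A * dim_col B)
       (\<lambda>(i, j). A $$ (i div dim_row B, j div dim_col B) * B $$ (i mod dim_row B, j mod dim_col B))"

definition rep_tensor :: "('g, 'k::field) rep \<Rightarrow> ('g, 'k) rep \<Rightarrow> ('g, 'k) rep" where
  "rep_tensor M N =
     \<lparr>rdim = rdim M * rdim N, act = (\<lambda>g. kronecker_mat (act M g) (act N g))\<rparr>"

definition rep_dual :: "'g monoid \<Rightarrow> ('g, 'k::field) rep \<Rightarrow> ('g, 'k) rep" where
  "rep_dual G M = \<lparr>rdim = rdim M, act = (\<lambda>g. transpose_mat (act M (inv\<^bsub>G\<^esub> g)))\<rparr>"

definition rep_restrict :: "('h \<Rightarrow> 'g) \<Rightarrow> ('g, 'k::field) rep \<Rightarrow> ('h, 'k) rep" where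
  "rep_restrict \<phi> M = \<lparr>rdim = rdim M, act = (\<lambda>h. act M (\<phi> h))\<rparr>"

definition rep_indecomposable :: "'g monoid \<Rightarrow> ('g, 'k::field) rep \<Rightarrow> bool" where
  "rep_indecomposable G M \<longleftrightarrow>
     is_rep G M \<and> rdim M \<noteq> 0 \<and>
     (\<forall>N L. is_rep G N \<longrightarrow> is_rep G L \<longrightarrow> rep_iso G M (rep_sum N L) \<longrightarrow> rdim N = 0 \<or> rdim L = 0)"

text \<open>There is a short exact sequence \<open>0 \<rightarrow> L \<rightarrow> M \<rightarrow> N \<rightarrow> 0\<close> of representations.\<close>

definition rep_extension ::
  "'g monoid \<Rightarrow> ('g, 'k::field) rep \<Rightarrow> ('g, 'k) rep \<Rightarrow> ('g, 'k) rep \<Rightarrow> bool" where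
  "rep_extension G L M N \<longleftrightarrow>
     is_rep G L \<and> is_rep G M \<and> is_rep G N \<and>
     (\<exists>A\<in>rep_hom G L M. \<exists>B\<in>rep_hom G M N.
        inj_on (\<lambda>v. A *\<^sub>v v) (carrier_vec (rdim L)) \<and>
        (\<lambda>v. A *\<^sub>v v) ` carrier_vec (rdim L) = mat_kernel B \<and>
        (\<lambda>v. B *\<^sub>v v) ` carrier_vec (rdim M) = carrier_vec (rdim N))"

text \<open>
  \<open>M\<close> has a finite filtration by subrepresentations whose successive quotients are isomorphic to
  members of the family \<open>F\<close>, in any order and with repetitions. In \<open>step\<close>, \<open>L\<close> is the largest
  proper term of the filtration.
\<close>

inductive has_filtration ::
  "'g monoid \<Rightarrow> (nat \<Rightarrow> ('g, 'k::field) rep) \<Rightarrow> ('g, 'k) rep \<Rightarrow> bool"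
  for G :: "'g monoid" and F :: "nat \<Rightarrow> ('g, 'k) rep" where
  zero: "is_rep G M \<Longrightarrow> rdim M = 0 \<Longrightarrow> has_filtration G F M"
| step: "has_filtration G F L \<Longrightarrow> rep_extension G L M (F n) \<Longrightarrow> has_filtration G F M"


section \<open>Tilting modules for \<open>SL\<^sub>2\<close>\<close>

definition SL2 :: "'k::field mat monoid" where
  "SL2 = \<lparr>carrier = {g \<in> carrier_mat 2 2. det g = 1}, monoid.mult = (*), one = 1\<^sub>m 2\<rparr>"

definition mat2 :: "'k::field \<Rightarrow> 'k \<Rightarrow> 'k \<Rightarrow> 'k \<Rightarrow> 'k mat" where
  "mat2 a b c d = mat_of_rows_list 2 [[a, b], [c, d]]"

text \<open>Polynomial functions in the four matrix entries; restricted to \<open>SL\<^sub>2\<close> they form \<open>k[SL\<^sub>2]\<close>.\<close>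

inductive_set poly_fun :: "('k::field mat \<Rightarrow> 'k) set" where
  const: "(\<lambda>g. c) \<in> poly_fun"
| entry: "i < 2 \<Longrightarrow> j < 2 \<Longrightarrow> (\<lambda>g. g $$ (i, j)) \<in> poly_fun"
| add: "f \<in> poly_fun \<Longrightarrow> h \<in> poly_fun \<Longrightarrow> (\<lambda>g. f g + h g) \<in> poly_fun"
| mult: "f \<in> poly_fun \<Longrightarrow> h \<in> poly_fun \<Longrightarrow> (\<lambda>g. f g * h g) \<in> poly_fun"

text \<open>\<open>SL\<^sub>2\<close>-modules are modules for the algebraic group, i.e. all matrix coefficients are regular.\<close>

definition SL2_module :: "('k::field mat, 'k) rep \<Rightarrow> bool" where
  "SL2_module M \<longleftrightarrow>
     is_rep SL2 M \<and>
     (\<forall>i<rdim M. \<forall>j<rdim M. \<exists>f\<in>poly_fun. \<forall>g\<in>carrier SL2. act M g $$ (i, j) = f g)"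

text \<open>
  The dual Weyl module of highest weight \<open>n\<close> is the symmetric power \<open>Sym\<^sup>n V\<close> of the natural module
  \<open>V = \<langle>x, y\<rangle>\<close>, on which \<open>g = (a b; c d)\<close> acts by \<open>x \<mapsto> a x + c y\<close>, \<open>y \<mapsto> b x + d y\<close>. In the
  basis \<open>x\<^sup>n\<^sup>-\<^sup>i y\<^sup>i\<close>, the \<open>(i, j)\<close> entry is the coefficient of \<open>x\<^sup>n\<^sup>-\<^sup>i y\<^sup>i\<close> in
  \<open>(a x + c y)\<^sup>n\<^sup>-\<^sup>j (b x + d y)\<^sup>j\<close>, which is read off after setting \<open>x = 1\<close>.
\<close>

definition dual_weyl :: "nat \<Rightarrow> ('k::field mat, 'k) rep" where
  "dual_weyl n =
     \<lparr>rdim = n + 1,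
      act = (\<lambda>g. mat (n + 1) (n + 1)
        (\<lambda>(i, j). coeff ([:g $$ (0, 0), g $$ (1, 0):] ^ (n - j) * [:g $$ (0, 1), g $$ (1, 1):] ^ j) i))\<rparr>"

text \<open>As \<open>-w\<^sub>0\<close> is trivial for \<open>SL\<^sub>2\<close>, the dual of \<open>dual_weyl n\<close> has highest weight \<open>n\<close>, not another one.\<close>

definition weyl :: "nat \<Rightarrow> ('k::field mat, 'k) rep" where
  "weyl n = rep_dual SL2 (dual_weyl n)"

definition tilting :: "('k::field mat, 'k) rep \<Rightarrow> bool" where
  "tilting M \<longleftrightarrow>
     SL2_module M \<and> has_filtration SL2 weyl M \<and> has_filtration SL2 dual_weyl M"

text \<open>Weights are taken with respect to the diagonal torus, with \<open>m\<close> standing for \<open>diag(t, 1/t) \<mapsto> t\<^sup>m\<close>.\<close>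

definition is_weight :: "('k::field mat, 'k) rep \<Rightarrow> int \<Rightarrow> bool" where
  "is_weight M m \<longleftrightarrow>
     (\<exists>v\<in>carrier_vec (rdim M). v \<noteq> 0\<^sub>v (rdim M) \<and>
        (\<forall>t. t \<noteq> 0 \<longrightarrow> act M (mat2 t 0 0 (inverse t)) *\<^sub>v v = (t powi m) \<cdot>\<^sub>v v))"

definition highest_weight :: "('k::field mat, 'k) rep \<Rightarrow> int \<Rightarrow> bool" where
  "highest_weight M m \<longleftrightarrow> is_weight M m \<and> (\<forall>l. is_weight M l \<longrightarrow> l \<le> m)"

definition indecomposable_tilting :: "nat \<Rightarrow> ('k::field mat, 'k) rep \<Rightarrow> bool" where
  "indecomposable_tilting i M \<longleftrightarrow>
     tilting M \<and> rep_indecomposable SL2 M \<and> highest_weight M (int i)"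

end

theory Submission
  imports Defs
begin

text \<open>
  Put \<open>z\<^sub>i = (g\<^sub>i - 1) / \<lambda>\<^sub>i\<close>, \<open>z = z\<^sub>1\<close> and \<open>u = z\<^sub>1 + z\<^sub>2\<close>; these operators commute and have square zero, and \<open>u\<close>
  vanishes on \<open>S = V\<close>. On \<open>V \<otimes> X\<close> there are matrices with \<open>z h + h z = 1\<close>, \<open>c u = z u a\<close> and
  \<open>u = z u b + c z\<close>, and these identities pass to direct summands. A nonzero \<open>E\<close>-module that admits
  them has a summand of the form \<open>V \<otimes> W\<close>: a free module \<open>V \<otimes> V\<^sup>(\<^sup>1\<^sup>)\<close> if \<open>z u \<noteq> 0\<close>; the module \<open>V \<otimes> V\<close>,
  generated by vectors with \<open>u v = z w \<noteq> 0\<close> and \<open>u w = 0\<close>, if \<open>z u = 0 \<noteq> u\<close>; and \<open>V\<close> itself if \<open>u = 0\<close>. Splitting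
  these off one by one decomposes \<open>V \<otimes> X\<close>.

  For \<open>i \<le> 3\<close> the tilting module \<open>T\<^sub>i\<close> is \<open>V \<otimes> W\<close> with \<open>W\<close> trivial, \<open>V\<close> or \<open>V\<^sup>(\<^sup>1\<^sup>)\<close>. By Frobenius reciprocity a
  Borel-equivariant map \<open>k\<^sub>1 \<otimes> W \<rightarrow> T\<^sub>i\<close> extends to \<open>V \<otimes> W \<rightarrow> T\<^sub>i\<close>; applied to \<open>T\<^sub>i\<close> and to its contravariant
  transpose this gives \<open>V \<otimes> W \<rightarrow> T\<^sub>i \<rightarrow> V \<otimes> W\<close> with composite 1, and \<open>T\<^sub>i\<close> is indecomposable. The two
  filtrations are needed only for \<open>i = 2\<close>.
\<close>

text \<open>When \<open>z u = 0\<close> and \<open>ker z = im z\<close>, the module is given up to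
  isomorphism by a matrix \<open>N\<close> with \<open>u = z N\<close>, where \<open>N\<close> is an
  endomorphism of a complement of \<open>im z\<close>. Every Jordan type of \<open>N\<close> occurs
  among \<open>kE\<close>-modules; the two equations for \<open>c\<close> force
  \<open>N * N = 0\<close>, which leaves Jordan blocks of size 1 and 2, that is \<open>V\<close> and
  \<open>V \<otimes> V\<close>. All three equations are linear in \<open>h\<close>,
  \<open>a\<close>, \<open>b\<close>, \<open>c\<close>, because solutions of such a system can be
  compressed to any direct summand. Hence complements can be split off repeatedly, without
  uniqueness of decompositions.

  On the side of \<open>SL2\<close> the characteristic blocks the use of the Lie algebra:
  \<open>e f v = 2 v = 0\<close> for a highest weight vector of weight 2. Divided powers take its
  place. They arise as the coefficients of polynomial curves along one-parameter subgroups, and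
  relations between them follow from identities in the group by comparison of coefficients, as the
  field is infinite. That \<open>e f v\<close> vanishes is also the reason why a filtration must
  supply a vector when the weight is 2.\<close>

lemma mm_assoc:
  "dim_col A = dim_row B \<Longrightarrow> dim_col B = dim_row C \<Longrightarrow> (A * B) * C = A * (B * (C :: 'k::field mat))"
  by (rule assoc_mult_mat[of A "dim_row A" "dim_col A" B "dim_col B" C "dim_col C"]) auto

lemma mm_distl:
  "dim_col A = dim_row B \<Longrightarrow> dim_row B = dim_row C \<Longrightarrow> dim_col B = dim_col C \<Longrightarrow>
    A * (B + C) = A * B + A * (C :: 'k::field mat)"
  by (rule mult_add_distrib_mat[of A "dim_row A" "dim_col A" B "dim_col B" C]) auto

lemma mm_distr:
  "dim_row A = dim_row B \<Longrightarrow> dim_col A = dim_col B \<Longrightarrow> dim_col B = dim_row C \<Longrightarrow>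
    (A + B) * C = A * C + B * (C :: 'k::field mat)"
  by (rule add_mult_distrib_mat[of A "dim_row A" "dim_col A" B C "dim_col C"]) auto

lemma mm_diffl:
  "dim_col A = dim_row B \<Longrightarrow> dim_row B = dim_row C \<Longrightarrow> dim_col B = dim_col C \<Longrightarrow>
    A * (B - C) = A * B - A * (C :: 'k::field mat)"
  by (rule mult_minus_distrib_mat[of A "dim_row A" "dim_col A" B "dim_col B" C]) auto

lemma mm_diffr:
  "dim_row A = dim_row B \<Longrightarrow> dim_col A = dim_col B \<Longrightarrow> dim_col B = dim_row C \<Longrightarrow>
    (A - B) * C = A * C - B * (C :: 'k::field mat)"
  by (rule minus_mult_distrib_mat[of A "dim_row A" "dim_col A" B C "dim_col C"]) auto

lemma mm_smultl: "dim_col A = dim_row B \<Longrightarrow> (c \<cdot>\<^sub>m A) * B = c \<cdot>\<^sub>m (A * (B :: 'k::field mat))"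
  by (rule mult_smult_assoc_mat[of A "dim_row A" "dim_col A" B "dim_col B"]) auto

lemma mm_smultr: "dim_col A = dim_row B \<Longrightarrow> A * (c \<cdot>\<^sub>m B) = c \<cdot>\<^sub>m (A * (B :: 'k::field mat))"
  by (rule mult_smult_distrib[of A "dim_row A" "dim_col A" B "dim_col B"]) auto

lemma mm_onel: "n = dim_row A \<Longrightarrow> 1\<^sub>m n * A = (A :: 'k::field mat)"
  by (rule left_mult_one_mat[of A _ "dim_col A"]) auto

lemma mm_oner: "n = dim_col A \<Longrightarrow> A * 1\<^sub>m n = (A :: 'k::field mat)"
  by (rule right_mult_one_mat[of A "dim_row A"]) auto

lemma mm_zerol: "m = dim_row A \<Longrightarrow> 0\<^sub>m n m * A = (0\<^sub>m n (dim_col A) :: 'k::field mat)"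
  by (rule left_mult_zero_mat[of A m "dim_col A" n]) auto

lemma mm_zeror: "n = dim_col A \<Longrightarrow> A * 0\<^sub>m n m = (0\<^sub>m (dim_row A) m :: 'k::field mat)"
  by (rule right_mult_zero_mat[of A "dim_row A" n m]) auto

lemma mm_add_zerol: "n = dim_row A \<Longrightarrow> m = dim_col A \<Longrightarrow> 0\<^sub>m n m + A = (A :: 'k::field mat)"
  by (rule eq_matI) auto

lemma mm_add_zeror: "n = dim_row A \<Longrightarrow> m = dim_col A \<Longrightarrow> A + 0\<^sub>m n m = (A :: 'k::field mat)"
  by (rule eq_matI) auto

lemma mm_smult_add:
  "dim_row A = dim_row B \<Longrightarrow> dim_col A = dim_col B \<Longrightarrow> c \<cdot>\<^sub>m (A + B) = c \<cdot>\<^sub>m A + c \<cdot>\<^sub>m (B :: 'k::field mat)"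
  by (rule eq_matI) (auto simp: algebra_simps)

lemma mm_smult_smult: "c \<cdot>\<^sub>m (d \<cdot>\<^sub>m A) = (c * d) \<cdot>\<^sub>m (A :: 'k::field mat)"
  by (rule eq_matI) auto

lemma mm_smult_zero: "c \<cdot>\<^sub>m 0\<^sub>m n m = (0\<^sub>m n m :: 'k::field mat)"
  by (rule eq_matI) auto

lemma mm_smult_one: "1 \<cdot>\<^sub>m A = (A :: 'k::field mat)"
  by (rule eq_matI) auto

lemma mm_zero_smult: "0 \<cdot>\<^sub>m A = (0\<^sub>m (dim_row A) (dim_col A) :: 'k::field mat)"
  by (rule eq_matI) auto

text \<open>All hypotheses are equations between dimensions, which the simplifier decides; with
  carrier sets the dimensions would be variables that the left-hand sides do not determine. The
  normal form is a sum of right-nested products with scalars in front.\<close>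

lemmas mm = mm_assoc mm_distl mm_distr mm_diffl mm_diffr mm_smultl mm_smultr mm_onel mm_oner
  mm_zerol mm_zeror mm_add_zerol mm_add_zeror mm_smult_add mm_smult_smult mm_smult_zero
  mm_smult_one mm_zero_smult

subsection \<open>Concatenation of matrices\<close>

text \<open>\<open>hcat A B\<close> is the map out of a direct sum with components \<open>A\<close>
  and \<open>B\<close>, and \<open>vcat A B\<close> the map into one. Bases and dual bases are
  assembled from single columns and rows in this way.\<close>

definition hcat :: "'k::field mat \<Rightarrow> 'k mat \<Rightarrow> 'k mat" where
  "hcat A B = mat (dim_row A) (dim_col A + dim_col B)
     (\<lambda>(i, j). if j < dim_col A then A $$ (i, j) else B $$ (i, j - dim_col A))"

definition vcat :: "'k::field mat \<Rightarrow> 'k mat \<Rightarrow> 'k mat" where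
  "vcat A B = mat (dim_row A + dim_row B) (dim_col A)
     (\<lambda>(i, j). if i < dim_row A then A $$ (i, j) else B $$ (i - dim_row A, j))"

lemma hcat_dim [simp]: "dim_row (hcat A B) = dim_row A" "dim_col (hcat A B) = dim_col A + dim_col B"
  by (simp_all add: hcat_def)

lemma vcat_dim [simp]: "dim_row (vcat A B) = dim_row A + dim_row B" "dim_col (vcat A B) = dim_col A"
  by (simp_all add: vcat_def)

lemma mat_mult_entry:
  "i < dim_row A \<Longrightarrow> j < dim_col B \<Longrightarrow> dim_col A = dim_row B \<Longrightarrow>
   (A * B) $$ (i, j) = (\<Sum>k<dim_row B. A $$ (i, k) * B $$ (k, j))"
  by (simp add: scalar_prod_def lessThan_atLeast0)

lemma sum_lessThan_add:
  "(\<Sum>k<n + (m::nat). f k :: 'a::comm_monoid_add) = (\<Sum>k<n. f k) + (\<Sum>k<m. f (n + k))"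
  by (induction m) (simp_all add: add.assoc)

lemma mult_hcat:
  "dim_col X = dim_row A \<Longrightarrow> dim_row A = dim_row B \<Longrightarrow> X * hcat A B = hcat (X * A) (X * B)"
  by (rule eq_matI) (auto simp: mat_mult_entry hcat_def simp del: index_mult_mat(1))

lemma vcat_mult:
  "dim_col A = dim_row X \<Longrightarrow> dim_col A = dim_col B \<Longrightarrow> vcat A B * X = vcat (A * X) (B * X)"
  by (rule eq_matI) (auto simp: mat_mult_entry vcat_def simp del: index_mult_mat(1))

lemma hcat_mult_vcat:
  assumes "dim_col A = dim_row C" "dim_col B = dim_row D" "dim_row A = dim_row B" "dim_col C = dim_col D"
  shows "hcat A B * vcat C D = A * C + B * D"
  by (rule eq_matI)
    (use assms in \<open>auto simp: mat_mult_entry hcat_def vcat_def sum_lessThan_add simp del: index_mult_mat(1)\<close>)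

lemma vcat_mult_hcat:
  assumes "dim_col A = dim_row C" "dim_col A = dim_col B" "dim_row C = dim_row D"
  shows "vcat A B * hcat C D = four_block_mat (A * C) (A * D) (B * C) (B * D)"
  by (rule eq_matI)
    (use assms in \<open>auto simp: mat_mult_entry hcat_def vcat_def simp del: index_mult_mat(1)\<close>)

lemma hcat_mult_four_block:
  assumes "dim_col A = dim_row P" "dim_row P = dim_row Q" "dim_col B = dim_row R" "dim_row R = dim_row S"
    "dim_row A = dim_row B" "dim_col P = dim_col R" "dim_col Q = dim_col S"
  shows "hcat A B * four_block_mat P Q R S = hcat (A * P + B * R) (A * Q + B * S)"
  by (rule eq_matI)
    (use assms in \<open>auto simp: mat_mult_entry hcat_def sum_lessThan_add simp del: index_mult_mat(1)\<close>)

lemma four_block_mult_vcat: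
  assumes "dim_col P = dim_row A" "dim_col P = dim_col R" "dim_row B = dim_col S" "dim_col S = dim_col Q"
    "dim_row P = dim_row Q" "dim_row R = dim_row S" "dim_col A = dim_col B"
  shows "four_block_mat P Q R S * vcat A B = vcat (P * A + Q * B) (R * A + S * B)"
  by (rule eq_matI)
    (use assms in \<open>auto simp: mat_mult_entry vcat_def sum_lessThan_add simp del: index_mult_mat(1)\<close>)

lemma four_block_mult:
  assumes "dim_col A = dim_row P" "dim_col A = dim_col C" "dim_row Q = dim_row P" 
    "dim_row A = dim_row B" "dim_row C = dim_row D" "dim_col B = dim_col D" "dim_col D = dim_row S"
    "dim_row R = dim_row S" "dim_col P = dim_col R" "dim_col Q = dim_col S"
  shows "four_block_mat A B C D * four_block_mat P Q R S =
    four_block_mat (A * P + B * R) (A * Q + B * S) (C * P + D * R) (C * Q + D * S)"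
  by (rule mult_four_block_mat[of A "dim_row A" "dim_col A" B "dim_col B" C "dim_row C" D P "dim_col P" Q "dim_col Q"])
    (insert assms, (rule carrier_matI; simp)+)

subsection \<open>Full rank factorisation\<close>

text \<open>If \<open>n > m\<close>, padding \<open>A\<close> with zero columns and \<open>B\<close>
  with zero rows gives square matrices with the same product 1, while the padded \<open>B\<close>
  has determinant 0.\<close>

lemma square_if_inverse:
  assumes A: "A \<in> carrier_mat n m" and B: "B \<in> carrier_mat m n"
    and AB: "A * B = 1\<^sub>m n" and BA: "B * A = (1\<^sub>m m :: 'k::field mat)"
  shows "n = m"
proof -
  have le: "n \<le> m" if A: "A \<in> carrier_mat n m" and B: "B \<in> carrier_mat m n"
    and AB: "A * B = 1\<^sub>m n" for A B :: "'k mat" and n m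
  proof (rule ccontr)
    assume "\<not> n \<le> m"
    then have mn: "m < n" by simp
    define A' where "A' = hcat A (0\<^sub>m n (n - m))"
    define B' where "B' = vcat B (0\<^sub>m (n - m) n)"
    have c: "A' \<in> carrier_mat n n" "B' \<in> carrier_mat n n"
      unfolding A'_def B'_def using A B mn by (auto intro!: carrier_matI)
    have "A' * B' = 1\<^sub>m n"
      unfolding A'_def B'_def using A B AB mn
      by (subst hcat_mult_vcat) (auto simp: mm)
    then have "det A' * det B' = 1"
      using det_mult[OF c] by simp
    moreover have "det B' = 0"
      using laplace_expansion_row[OF c(2) mn] B mn unfolding B'_def by (auto simp: vcat_def)
    ultimately show False by simp
  qed
  show ?thesis using le[OF A B AB] le[OF B A BA] by simp
qed

text \<open>Stands in for the choice of a basis of the image: \<open>X\<close> embeds it,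
  \<open>Y\<close> projects onto it, and \<open>L\<close> and \<open>R\<close> are one-sided
  inverses. The proof is elimination by rank-one corrections: subtracting \<open>c * b\<close>
  clears the pivot row \<open>i\<close> and the pivot column \<open>j\<close> and keeps zero rows
  zero, so the number of nonzero rows drops.\<close>

lemma full_rank_factorization:
  fixes A :: "'k::field mat"
  assumes A: "A \<in> carrier_mat m n"
  obtains r X Y L R where "X \<in> carrier_mat m r" "Y \<in> carrier_mat r n"
    "L \<in> carrier_mat r m" "R \<in> carrier_mat n r" "A = X * Y" "L * X = 1\<^sub>m r" "Y * R = 1\<^sub>m r"
proof -
  have "\<exists>r X Y L R. X \<in> carrier_mat m r \<and> Y \<in> carrier_mat r n \<and> L \<in> carrier_mat r m \<and>
     R \<in> carrier_mat n r \<and> A = X * Y \<and> L * X = 1\<^sub>m r \<and> Y * R = 1\<^sub>m r"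
    using A
  proof (induction "card {i. i < m \<and> (\<exists>j<n. A $$ (i, j) \<noteq> 0)}" arbitrary: A rule: less_induct)
    case less
    note A = less.prems
    show ?case
    proof (cases "\<exists>i<m. \<exists>j<n. A $$ (i, j) \<noteq> 0")
      case False
      have "A = 0\<^sub>m m 0 * 0\<^sub>m 0 n" using False A by (intro eq_matI) (auto simp: scalar_prod_def)
      moreover have "0\<^sub>m 0 m * 0\<^sub>m m 0 = (1\<^sub>m 0 :: 'k mat)" "0\<^sub>m 0 n * 0\<^sub>m n 0 = (1\<^sub>m 0 :: 'k mat)"
        by (auto intro!: eq_matI)
      ultimately show ?thesis
        by (intro exI[of _ 0] exI[of _ "0\<^sub>m m 0"] exI[of _ "0\<^sub>m 0 n"] exI[of _ "0\<^sub>m 0 m"] exI[of _ "0\<^sub>m n 0"])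
          auto
    next
      case True
      then obtain i j where ij: "i < m" "j < n" "A $$ (i, j) \<noteq> 0" by blast
      define a where "a = A $$ (i, j)"
      define ei where "ei = mat 1 m (\<lambda>(_, l). if l = i then 1 else 0 :: 'k)"
      define ej where "ej = mat n 1 (\<lambda>(l, _). if l = j then 1 else 0 :: 'k)"
      define c where "c = A * ej"
      define b where "b = inverse a \<cdot>\<^sub>m (ei * A)"
      have dims [simp]: "dim_row A = m" "dim_col A = n" "dim_row ei = 1" "dim_col ei = m"
        "dim_row ej = n" "dim_col ej = 1" "dim_row c = m" "dim_col c = 1" "dim_row b = 1" "dim_col b = n"
        using A by (auto simp: ei_def ej_def c_def b_def)
      have ei_mult: "ei * B = mat 1 (dim_col B) (\<lambda>(_, l). B $$ (i, l))" if "dim_row B = m" for B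
        using ij that by (intro eq_matI) (auto simp: mat_mult_entry ei_def if_distrib[where f = "\<lambda>x. x * y" for y] cong: if_cong
            simp del: index_mult_mat(1))
      have mult_ej: "B * ej = mat (dim_row B) 1 (\<lambda>(l, _). B $$ (l, j))" if "dim_col B = n" for B
        using ij that by (intro eq_matI) (auto simp: mat_mult_entry ej_def if_distrib[where f = "\<lambda>x. y * x" for y] cong: if_cong
            simp del: index_mult_mat(1))
      have a0: "a \<noteq> 0" using ij by (simp add: a_def)
      have ec: "ei * c = a \<cdot>\<^sub>m 1\<^sub>m 1"
        using ij by (intro eq_matI) (auto simp: ei_mult a_def c_def mult_ej)
      have be: "b * ej = 1\<^sub>m 1"
        using ij a0 by (intro eq_matI) (auto simp: mult_ej a_def b_def ei_mult)
      define A' where "A' = A - c * b"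
      have A': "A' \<in> carrier_mat m n" by (rule carrier_matI) (simp_all add: A'_def)
      have eA': "ei * A' = 0\<^sub>m 1 n"
      proof -
        have "ei * A' = ei * A - (ei * c) * b" by (simp add: A'_def mm)
        also have "\<dots> = ei * A - a \<cdot>\<^sub>m b" by (simp add: ec mm)
        also have "\<dots> = 0\<^sub>m 1 n" using a0 by (intro eq_matI) (auto simp: b_def)
        finally show ?thesis .
      qed
      have Ae': "A' * ej = 0\<^sub>m m 1"
      proof -
        have "A' * ej = A * ej - c * (b * ej)" by (simp add: A'_def mm)
        also have "\<dots> = 0\<^sub>m m 1" unfolding be by (intro eq_matI) (auto simp: mm c_def)
        finally show ?thesis .
      qed
      have entry: "(c * b) $$ (l, k) = A $$ (l, j) * b $$ (0, k)" if "l < m" "k < n" for l k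
        using that by (simp add: mat_mult_entry c_def mult_ej del: index_mult_mat(1))
      have "A' $$ (i, k) = 0" if "k < n" for k
        using arg_cong[OF eA', of "\<lambda>B. B $$ (0, k)"] that A' by (simp add: ei_mult carrier_matD)
      moreover have "A' $$ (l, k) = 0" if "l < m" "k < n" "\<forall>k<n. A $$ (l, k) = 0" for l k
        using that ij by (simp add: A'_def entry del: index_mult_mat(1))
      ultimately have "{l. l < m \<and> (\<exists>k<n. A' $$ (l, k) \<noteq> 0)} \<subset> {l. l < m \<and> (\<exists>k<n. A $$ (l, k) \<noteq> 0)}"
        using ij by blast
      then have "card {l. l < m \<and> (\<exists>k<n. A' $$ (l, k) \<noteq> 0)} < card {l. l < m \<and> (\<exists>k<n. A $$ (l, k) \<noteq> 0)}"
        by (rule psubset_card_mono[rotated]) simp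
      from less.hyps[OF this A'] obtain r X Y L R where IH: "X \<in> carrier_mat m r"
        "Y \<in> carrier_mat r n" "L \<in> carrier_mat r m" "R \<in> carrier_mat n r" "A' = X * Y"
        "L * X = 1\<^sub>m r" "Y * R = 1\<^sub>m r" by blast
      have dims' [simp]: "dim_row X = m" "dim_col X = r" "dim_row Y = r" "dim_col Y = n"
        "dim_row L = r" "dim_col L = m" "dim_row R = n" "dim_col R = r"
        using IH by (auto simp: carrier_matD)
      \<comment> \<open>\<open>Y\<close> can be cancelled on the right and \<open>X\<close> on the
        left of \<open>A' = X * Y\<close>, so the cleared row of \<open>A'\<close> is zero in
        \<open>X\<close> and the cleared column is zero in \<open>Y\<close>.\<close>
      have eX: "ei * X = 0\<^sub>m 1 r"
      proof -
        have "ei * X = ei * X * (Y * R)" by (simp add: IH mm)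
        also have "\<dots> = (ei * A') * R" by (simp add: IH(5) mm)
        finally show ?thesis by (simp add: eA' mm)
      qed
      have Ye: "Y * ej = 0\<^sub>m r 1"
      proof -
        have "Y * ej = (L * X) * (Y * ej)" by (simp add: IH(6) mm)
        also have "\<dots> = L * (A' * ej)" by (simp add: IH(5) mm)
        finally show ?thesis by (simp add: Ae' mm)
      qed
      \<comment> \<open>The corrections keep the old inverses away from the new column and the new
        row: the lower block of \<open>L'\<close> annihilates \<open>c\<close>, and the right block
        of \<open>R'\<close> is annihilated by \<open>b\<close>.\<close>
      define L' where "L' = vcat (inverse a \<cdot>\<^sub>m ei) (L - inverse a \<cdot>\<^sub>m (L * c * ei))"
      define R' where "R' = hcat ej (R - ej * (b * R))"
      have LX: "L' * hcat c X = 1\<^sub>m (1 + r)"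
      proof -
        have "L' * hcat c X = four_block_mat (inverse a \<cdot>\<^sub>m (ei * c)) (inverse a \<cdot>\<^sub>m (ei * X))
            (L * c - inverse a \<cdot>\<^sub>m (L * (c * (ei * c)))) (L * X - inverse a \<cdot>\<^sub>m (L * (c * (ei * X))))"
          unfolding L'_def by (subst vcat_mult_hcat) (simp_all add: mm)
        also have "\<dots> = four_block_mat (1\<^sub>m 1) (0\<^sub>m 1 r) (0\<^sub>m r 1) (1\<^sub>m r)"
          unfolding ec eX IH(6) using a0 by (intro cong_four_block_mat eq_matI) (auto simp: mm)
        finally show ?thesis by simp
      qed
      have YR: "vcat b Y * R' = 1\<^sub>m (1 + r)"
      proof -
        have "vcat b Y * R' = four_block_mat (b * ej) (b * R - (b * ej) * (b * R))
            (Y * ej) (Y * R - (Y * ej) * (b * R))"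
          unfolding R'_def by (subst vcat_mult_hcat) (simp_all add: mm)
        also have "\<dots> = four_block_mat (1\<^sub>m 1) (0\<^sub>m 1 r) (0\<^sub>m r 1) (1\<^sub>m r)"
          unfolding be Ye IH(7) by (intro cong_four_block_mat eq_matI) (auto simp: mm)
        finally show ?thesis by simp
      qed
      have "hcat c X * vcat b Y = c * b + A'" by (simp add: hcat_mult_vcat IH(5))
      also have "\<dots> = A" unfolding A'_def by (intro eq_matI) (auto simp del: index_mult_mat(1))
      finally have "A = hcat c X * vcat b Y" ..
      then show ?thesis using LX YR
        by (intro exI[of _ "1 + r"] exI[of _ "hcat c X"] exI[of _ "vcat b Y"] exI[of _ L'] exI[of _ R'])
          (auto simp: L'_def R'_def intro!: carrier_matI)
    qed
  qed
  then show thesis using that by blast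
qed

subsection \<open>Representations\<close>

lemma is_rep_dims:
  assumes "is_rep G M" "g \<in> carrier G"
  shows "dim_row (act M g) = rdim M" "dim_col (act M g) = rdim M"
  using assms by (auto simp: is_rep_def carrier_matD)

lemma rep_homD:
  assumes "A \<in> rep_hom G M N"
  shows "dim_row A = rdim N" "dim_col A = rdim M" "g \<in> carrier G \<Longrightarrow> A * act M g = act N g * A"
  using assms by (auto simp: rep_hom_def carrier_matD)

lemma rep_homI:
  assumes "dim_row A = rdim N" "dim_col A = rdim M"
    "\<And>g. g \<in> carrier G \<Longrightarrow> A * act M g = act N g * A"
  shows "A \<in> rep_hom G M N"
  using assms by (auto simp: rep_hom_def)

lemma is_repI:
  assumes "\<And>g. g \<in> carrier G \<Longrightarrow> dim_row (act M g) = rdim M"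
    "\<And>g. g \<in> carrier G \<Longrightarrow> dim_col (act M g) = rdim M"
    "act M \<one>\<^bsub>G\<^esub> = 1\<^sub>m (rdim M)"
    "\<And>g h. g \<in> carrier G \<Longrightarrow> h \<in> carrier G \<Longrightarrow> act M (g \<otimes>\<^bsub>G\<^esub> h) = act M g * act M h"
  shows "is_rep G M"
  using assms by (auto simp: is_rep_def)

lemma is_repD:
  assumes "is_rep G M"
  shows "act M \<one>\<^bsub>G\<^esub> = 1\<^sub>m (rdim M)"
    "g \<in> carrier G \<Longrightarrow> h \<in> carrier G \<Longrightarrow> act M (g \<otimes>\<^bsub>G\<^esub> h) = act M g * act M h"
  using assms by (auto simp: is_rep_def)

lemma rep_hom_comp:
  assumes "is_rep G L" "is_rep G M" "is_rep G N" "A \<in> rep_hom G L M" "B \<in> rep_hom G M N"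
  shows "B * A \<in> rep_hom G L N"
proof (rule rep_homI)
  fix g assume g: "g \<in> carrier G"
  note d = is_rep_dims[OF assms(1) g] is_rep_dims[OF assms(2) g] is_rep_dims[OF assms(3) g]
    rep_homD[OF assms(4)] rep_homD[OF assms(5)]
  have "B * A * act L g = B * (act M g * A)" using d g by (simp add: mm)
  also have "\<dots> = (B * act M g) * A" using d(1-8) rep_homD(1,2)[OF assms(5)] by (simp add: mm)
  also have "\<dots> = act N g * (B * A)" using d g by (simp add: mm)
  finally show "B * A * act L g = act N g * (B * A)" .
qed (use rep_homD[OF assms(4)] rep_homD[OF assms(5)] in auto)

lemma rep_isoI:
  assumes "A \<in> rep_hom G M N" "dim_row B = rdim M" "dim_col B = rdim N"
    "A * B = 1\<^sub>m (rdim N)" "B * A = 1\<^sub>m (rdim M)"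
  shows "rep_iso G M N"
proof -
  have "rdim N = rdim M"
    by (rule square_if_inverse[OF _ _ assms(4,5)]) (use assms rep_homD[OF assms(1)] in auto)
  then show ?thesis
    using assms rep_homD(1,2)[OF assms(1)]
    by (auto simp: rep_iso_def invertible_mat_def inverts_mat_def square_mat.simps intro!: bexI[of _ A] exI[of _ B])
qed

lemma rep_isoE:
  assumes "rep_iso G M N" "is_rep G M" "is_rep G N"
  obtains A B where "A \<in> rep_hom G M N" "B \<in> rep_hom G N M"
    "A * B = 1\<^sub>m (rdim N)" "B * A = 1\<^sub>m (rdim M)"
proof -
  from assms(1) obtain A B where A: "A \<in> rep_hom G M N" "square_mat A"
    and B: "A * B = 1\<^sub>m (dim_row A)" "B * A = 1\<^sub>m (dim_row B)"
    by (auto simp: rep_iso_def invertible_mat_def inverts_mat_def)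
  note dA = rep_homD(1,2)[OF A(1)]
  have dB: "dim_col B = rdim N" "dim_row B = rdim M"
    using arg_cong[OF B(1), of dim_col] arg_cong[OF B(2), of dim_col] dA A(2)
    by (auto simp: square_mat.simps)
  have "B \<in> rep_hom G N M"
  proof (rule rep_homI)
    fix g assume g: "g \<in> carrier G"
    note d = is_rep_dims[OF assms(2) g] is_rep_dims[OF assms(3) g] dA dB
    have "B * act N g = B * (act N g * (A * B))" using d B by (simp add: mm)
    also have "\<dots> = B * ((act N g * A) * B)" using d by (simp add: mm)
    also have "\<dots> = B * ((A * act M g) * B)" using rep_homD(3)[OF A(1) g] by simp
    also have "\<dots> = (B * A) * (act M g * B)" using d by (simp add: mm)
    also have "\<dots> = act M g * B" using d B by (simp add: mm)
    finally show "B * act N g = act M g * B" .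
  qed (use dB in auto)
  then show thesis using that A B dA dB by auto
qed

lemma rep_iso_trans:
  assumes "rep_iso G L M" "rep_iso G M N" "is_rep G L" "is_rep G M" "is_rep G N"
  shows "rep_iso G L N"
proof -
  from assms obtain A A' where A: "A \<in> rep_hom G L M" "A' \<in> rep_hom G M L" "A * A' = 1\<^sub>m (rdim M)"
    "A' * A = 1\<^sub>m (rdim L)" by (elim rep_isoE)
  from assms(2,4,5) obtain B B' where B: "B \<in> rep_hom G M N" "B' \<in> rep_hom G N M" "B * B' = 1\<^sub>m (rdim N)"
    "B' * B = 1\<^sub>m (rdim M)" by (elim rep_isoE)
  note d = rep_homD(1,2)[OF A(1)] rep_homD(1,2)[OF A(2)] rep_homD(1,2)[OF B(1)] rep_homD(1,2)[OF B(2)]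
  show ?thesis
  proof (rule rep_isoI)
    show "B * A \<in> rep_hom G L N" using assms A B by (intro rep_hom_comp)
    have "B * A * (A' * B') = B * ((A * A') * B')" using d by (simp add: mm)
    then show "B * A * (A' * B') = 1\<^sub>m (rdim N)" using d A B by (simp add: mm)
    have "A' * B' * (B * A) = A' * ((B' * B) * A)" using d by (simp add: mm)
    then show "A' * B' * (B * A) = 1\<^sub>m (rdim L)" using d A B by (simp add: mm)
  qed (use d in auto)
qed

lemma rep_sum_simps [simp]:
  "rdim (rep_sum M N) = rdim M + rdim N"
  "act (rep_sum M N) g = four_block_mat (act M g) (0\<^sub>m (rdim M) (rdim N)) (0\<^sub>m (rdim N) (rdim M)) (act N g)"
  by (simp_all add: rep_sum_def)

lemma is_rep_sum:
  assumes "is_rep G M" "is_rep G N"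
  shows "is_rep G (rep_sum M N)"
  by (rule is_repI)
    (use assms in \<open>simp_all add: is_rep_dims is_repD four_block_mult mm\<close>)

lemma rep_iso_sum_cong:
  assumes "rep_iso G M N" "is_rep G L" "is_rep G M" "is_rep G N"
  shows "rep_iso G (rep_sum L M) (rep_sum L N)"
proof -
  from assms obtain A B where A: "A \<in> rep_hom G M N" "B \<in> rep_hom G N M" "A * B = 1\<^sub>m (rdim N)"
    "B * A = 1\<^sub>m (rdim M)" by (elim rep_isoE)
  note d = rep_homD(1,2)[OF A(1)] rep_homD(1,2)[OF A(2)]
  let ?D = "\<lambda>A. four_block_mat (1\<^sub>m (rdim L)) (0\<^sub>m (rdim L) (dim_col A)) (0\<^sub>m (dim_row A) (rdim L)) A"
  show ?thesis
  proof (rule rep_isoI[of "?D A" _ _ _ "?D B"])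
    show "?D A \<in> rep_hom G (rep_sum L M) (rep_sum L N)"
      by (rule rep_homI) (use d assms rep_homD(3)[OF A(1)] in \<open>simp_all add: four_block_mult is_rep_dims mm\<close>)
  qed (use d A in \<open>simp_all add: four_block_mult mm\<close>)
qed

lemma rep_direct_sum_simps [simp]:
  "rep_direct_sum [] = zero_rep" "rep_direct_sum (M # Ms) = rep_sum M (rep_direct_sum Ms)"
  by (simp_all add: rep_direct_sum_def)

lemma is_rep_zero: "is_rep G zero_rep"
  by (simp add: is_rep_def zero_rep_def)

lemma is_rep_direct_sum: "(\<And>M. M \<in> set Ms \<Longrightarrow> is_rep G M) \<Longrightarrow> is_rep G (rep_direct_sum Ms)"
  by (induction Ms) (simp_all add: is_rep_zero is_rep_sum del: rep_sum_simps)

lemma rep_iso_zero: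
  assumes "is_rep G M" "rdim M = 0"
  shows "rep_iso G M zero_rep"
  by (rule rep_isoI[of "0\<^sub>m 0 0" _ _ _ "0\<^sub>m 0 0"])
    (use assms in \<open>auto simp: zero_rep_def is_rep_dims intro!: rep_homI eq_matI\<close>)

text \<open>The complement of a retract is the image of the idempotent \<open>1 - P * Q\<close>. A
  full-rank factorisation \<open>X * Y\<close> of an idempotent satisfies \<open>Y * X = 1\<close>,
  so the image carries the action \<open>Y * act M g * X\<close>, for which \<open>X\<close> and
  \<open>Y\<close> are intertwiners. They are returned as \<open>I\<close> and \<open>J\<close>
  because further properties of \<open>M\<close> are transported along them.\<close>

lemma split_summand:
  assumes M: "is_rep G M" and N: "is_rep G N" and P: "P \<in> rep_hom G N M" and Q: "Q \<in> rep_hom G M N"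
    and QP: "Q * P = 1\<^sub>m (rdim N)"
  obtains K I J where "is_rep G K" "I \<in> rep_hom G K M" "J \<in> rep_hom G M K" "J * I = 1\<^sub>m (rdim K)"
    "rep_iso G M (rep_sum N K)" "rdim M = rdim N + rdim K"
proof -
  note d = rep_homD(1,2)[OF P] rep_homD(1,2)[OF Q]
  let ?m = "rdim M" and ?n = "rdim N"
  have "1\<^sub>m ?m - P * Q \<in> carrier_mat ?m ?m" using d by (intro carrier_matI) auto
  from full_rank_factorization[OF this] obtain r X Y L R where F: "X \<in> carrier_mat ?m r" "Y \<in> carrier_mat r ?m"
    "L \<in> carrier_mat r ?m" "R \<in> carrier_mat ?m r" "1\<^sub>m ?m - P * Q = X * Y" "L * X = 1\<^sub>m r" "Y * R = 1\<^sub>m r" .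
  have d' [simp]: "dim_row X = ?m" "dim_col X = r" "dim_row Y = r" "dim_col Y = ?m"
    "dim_row L = r" "dim_col L = ?m" "dim_row R = ?m" "dim_col R = r" using F by (auto simp: carrier_matD)
  have YP: "Y * P = 0\<^sub>m r ?n"
  proof -
    have "Y * P = (L * X) * (Y * P)" using d F(6) by (simp add: mm)
    also have "\<dots> = L * ((X * Y) * P)" using d by (simp add: mm)
    also have "(X * Y) * P = P - P * (Q * P)" unfolding F(5)[symmetric] using d by (simp add: mm)
    also have "\<dots> = 0\<^sub>m ?m ?n" unfolding QP using d by (intro eq_matI) (auto simp: mm)
    finally show ?thesis by (simp add: mm)
  qed
  have QX: "Q * X = 0\<^sub>m ?n r"
  proof -
    have "Q * X = (Q * X) * (Y * R)" using d F(7) by (simp add: mm)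
    also have "\<dots> = (Q * (X * Y)) * R" using d by (simp add: mm)
    also have "Q * (X * Y) = Q - (Q * P) * Q" unfolding F(5)[symmetric] using d by (simp add: mm)
    also have "\<dots> = 0\<^sub>m ?n ?m" unfolding QP using d by (intro eq_matI) (auto simp: mm)
    finally show ?thesis by (simp add: mm)
  qed
  \<comment> \<open>Idempotency of \<open>X * Y\<close>, with \<open>X\<close> cancelled by
    \<open>L\<close> on the left and \<open>Y\<close> cancelled by \<open>R\<close> on the
    right.\<close>
  have YX: "Y * X = 1\<^sub>m r"
  proof -
    have "Y * X = (L * X) * ((Y * X) * (Y * R))" unfolding F(6,7) by (simp add: mm)
    also have "\<dots> = L * ((X * Y) * (X * Y)) * R" by (simp add: mm)
    also have "(X * Y) * (X * Y) = X * Y - P * (Q * X) * Y" 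
      using d by (subst (1) F(5)[symmetric]) (simp add: mm)
    also have "\<dots> = X * Y" unfolding QX using d by (intro eq_matI) (auto simp: mm simp del: index_mult_mat(1))
    also have "L * (X * Y) * R = (L * X) * (Y * R)" by (simp add: mm)
    finally show ?thesis unfolding F(6,7) by (simp add: mm)
  qed
  have sum1: "P * Q + X * Y = 1\<^sub>m ?m"
    unfolding F(5)[symmetric] using d by (intro eq_matI) (auto simp del: index_mult_mat(1))
  define K where "K = \<lparr>rdim = r, act = (\<lambda>g. Y * act M g * X)\<rparr>"
  have K: "rdim K = r" "act K g = Y * act M g * X" for g by (simp_all add: K_def)
  have Yg: "Y * act M g = act K g * Y" if g: "g \<in> carrier G" for g
  proof -
    note dg = is_rep_dims[OF M g] is_rep_dims[OF N g]
    have "Y * act M g = Y * act M g * (P * Q + X * Y)" using dg by (simp add: sum1 mm)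
    also have "\<dots> = Y * (act M g * P) * Q + act K g * Y" using dg d by (simp add: K mm)
    also have "act M g * P = P * act N g" using rep_homD(3)[OF P g] by simp
    also have "Y * (P * act N g) * Q = (Y * P) * (act N g * Q)" using dg d by (simp add: mm)
    also have "\<dots> + act K g * Y = act K g * Y" unfolding YP using dg d by (simp add: K mm)
    finally show ?thesis .
  qed
  have gX: "act M g * X = X * act K g" if g: "g \<in> carrier G" for g
  proof -
    note dg = is_rep_dims[OF M g] is_rep_dims[OF N g]
    have "act M g * X = (P * Q + X * Y) * (act M g * X)" using dg by (simp add: sum1 mm)
    also have "\<dots> = P * ((Q * act M g) * X) + X * act K g" using dg d by (simp add: K mm)
    also have "Q * act M g = act N g * Q" using rep_homD(3)[OF Q g] by simp
    also have "P * ((act N g * Q) * X) = P * (act N g * (Q * X))" using dg d by (simp add: mm)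
    also have "\<dots> + X * act K g = X * act K g" unfolding QX using dg d by (simp add: K mm)
    finally show ?thesis .
  qed
  have repK: "is_rep G K"
  proof (rule is_repI)
    fix g h assume gh: "g \<in> carrier G" "h \<in> carrier G"
    note dg = is_rep_dims[OF M gh(1)] is_rep_dims[OF M gh(2)]
    have "act K g * act K h = (act K g * Y) * (act M h * X)" using dg by (simp add: K mm)
    also have "\<dots> = Y * act M g * (act M h * X)" using Yg[OF gh(1)] by simp
    also have "\<dots> = act K (g \<otimes>\<^bsub>G\<^esub> h)" using dg is_repD(2)[OF M gh] by (simp add: K mm)
    finally show "act K (g \<otimes>\<^bsub>G\<^esub> h) = act K g * act K h" ..
  qed (use is_repD(1)[OF M] YX in \<open>simp_all add: K mm\<close>)
  show thesis
  proof (rule that[OF repK])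
    show X: "X \<in> rep_hom G K M" by (rule rep_homI) (simp_all add: K(1) gX)
    show Y: "Y \<in> rep_hom G M K" by (rule rep_homI) (simp_all add: K(1) Yg)
    show "Y * X = 1\<^sub>m (rdim K)" by (simp add: K YX)
    have AB: "vcat Q Y * hcat P X = 1\<^sub>m (?n + r)"
      using d by (simp add: vcat_mult_hcat QP QX YP YX)
    have BA: "hcat P X * vcat Q Y = 1\<^sub>m ?m"
      using d by (simp add: hcat_mult_vcat sum1)
    have "?n + r = ?m"
      by (rule square_if_inverse[OF _ _ AB BA]; rule carrier_matI) (use d in simp_all)
    then show "rdim M = rdim N + rdim K" by (simp add: K)
    show "rep_iso G M (rep_sum N K)"
    proof (rule rep_isoI[of "vcat Q Y" _ _ _ "hcat P X"])
      show "vcat Q Y \<in> rep_hom G M (rep_sum N K)"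
      proof (rule rep_homI)
        fix g assume g: "g \<in> carrier G"
        note dg = is_rep_dims[OF M g] is_rep_dims[OF N g] is_rep_dims[OF repK g]
        have "vcat Q Y * act M g = vcat (act N g * Q) (act K g * Y)"
          using dg d Yg[OF g] rep_homD(3)[OF Q g] by (simp add: vcat_mult)
        also have "\<dots> = act (rep_sum N K) g * vcat Q Y"
          using dg d by (simp add: four_block_mult_vcat K(1) mm)
        finally show "vcat Q Y * act M g = act (rep_sum N K) g * vcat Q Y" .
      qed (use d in \<open>auto simp: K(1)\<close>)
    qed (use d AB BA in \<open>simp_all add: K(1)\<close>)
  qed
qed

text \<open>An invertible composite is as good as 1: the inverse of a bijective endomorphism is
  again an endomorphism and can be absorbed into \<open>Q\<close>. A pairing of a basis with
  functionals therefore only has to be triangular.\<close>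

lemma split_hom:
  assumes M: "is_rep G M" and N: "is_rep G N" and P: "P \<in> rep_hom G N M" and Q: "Q \<in> rep_hom G M N"
    and R: "dim_row R = rdim N" "dim_col R = rdim N" "R * (Q * P) = 1\<^sub>m (rdim N)" "(Q * P) * R = 1\<^sub>m (rdim N)"
  obtains Q' where "Q' \<in> rep_hom G M N" "Q' * P = 1\<^sub>m (rdim N)"
proof -
  note d = rep_homD(1,2)[OF P] rep_homD(1,2)[OF Q] R(1,2)
  have QP: "Q * P \<in> rep_hom G N N" using P Q M N by (auto intro: rep_hom_comp)
  have Rh: "R \<in> rep_hom G N N"
  proof (rule rep_homI)
    fix g assume g: "g \<in> carrier G"
    note dg = is_rep_dims[OF N g]
    have "R * act N g = R * (act N g * ((Q * P) * R))" unfolding R(4) using dg d by (simp add: mm)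
    also have "\<dots> = R * ((act N g * (Q * P)) * R)" using dg d by (simp add: mm)
    also have "act N g * (Q * P) = Q * P * act N g" using rep_homD(3)[OF QP g] by simp
    also have "R * ((Q * P * act N g) * R) = (R * (Q * P)) * (act N g * R)" using dg d by (simp add: mm)
    finally show "R * act N g = act N g * R" unfolding R(3) using dg d by (simp add: mm)
  qed (use d in auto)
  show thesis
  proof (rule that)
    show "R * Q \<in> rep_hom G M N" by (rule rep_hom_comp[OF M N N Q Rh])
    show "R * Q * P = 1\<^sub>m (rdim N)" using R(3) d by (simp add: mm)
  qed
qed

subsection \<open>Tensor products with a two-dimensional factor\<close>

text \<open>Every tensor product in the argument has a left factor of dimension 2, so block matrices
  replace the index arithmetic of \<open>div\<close> and \<open>mod\<close> from here on.\<close>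

lemma kron2:
  assumes "dim_row A = 2" "dim_col A = 2"
  shows "kronecker_mat A B =
    four_block_mat (A $$ (0, 0) \<cdot>\<^sub>m B) (A $$ (0, 1) \<cdot>\<^sub>m B) (A $$ (1, 0) \<cdot>\<^sub>m B) (A $$ (1, 1) \<cdot>\<^sub>m B)"
proof (rule eq_matI)
  have divmod: "i div n = (if i < n then 0 else 1)" "i mod n = (if i < n then i else i - n)"
    if "i < n + n" for i n :: nat
    using that by (auto simp: div_eq_0_iff not_less le_div_geq le_mod_geq)
  fix i j
  assume "i < dim_row (four_block_mat (A $$ (0, 0) \<cdot>\<^sub>m B) (A $$ (0, 1) \<cdot>\<^sub>m B) (A $$ (1, 0) \<cdot>\<^sub>m B) (A $$ (1, 1) \<cdot>\<^sub>m B))"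
    "j < dim_col (four_block_mat (A $$ (0, 0) \<cdot>\<^sub>m B) (A $$ (0, 1) \<cdot>\<^sub>m B) (A $$ (1, 0) \<cdot>\<^sub>m B) (A $$ (1, 1) \<cdot>\<^sub>m B))"
  then have ij: "i < dim_row B + dim_row B" "j < dim_col B + dim_col B" by auto
  then show "kronecker_mat A B $$ (i, j) =
      four_block_mat (A $$ (0, 0) \<cdot>\<^sub>m B) (A $$ (0, 1) \<cdot>\<^sub>m B) (A $$ (1, 0) \<cdot>\<^sub>m B) (A $$ (1, 1) \<cdot>\<^sub>m B) $$ (i, j)"
    by (auto simp: kronecker_mat_def assms mult_2 divmod)
qed (auto simp: kronecker_mat_def assms)

lemma mat2_simps [simp]:
  "dim_row (mat2 a b c d) = 2" "dim_col (mat2 a b c d) = 2"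
  "mat2 a b c d $$ (0, 0) = a" "mat2 a b c d $$ (0, 1) = b" "mat2 a b c d $$ (0, Suc 0) = b"
  "mat2 a b c d $$ (1, 0) = c" "mat2 a b c d $$ (Suc 0, 0) = c"
  "mat2 a b c d $$ (1, 1) = d" "mat2 a b c d $$ (Suc 0, Suc 0) = d"
  by (simp_all add: mat2_def mat_of_rows_list_def)

lemma mat2_cases:
  assumes "dim_row A = 2" "dim_col A = 2"
  shows "A = mat2 (A $$ (0, 0)) (A $$ (0, 1)) (A $$ (1, 0)) (A $$ (1, 1))"
  by (rule eq_matI) (use assms in \<open>auto simp: less_2_cases_iff\<close>)

lemma mat2_inject:
  "mat2 a b c d = mat2 a' b' c' d' \<longleftrightarrow> a = a' \<and> b = b' \<and> c = c' \<and> d = d'"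
proof
  assume *: "mat2 a b c d = mat2 a' b' c' d'"
  show "a = a' \<and> b = b' \<and> c = c' \<and> d = d'"
    using arg_cong[OF *, of "\<lambda>A. A $$ (0,0)"] arg_cong[OF *, of "\<lambda>A. A $$ (0,1)"]
      arg_cong[OF *, of "\<lambda>A. A $$ (1,0)"] arg_cong[OF *, of "\<lambda>A. A $$ (1,1)"] by simp
qed simp

lemma mat2_mult:
  "mat2 a b c d * mat2 a' b' c' d' =
    mat2 (a * a' + b * c') (a * b' + b * d') (c * a' + d * c') (c * b' + d * d')"
  by (rule eq_matI) (auto simp: less_2_cases_iff mat_mult_entry numeral_2_eq_2 less_Suc_eq simp del: index_mult_mat(1))

lemma mat2_one: "mat2 1 0 0 1 = 1\<^sub>m 2"
  by (rule eq_matI) (auto simp: less_2_cases_iff)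

lemma mat2_transpose: "transpose_mat (mat2 a b c d) = mat2 a c b d"
  by (rule eq_matI) (auto simp: less_2_cases_iff)

lemma det_mat2: "det (mat2 a b c d) = a * d - b * c"
proof -
  have "mat_delete (mat2 a b c d) 0 j = mat 1 1 (\<lambda>_. if j = 0 then d else c)" if "j < 2" for j
    using that by (intro eq_matI) (auto simp: mat_delete_def less_2_cases_iff)
  then show ?thesis
    by (subst laplace_expansion_row[of _ 2 0])
      (auto intro!: carrier_matI simp: numeral_2_eq_2 cofactor_def det_single)
qed

lemma kron2_dim:
  assumes "dim_row A = 2" "dim_col A = 2"
  shows "dim_row (kronecker_mat A B) = dim_row B + dim_row B" "dim_col (kronecker_mat A B) = dim_col B + dim_col B"
  by (simp_all add: kron2[OF assms])

lemma kron2_mult: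
  assumes "dim_row A = 2" "dim_col A = 2" "dim_row A' = 2" "dim_col A' = 2" "dim_col B = dim_row B'"
  shows "kronecker_mat A B * kronecker_mat A' B' = kronecker_mat (A * A') (B * B')"
proof -
  have e: "A * A' = mat2 (A$$(0,0)*A'$$(0,0) + A$$(0,1)*A'$$(1,0)) (A$$(0,0)*A'$$(0,1) + A$$(0,1)*A'$$(1,1))
     (A$$(1,0)*A'$$(0,0) + A$$(1,1)*A'$$(1,0)) (A$$(1,0)*A'$$(0,1) + A$$(1,1)*A'$$(1,1))"
    by (subst mat2_cases[OF assms(1,2)], subst mat2_cases[OF assms(3,4)]) (simp only: mat2_mult)
  show ?thesis
    unfolding e kron2[OF assms(1,2)] kron2[OF assms(3,4)] kron2[OF mat2_simps(1,2)]
    by (subst four_block_mult)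
      (use assms(5) in \<open>auto intro!: cong_four_block_mat eq_matI simp: mm algebra_simps simp del: index_mult_mat(1)\<close>)
qed

lemma kron2_one: "kronecker_mat (1\<^sub>m 2) (1\<^sub>m n) = 1\<^sub>m (n + n)"
  by (subst kron2) (auto intro!: eq_matI)

text \<open>\<open>C0\<close> and \<open>C1\<close> are the restrictions of a map out of
  \<open>V \<otimes> W\<close> to the two copies of \<open>W\<close>.\<close>

lemma hcat_kron2:
  assumes "dim_row A = 2" "dim_col A = 2" "dim_col C0 = dim_row B" "dim_col C1 = dim_row B" "dim_row C0 = dim_row C1"
  shows "hcat C0 C1 * kronecker_mat A B =
    hcat ((A $$ (0, 0) \<cdot>\<^sub>m C0 + A $$ (1, 0) \<cdot>\<^sub>m C1) * B) ((A $$ (0, 1) \<cdot>\<^sub>m C0 + A $$ (1, 1) \<cdot>\<^sub>m C1) * B)"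
  unfolding kron2[OF assms(1,2)] by (subst hcat_mult_four_block) (use assms in \<open>auto simp: mm\<close>)

lemma kron2_vcat:
  assumes "dim_row A = 2" "dim_col A = 2" "dim_row R0 = dim_col B" "dim_row R1 = dim_col B" "dim_col R0 = dim_col R1"
  shows "kronecker_mat A B * vcat R0 R1 =
    vcat (B * (A $$ (0, 0) \<cdot>\<^sub>m R0 + A $$ (0, 1) \<cdot>\<^sub>m R1)) (B * (A $$ (1, 0) \<cdot>\<^sub>m R0 + A $$ (1, 1) \<cdot>\<^sub>m R1))"
  unfolding kron2[OF assms(1,2)] by (subst four_block_mult_vcat) (use assms in \<open>auto simp: mm\<close>)

lemma hcat_mat2:
  assumes "dim_col C0 = 1" "dim_col C1 = 1" "dim_row C0 = dim_row C1"
  shows "hcat C0 C1 * mat2 a b c d = hcat (a \<cdot>\<^sub>m C0 + c \<cdot>\<^sub>m C1) (b \<cdot>\<^sub>m C0 + d \<cdot>\<^sub>m C1)"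
  by (rule eq_matI)
    (use assms in \<open>auto simp: mat_mult_entry hcat_def numeral_2_eq_2 less_Suc_eq algebra_simps simp del: index_mult_mat(1)\<close>)

lemma mat2_vcat:
  assumes "dim_row R0 = 1" "dim_row R1 = 1" "dim_col R0 = dim_col R1"
  shows "mat2 a b c d * vcat R0 R1 = vcat (a \<cdot>\<^sub>m R0 + b \<cdot>\<^sub>m R1) (c \<cdot>\<^sub>m R0 + d \<cdot>\<^sub>m R1)"
  by (rule eq_matI)
    (use assms in \<open>auto simp: mat_mult_entry vcat_def numeral_2_eq_2 less_Suc_eq algebra_simps simp del: index_mult_mat(1)\<close>)

lemma rep_tensor_simps [simp]:
  "rdim (rep_tensor M N) = rdim M * rdim N"
  "act (rep_tensor M N) g = kronecker_mat (act M g) (act N g)"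
  by (simp_all add: rep_tensor_def)

lemma rep_restrict_simps [simp]:
  "rdim (rep_restrict \<phi> M) = rdim M" "act (rep_restrict \<phi> M) g = act M (\<phi> g)"
  by (simp_all add: rep_restrict_def)

lemma is_rep_tensor2:
  assumes "is_rep G M" "rdim M = 2" "is_rep G N"
  shows "is_rep G (rep_tensor M N)"
  by (rule is_repI)
    (use assms in \<open>simp_all add: kron2_dim is_rep_dims is_repD kron2_mult kron2_one mult_2\<close>)

lemma rep_iso_tensor2:
  assumes "rep_iso G M M'" "is_rep G M" "is_rep G M'" "rdim M = 2" "rdim M' = 2" "is_rep G N"
  shows "rep_iso G (rep_tensor M N) (rep_tensor M' N)"
proof -
  from assms obtain A B where A: "A \<in> rep_hom G M M'" "B \<in> rep_hom G M' M" "A * B = 1\<^sub>m (rdim M')"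
    "B * A = 1\<^sub>m (rdim M)" by (elim rep_isoE)
  note d = rep_homD(1,2)[OF A(1)] rep_homD(1,2)[OF A(2)]
  show ?thesis
  proof (rule rep_isoI[of "kronecker_mat A (1\<^sub>m (rdim N))" _ _ _ "kronecker_mat B (1\<^sub>m (rdim N))"])
    show "kronecker_mat A (1\<^sub>m (rdim N)) \<in> rep_hom G (rep_tensor M N) (rep_tensor M' N)"
      by (rule rep_homI)
        (use d assms rep_homD(3)[OF A(1)] in \<open>simp_all add: kron2_dim is_rep_dims kron2_mult mm mult_2\<close>)
  qed (use d A assms in \<open>simp_all add: kron2_dim is_rep_dims kron2_mult kron2_one mm mult_2\<close>)
qed

lemma is_rep_restrict:
  assumes "is_rep H M" "\<phi> \<in> hom G H" "group G" "group H"
  shows "is_rep G (rep_restrict \<phi> M)"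
proof (rule is_repI)
  interpret group_hom G H \<phi> using assms by (simp add: group_hom_def group_hom_axioms_def)
  show "act (rep_restrict \<phi> M) \<one>\<^bsub>G\<^esub> = 1\<^sub>m (rdim (rep_restrict \<phi> M))"
    using is_repD(1)[OF assms(1)] by simp
qed (use assms is_repD(2)[OF assms(1)] in \<open>auto simp: is_rep_dims hom_in_carrier hom_mult\<close>)

lemma rep_iso_restrict:
  assumes "rep_iso H M N" "\<phi> \<in> hom G H"
  shows "rep_iso G (rep_restrict \<phi> M) (rep_restrict \<phi> N)"
  using assms unfolding rep_iso_def rep_hom_def by (auto simp: hom_in_carrier) 

subsection \<open>Commuting pairs of square-zero matrices\<close>

lemma char2_add_self: "CHAR('k) = 2 \<Longrightarrow> x + x = (0 :: 'k::field)"
  using of_nat_CHAR[where ?'a = 'k] by (simp add: mult_2[symmetric])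

lemma char2_two: "CHAR('k) = 2 \<Longrightarrow> (2 :: 'k::field) = 0"
  using of_nat_CHAR[where ?'a = 'k] by simp

lemma char2_add_left_self: "CHAR('k) = 2 \<Longrightarrow> x + (x + y) = (y :: 'k::field)"
  by (simp add: char2_add_self add.assoc[symmetric])

text \<open>A relation \<open>A * B = C\<close> does not match inside the right-nested product
  \<open>A * (B * X)\<close>. The extended rule closes this gap, so that the simplifier can compute
  modulo the relations between \<open>z\<close> and \<open>u\<close>.\<close>

lemma mat_assoc_rule:
  "A * B = C \<Longrightarrow> dim_col A = dim_row B \<Longrightarrow> dim_col B = dim_row X \<Longrightarrow> A * (B * X) = C * (X :: 'k::field mat)"
  by (simp add: mm_assoc[symmetric])

lemma mat_assoc_rule2:
  "A * B = C * D \<Longrightarrow> dim_col A = dim_row B \<Longrightarrow> dim_col B = dim_row X \<Longrightarrow> dim_col C = dim_row D \<Longrightarrow>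
    dim_col D = dim_row X \<Longrightarrow> A * (B * X) = C * (D * (X :: 'k::field mat))"
  by (simp add: mm_assoc[symmetric])

text \<open>A nonzero entry suffices. The value \<open>c\<close> is left free so that it can cancel
  the scalar by which the later basis vectors are divided.\<close>

lemma exists_pairing:
  fixes A :: "'k::field mat"
  assumes "A \<noteq> 0\<^sub>m (dim_row A) (dim_col A)"
  obtains y v where "dim_row y = 1" "dim_col y = dim_row A" "dim_row v = dim_col A" "dim_col v = 1"
    "y * (A * v) = c \<cdot>\<^sub>m 1\<^sub>m 1"
proof -
  from assms obtain i j where ij: "i < dim_row A" "j < dim_col A" "A $$ (i, j) \<noteq> 0"
    by (metis eq_matI index_zero_mat(1) index_zero_mat(2) index_zero_mat(3))
  define y where "y = mat 1 (dim_row A) (\<lambda>(_, k). if k = i then c / A $$ (i, j) else 0)"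
  define v where "v = mat (dim_col A) 1 (\<lambda>(k, _). if k = j then 1 else 0 :: 'k)"
  have Av: "A * v = mat (dim_row A) 1 (\<lambda>(k, _). A $$ (k, j))"
    using ij by (intro eq_matI) (auto simp: mat_mult_entry v_def if_distrib[where f = "\<lambda>x. y * x" for y] 
        cong: if_cong simp del: index_mult_mat(1))
  have "y * (A * v) = c \<cdot>\<^sub>m 1\<^sub>m 1"
    unfolding Av using ij by (intro eq_matI) (auto simp: mat_mult_entry y_def if_distrib[where f = "\<lambda>x. x * y" for y] 
        cong: if_cong simp del: index_mult_mat(1))
  then show thesis using that[of y v] by (auto simp: y_def v_def)
qed

text \<open>
  Linear forms, stable under passage to summands, of the following two properties: the kernel of \<open>z\<close>
  is its image, and \<open>u v = z w\<close> implies \<open>u w \<in> im (z u)\<close>.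
\<close>

definition split_pair :: "nat \<Rightarrow> 'k::field mat \<Rightarrow> 'k mat \<Rightarrow> bool" where
  "split_pair n z u \<longleftrightarrow> (\<exists>h a b c. h \<in> carrier_mat n n \<and> a \<in> carrier_mat n n \<and> b \<in> carrier_mat n n \<and>
     c \<in> carrier_mat n n \<and> z * h + h * z = 1\<^sub>m n \<and> c * u = z * u * a \<and> u = z * u * b + c * z)"

text \<open>Each equation is linear in the unknowns, with \<open>z\<close> and \<open>u\<close> only
  as outer factors, and \<open>I\<close> and \<open>J\<close> commute past these. Compression
  \<open>J * _ * I\<close> therefore carries a solution on the whole space to one on the
  summand.\<close>

lemma split_pair_summand:
  assumes sp: "split_pair n z u"
    and d: "dim_row z = n" "dim_col z = n" "dim_row u = n" "dim_col u = n"
      "dim_row z' = k" "dim_col z' = k" "dim_row u' = k" "dim_col u' = k"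
      "dim_row I = n" "dim_col I = k" "dim_row J = k" "dim_col J = n"
    and JI: "J * I = 1\<^sub>m k" and zI: "z * I = I * z'" "u * I = I * u'" "J * z = z' * J" "J * u = u' * J"
  shows "split_pair k z' u'"
proof -
  from sp obtain h a b c where c: "h \<in> carrier_mat n n" "a \<in> carrier_mat n n" "b \<in> carrier_mat n n"
     "c \<in> carrier_mat n n" and e: "z * h + h * z = 1\<^sub>m n" "c * u = z * u * a" "u = z * u * b + c * z"
    by (auto simp: split_pair_def)
  have dd [simp]: "dim_row h = n" "dim_col h = n" "dim_row a = n" "dim_col a = n" "dim_row b = n" "dim_col b = n"
    "dim_row c = n" "dim_col c = n" using c by (auto simp: carrier_matD)
  note d [simp]
  have r: "\<And>X. dim_row X = n \<Longrightarrow> z' * (J * X) = J * (z * X)" "\<And>X. dim_row X = n \<Longrightarrow> u' * (J * X) = J * (u * X)"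
    using mat_assoc_rule2[OF zI(3)] mat_assoc_rule2[OF zI(4)] by simp_all
  have r': "I * z' = z * I" "I * u' = u * I" using zI by simp_all
  have "z' * (J * h * I) + (J * h * I) * z' = J * (z * h + h * z) * I"
    by (simp add: mm r r')
  then have 1: "z' * (J * h * I) + (J * h * I) * z' = 1\<^sub>m k" by (simp add: e JI mm)
  have "(J * c * I) * u' = J * (c * u) * I" by (simp add: mm r')
  also have "\<dots> = z' * u' * (J * a * I)" unfolding e(2) by (simp add: mm r)
  finally have 2: "(J * c * I) * u' = z' * u' * (J * a * I)" .
  have "u' = J * I * u'" by (simp add: JI mm)
  also have "\<dots> = J * u * I" by (simp add: r' mm)
  also have "\<dots> = J * (z * u * b + c * z) * I" using e(3) by simp
  also have "\<dots> = z' * u' * (J * b * I) + J * c * I * z'" by (simp add: mm r r')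
  finally have 3: "u' = z' * u' * (J * b * I) + J * c * I * z'" .
  show ?thesis unfolding split_pair_def
    by (rule exI[of _ "J * h * I"], rule exI[of _ "J * a * I"], rule exI[of _ "J * b * I"], rule exI[of _ "J * c * I"])
      (use 1 2 3 in \<open>auto intro!: carrier_matI\<close>)
qed

lemma four_block_add:
  assumes "dim_row A = r1" "dim_row B = r1" "dim_row P = r1" "dim_row Q = r1"
    "dim_row C = r2" "dim_row D = r2" "dim_row R = r2" "dim_row S = r2"
    "dim_col A = c1" "dim_col C = c1" "dim_col P = c1" "dim_col R = c1"
    "dim_col B = c2" "dim_col D = c2" "dim_col Q = c2" "dim_col S = c2"
  shows "four_block_mat A B C D + four_block_mat P Q R S = four_block_mat (A + P) (B + Q) (C + R) (D + S)"
  by (rule add_four_block_mat[of A r1 c1 B c2 C r2]; rule carrier_matI; simp only: assms)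

text \<open>Here \<open>a\<close> and \<open>b\<close> are the operators \<open>z\<^sub>1\<close>
  and \<open>z\<^sub>2\<close> of \<open>X\<close>. The two block matrices are \<open>z\<close> and
  \<open>u\<close> on \<open>V \<otimes> X\<close>, obtained by expanding the tensor product of
  \<open>mat2 1 0 l1 1\<close> with \<open>1 + l1 a\<close>, and likewise for \<open>l2\<close> and
  \<open>b\<close>.\<close>

lemma split_pair_tensor:
  fixes a b :: "'k::field mat"
  assumes c2: "CHAR('k) = 2"
    and d [simp]: "dim_row a = n" "dim_col a = n" "dim_row b = n" "dim_col b = n"
    and aa: "a * a = 0\<^sub>m n n" and bb: "b * b = 0\<^sub>m n n" and ba: "b * a = a * b"
  shows "split_pair (n + n) (four_block_mat a (0\<^sub>m n n) (1\<^sub>m n + l1 \<cdot>\<^sub>m a) a)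
     (four_block_mat (a + b) (0\<^sub>m n n) (l1 \<cdot>\<^sub>m a + l2 \<cdot>\<^sub>m b) (a + b))"
proof -
  have r: "a * (a * X) = 0\<^sub>m n (dim_col X)" "b * (b * X) = 0\<^sub>m n (dim_col X)" "b * (a * X) = a * (b * X)"
    if "dim_row X = n" for X
    using mat_assoc_rule[OF aa] mat_assoc_rule[OF bb] mat_assoc_rule2[OF ba] that by (simp_all add: mm)
  note c2s = char2_two[OF c2] char2_add_self[OF c2] char2_add_left_self[OF c2]
  \<comment> \<open>As \<open>a * a = 0\<close> and \<open>2 = 0\<close>, this matrix is its own
    inverse. It is the lower left block of \<open>z\<close>; placed at the upper right of
    \<open>h\<close> it makes both diagonal blocks of \<open>z h + h z\<close> equal to 1, and the
    upper right block becomes \<open>2 a e = 0\<close>.\<close>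
  define e where "e = 1\<^sub>m n + l1 \<cdot>\<^sub>m a"
  have de [simp]: "dim_row e = n" "dim_col e = n" by (simp_all add: e_def)
  let ?z = "four_block_mat a (0\<^sub>m n n) (1\<^sub>m n + l1 \<cdot>\<^sub>m a) a"
  let ?u = "four_block_mat (a + b) (0\<^sub>m n n) (l1 \<cdot>\<^sub>m a + l2 \<cdot>\<^sub>m b) (a + b)"
  let ?h = "four_block_mat (0\<^sub>m n n) e (0\<^sub>m n n) (0\<^sub>m n n)"
  \<comment> \<open>\<open>?\<alpha>\<close>, \<open>?\<beta>\<close>, \<open>?\<gamma>\<close> play
    the parts of \<open>a\<close>, \<open>b\<close>, \<open>c\<close> in \<open>split_pair\<close>.
    Both sides of the second equation become the block matrix with upper row 0 and lower row
    \<open>(l1 + l2) l2 a b\<close>, \<open>(l1 + l2) a b\<close>.\<close>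
  let ?\<alpha> = "four_block_mat (0\<^sub>m n n) (0\<^sub>m n n) (((l1 + l2) * l2) \<cdot>\<^sub>m 1\<^sub>m n) ((l1 + l2) \<cdot>\<^sub>m 1\<^sub>m n)"
  let ?\<beta> = "four_block_mat (l2 \<cdot>\<^sub>m e) e ((l2 * l2) \<cdot>\<^sub>m e) (l2 \<cdot>\<^sub>m e)"
  let ?\<gamma> = "four_block_mat ((l1 + l2) \<cdot>\<^sub>m b) (a + b) (0\<^sub>m n n) ((l1 + l2) \<cdot>\<^sub>m a)"
  have "?z * ?h + ?h * ?z = four_block_mat (1\<^sub>m n) (0\<^sub>m n n) (0\<^sub>m n n) (1\<^sub>m n)"
    apply (simp add: four_block_mult four_block_add mm del: four_block_one_mat)
    apply (intro cong_four_block_mat; simp add: e_def mm aa; (rule eq_matI; simp del: index_mult_mat(1) index_one_mat(1))?)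
    apply (simp_all add: c2s algebra_simps)
    done
  then have 1: "?z * ?h + ?h * ?z = 1\<^sub>m (n + n)" by simp
  have 2: "?\<gamma> * ?u = ?z * ?u * ?\<alpha>"
    apply (simp add: four_block_mult mm e_def)
    apply (intro cong_four_block_mat; simp add: mm aa bb ba r; (rule eq_matI; simp del: index_mult_mat(1) index_one_mat(1))?)
    apply (simp_all add: c2s algebra_simps)
    done
  have 3: "?u = ?z * ?u * ?\<beta> + ?\<gamma> * ?z"
    apply (simp add: four_block_mult four_block_add mm e_def)
    apply (intro cong_four_block_mat; simp add: mm aa bb ba r; (rule eq_matI; simp del: index_mult_mat(1) index_one_mat(1))?)
    apply (simp_all add: c2s algebra_simps)
    done
  have 4: "?h \<in> carrier_mat (n + n) (n + n)" "?\<alpha> \<in> carrier_mat (n + n) (n + n)"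
    "?\<beta> \<in> carrier_mat (n + n) (n + n)" "?\<gamma> \<in> carrier_mat (n + n) (n + n)"
    by (rule carrier_matI; simp)+
  show ?thesis unfolding split_pair_def
    by (rule exI[of _ ?h], rule exI[of _ ?\<alpha>], rule exI[of _ ?\<beta>], rule exI[of _ ?\<gamma>], intro conjI;
      fact 1 2 3 4)
qed

section \<open>Equivariant families of columns and rows, and their pairings\<close>

lemma hcat_add:
  assumes "dim_row A = m" "dim_row B = m" "dim_row C = m" "dim_row D = m"
    "dim_col A = k" "dim_col B = l" "dim_col C = k" "dim_col D = l"
  shows "hcat A B + hcat C D = hcat (A + C) (B + D)"
  by (rule eq_matI) (simp_all add: assms hcat_def)

lemma vcat_add:
  assumes "dim_row A = k" "dim_row B = l" "dim_row C = k" "dim_row D = l"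
    "dim_col A = m" "dim_col B = m" "dim_col C = m" "dim_col D = m"
  shows "vcat A B + vcat C D = vcat (A + C) (B + D)"
  by (rule eq_matI) (simp_all add: assms vcat_def)

lemma hcat_smult: "dim_row A = dim_row B \<Longrightarrow> c \<cdot>\<^sub>m hcat A B = hcat (c \<cdot>\<^sub>m A) (c \<cdot>\<^sub>m B)"
  by (rule eq_matI) (simp_all add: hcat_def)

lemma vcat_smult: "dim_col A = dim_col B \<Longrightarrow> c \<cdot>\<^sub>m vcat A B = vcat (c \<cdot>\<^sub>m A) (c \<cdot>\<^sub>m B)"
  by (rule eq_matI) (simp_all add: vcat_def)

lemma unitriangular_inverse:
  fixes A :: "'k::field mat"
  assumes "dim_row A = n" "dim_col A = n" "\<And>i j. i < j \<Longrightarrow> j < n \<Longrightarrow> A $$ (i, j) = 0"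
    "\<And>i. i < n \<Longrightarrow> A $$ (i, i) = 1"
  obtains R where "dim_row R = n" "dim_col R = n" "R * A = 1\<^sub>m n" "A * R = 1\<^sub>m n"
proof -
  have A: "A \<in> carrier_mat n n" using assms by (intro carrier_matI)
  have "diag_mat A = map (\<lambda>i. 1) [0..<n]" using assms by (auto simp: diag_mat_def)
  then have "prod_list (diag_mat A) = 1" by (simp add: map_replicate_const)
  then have "det A \<noteq> 0" using det_lower_triangular[OF assms(3) A] by simp
  from det_non_zero_imp_unit[OF A this, of "()"]
  show thesis using that by (auto simp: Units_def ring_mat_def carrier_matD)
qed

text \<open>The columns are the images of the tensor basis
  \<open>e\<^sub>i \<otimes> e\<^sub>j\<close>, and the four equations expand the action of the two
  unipotent matrices on this basis, with \<open>l\<close> for the first factor and \<open>m\<close>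
  for the second.\<close>

lemma columns_equivariant4:
  assumes "dim_row x = n" "dim_col x = n"
    "dim_row e00 = n" "dim_row e01 = n" "dim_row e10 = n" "dim_row e11 = n"
    "dim_col e00 = 1" "dim_col e01 = 1" "dim_col e10 = 1" "dim_col e11 = 1"
    "x * e00 = e00 + l \<cdot>\<^sub>m e10 + (m \<cdot>\<^sub>m e01 + (m * l) \<cdot>\<^sub>m e11)" "x * e01 = e01 + l \<cdot>\<^sub>m e11"
    "x * e10 = e10 + m \<cdot>\<^sub>m e11" "x * e11 = e11"
  shows "hcat (hcat e00 e01) (hcat e10 e11) * kronecker_mat (mat2 1 0 l 1) (mat2 1 0 m 1) =
    x * hcat (hcat e00 e01) (hcat e10 e11)"
  using assms by (simp add: mult_hcat hcat_kron2 mm hcat_mat2 hcat_smult hcat_add)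

text \<open>The same for a map into the tensor product, whose coordinates are the four rows; under
  transposition the roles of \<open>r00\<close> and \<open>r11\<close> correspond to
  \<open>e11\<close> and \<open>e00\<close>.\<close>

lemma rows_equivariant4:
  assumes "dim_row x = n" "dim_col x = n"
    "dim_col r00 = n" "dim_col r01 = n" "dim_col r10 = n" "dim_col r11 = n"
    "dim_row r00 = 1" "dim_row r01 = 1" "dim_row r10 = 1" "dim_row r11 = 1"
    "r11 * x = (m * l) \<cdot>\<^sub>m r00 + m \<cdot>\<^sub>m r10 + (l \<cdot>\<^sub>m r01 + r11)" "r10 * x = l \<cdot>\<^sub>m r00 + r10"
    "r01 * x = m \<cdot>\<^sub>m r00 + r01" "r00 * x = r00"
  shows "vcat (vcat r00 r01) (vcat r10 r11) * x =
    kronecker_mat (mat2 1 0 l 1) (mat2 1 0 m 1) * vcat (vcat r00 r01) (vcat r10 r11)"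
  using assms by (simp add: vcat_mult kron2_vcat mm mat2_vcat vcat_smult vcat_add)

lemma columns_equivariant2:
  assumes "dim_row x = n" "dim_col x = n" "dim_row e0 = n" "dim_row e1 = n" "dim_col e0 = 1" "dim_col e1 = 1"
    "x * e0 = e0 + l \<cdot>\<^sub>m e1" "x * e1 = e1"
  shows "hcat e0 e1 * kronecker_mat (mat2 1 0 l 1) (1\<^sub>m 1) = x * hcat e0 e1"
  using assms by (simp add: mult_hcat hcat_kron2 mm)

lemma rows_equivariant2:
  assumes "dim_row x = n" "dim_col x = n" "dim_col r0 = n" "dim_col r1 = n" "dim_row r0 = 1" "dim_row r1 = 1"
    "r1 * x = l \<cdot>\<^sub>m r0 + r1" "r0 * x = r0"
  shows "vcat r0 r1 * x = kronecker_mat (mat2 1 0 l 1) (1\<^sub>m 1) * vcat r0 r1"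
  using assms by (simp add: vcat_mult kron2_vcat mm)

text \<open>Only the pairings on and above the diagonal are prescribed. Whatever the entries below
  it are, the matrix is lower unitriangular and so invertible.\<close>

lemma unitriangular_pairing4:
  fixes e00 :: "'k::field mat"
  assumes "dim_row e00 = n" "dim_row e01 = n" "dim_row e10 = n" "dim_row e11 = n"
    "dim_col e00 = 1" "dim_col e01 = 1" "dim_col e10 = 1" "dim_col e11 = 1"
    "dim_col r00 = n" "dim_col r01 = n" "dim_col r10 = n" "dim_col r11 = n"
    "dim_row r00 = 1" "dim_row r01 = 1" "dim_row r10 = 1" "dim_row r11 = 1"
    "r00 * e00 = 1\<^sub>m 1" "r01 * e01 = 1\<^sub>m 1" "r10 * e10 = 1\<^sub>m 1" "r11 * e11 = 1\<^sub>m 1"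
    "r00 * e01 = 0\<^sub>m 1 1" "r00 * e10 = 0\<^sub>m 1 1" "r00 * e11 = 0\<^sub>m 1 1"
    "r01 * e10 = 0\<^sub>m 1 1" "r01 * e11 = 0\<^sub>m 1 1" "r10 * e11 = 0\<^sub>m 1 1"
  obtains R where "dim_row R = 4" "dim_col R = 4"
    "R * (vcat (vcat r00 r01) (vcat r10 r11) * hcat (hcat e00 e01) (hcat e10 e11)) = 1\<^sub>m 4"
    "(vcat (vcat r00 r01) (vcat r10 r11) * hcat (hcat e00 e01) (hcat e10 e11)) * R = 1\<^sub>m 4"
proof (rule unitriangular_inverse[of _ 4])
  let ?A = "vcat (vcat r00 r01) (vcat r10 r11) * hcat (hcat e00 e01) (hcat e10 e11)"
  have A: "?A = four_block_mat (four_block_mat (1\<^sub>m 1) (0\<^sub>m 1 1) (r01 * e00) (1\<^sub>m 1))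
    (four_block_mat (0\<^sub>m 1 1) (0\<^sub>m 1 1) (0\<^sub>m 1 1) (0\<^sub>m 1 1))
    (four_block_mat (r10 * e00) (r10 * e01) (r11 * e00) (r11 * e01))
    (four_block_mat (1\<^sub>m 1) (0\<^sub>m 1 1) (r11 * e10) (1\<^sub>m 1))"
    using assms by (simp add: vcat_mult_hcat)
  show "dim_row ?A = 4" "dim_col ?A = 4" unfolding A by simp_all
  show "?A $$ (i, i) = 1" if "i < 4" for i
    using that unfolding A by (auto simp: numeral_eq_Suc less_Suc_eq simp del: index_mult_mat(1) four_block_zero_mat)
  show "?A $$ (i, j) = 0" if "i < j" "j < 4" for i j
    using that unfolding A by (auto simp: numeral_eq_Suc less_Suc_eq simp del: index_mult_mat(1) four_block_zero_mat)
qed (use that in blast)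

lemma unitriangular_pairing2:
  fixes e0 :: "'k::field mat"
  assumes "dim_row e0 = n" "dim_row e1 = n" "dim_col e0 = 1" "dim_col e1 = 1"
    "dim_col r0 = n" "dim_col r1 = n" "dim_row r0 = 1" "dim_row r1 = 1"
    "r0 * e0 = 1\<^sub>m 1" "r1 * e1 = 1\<^sub>m 1" "r0 * e1 = 0\<^sub>m 1 1"
  obtains R where "dim_row R = 2" "dim_col R = 2"
    "R * (vcat r0 r1 * hcat e0 e1) = 1\<^sub>m 2" "(vcat r0 r1 * hcat e0 e1) * R = 1\<^sub>m 2"
proof (rule unitriangular_inverse[of _ 2])
  let ?A = "vcat r0 r1 * hcat e0 e1"
  have A: "?A = four_block_mat (1\<^sub>m 1) (0\<^sub>m 1 1) (r1 * e0) (1\<^sub>m 1)"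
    using assms by (simp add: vcat_mult_hcat)
  show "dim_row ?A = 2" "dim_col ?A = 2" unfolding A by simp_all
  show "?A $$ (i, i) = 1" if "i < 2" for i
    using that unfolding A by (auto simp: numeral_eq_Suc less_Suc_eq simp del: index_mult_mat(1))
  show "?A $$ (i, j) = 0" if "i < j" "j < 2" for i j
    using that unfolding A by (auto simp: numeral_eq_Suc less_Suc_eq simp del: index_mult_mat(1))
qed (use that in blast)

section \<open>Splitting off a copy of V, of V \<otimes> V, or of the free module\<close>

lemma split_pair_case1:
  fixes z :: "'k::field mat"
  assumes d [simp]: "dim_row z = n" "dim_col z = n"
    and zz: "z * z = 0\<^sub>m n n" and sp: "split_pair n z (0\<^sub>m n n)" and n: "n > 0"
  obtains P Q R where "dim_row P = n" "dim_col P = 2" "dim_row Q = 2" "dim_col Q = n"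
    "dim_row R = 2" "dim_col R = 2" "R * (Q * P) = 1\<^sub>m 2" "(Q * P) * R = 1\<^sub>m 2"
    "\<And>l. P * kronecker_mat (mat2 1 0 l 1) (1\<^sub>m 1) = (1\<^sub>m n + l \<cdot>\<^sub>m z) * P"
    "\<And>l. Q * (1\<^sub>m n + l \<cdot>\<^sub>m z) = kronecker_mat (mat2 1 0 l 1) (1\<^sub>m 1) * Q"
proof -
  have "z \<noteq> 0\<^sub>m n n"
  proof
    assume z0: "z = 0\<^sub>m n n"
    from sp obtain h where "h \<in> carrier_mat n n" "z * h + h * z = 1\<^sub>m n" by (auto simp: split_pair_def)
    then have "1\<^sub>m n = (0\<^sub>m n n :: 'k mat)" using z0 by (simp add: mm carrier_matD)
    from arg_cong[OF this, of "\<lambda>A. A $$ (0, 0)"] n show False by simp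
  qed
  then obtain y v where yv [simp]: "dim_row y = 1" "dim_col y = n" "dim_row v = n" "dim_col v = 1"
    and p: "y * (z * v) = 1 \<cdot>\<^sub>m 1\<^sub>m 1" using exists_pairing[of z 1] by auto
  have r: "z * (z * X) = 0\<^sub>m n (dim_col X)" if "dim_row X = n" for X
    using mat_assoc_rule[OF zz] that by (simp add: mm)
  \<comment> \<open>The functionals \<open>y z\<close> and \<open>y\<close> take the values 1 and
    \<open>y v\<close> on \<open>v\<close>, and 0 and 1 on \<open>z v\<close>.\<close>
  obtain R where R: "dim_row R = 2" "dim_col R = 2"
    "R * (vcat (y * z) y * hcat v (z * v)) = 1\<^sub>m 2" "(vcat (y * z) y * hcat v (z * v)) * R = 1\<^sub>m 2"
    by (rule unitriangular_pairing2[of v n "z * v" "y * z" y]) (simp_all add: mm p r)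
  show thesis
  proof (rule that[of "hcat v (z * v)" "vcat (y * z) y" R])
    show "hcat v (z * v) * kronecker_mat (mat2 1 0 l 1) (1\<^sub>m 1) = (1\<^sub>m n + l \<cdot>\<^sub>m z) * hcat v (z * v)" for l
      by (rule columns_equivariant2) (simp_all add: mm r)
    show "vcat (y * z) y * (1\<^sub>m n + l \<cdot>\<^sub>m z) = kronecker_mat (mat2 1 0 l 1) (1\<^sub>m 1) * vcat (y * z) y" for l
      by (rule rows_equivariant2) (simp_all add: mm zz, (intro eq_matI; simp add: add.commute)?)
  qed (use R in simp_all)
qed

text \<open>The basis is forced by its first vector \<open>v = e00\<close>. Equivariance under the
  two generators at \<open>v\<close> reads \<open>e01 + e10 + l1 e11 = z v\<close> and
  \<open>e01 + e10 + l2 e11 = (z + u) v\<close>, so \<open>d e11 = u v\<close> with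
  \<open>d = l1 + l2\<close>. As \<open>e11 = z e01\<close> and \<open>u e01 = 0\<close>, the vector
  \<open>d e01\<close> must be some \<open>w\<close> with \<open>z w = u v\<close> and
  \<open>u w = 0\<close>. The pairing value \<open>d\<close> turns the diagonal entries into
  1.\<close>

lemma split_pair_case2:
  fixes z u :: "'k::field mat"
  assumes c2: "CHAR('k) = 2"
    and d [simp]: "dim_row z = n" "dim_col z = n" "dim_row u = n" "dim_col u = n"
    and zz: "z * z = 0\<^sub>m n n" and uu: "u * u = 0\<^sub>m n n" and uz: "u * z = 0\<^sub>m n n" and zu: "z * u = 0\<^sub>m n n"
    and sp: "split_pair n z u" and u: "u \<noteq> 0\<^sub>m n n" and l12: "l1 + l2 \<noteq> 0"
  obtains P Q R where "dim_row P = n" "dim_col P = 4" "dim_row Q = 4" "dim_col Q = n"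
    "dim_row R = 4" "dim_col R = 4" "R * (Q * P) = 1\<^sub>m 4" "(Q * P) * R = 1\<^sub>m 4"
    "P * kronecker_mat (mat2 1 0 l1 1) (mat2 1 0 l1 1) = (1\<^sub>m n + l1 \<cdot>\<^sub>m z) * P"
    "Q * (1\<^sub>m n + l1 \<cdot>\<^sub>m z) = kronecker_mat (mat2 1 0 l1 1) (mat2 1 0 l1 1) * Q"
    "P * kronecker_mat (mat2 1 0 l2 1) (mat2 1 0 l2 1) = (1\<^sub>m n + l2 \<cdot>\<^sub>m (z + u)) * P"
    "Q * (1\<^sub>m n + l2 \<cdot>\<^sub>m (z + u)) = kronecker_mat (mat2 1 0 l2 1) (mat2 1 0 l2 1) * Q"
proof -
  note c2s = char2_two[OF c2] char2_add_self[OF c2] char2_add_left_self[OF c2]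
  from sp obtain h a b c where c: "h \<in> carrier_mat n n" "a \<in> carrier_mat n n" "b \<in> carrier_mat n n"
     "c \<in> carrier_mat n n" and e: "z * h + h * z = 1\<^sub>m n" "c * u = z * u * a" "u = z * u * b + c * z"
    by (auto simp: split_pair_def)
  have dd [simp]: "dim_row h = n" "dim_col h = n" "dim_row a = n" "dim_col a = n" "dim_row b = n" "dim_col b = n"
    "dim_row c = n" "dim_col c = n" using c by (auto simp: carrier_matD)
  \<comment> \<open>With \<open>z u = 0\<close> the equations shrink to \<open>c z = u\<close> and
    \<open>c u = 0\<close>, from which \<open>u w = c z w = c u v = 0\<close> below.\<close>
  have cu: "c * u = 0\<^sub>m n n" and cz: "c * z = u" using e(2,3) by (simp_all add: zu mm)
  define d where "d = l1 + l2"
  define di where "di = inverse d"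
  have di: "d * di = 1" "d * (di * x) = x" for x using l12 by (simp_all add: di_def d_def)
  have l2: "l2 = l1 + d" by (simp add: d_def c2s)
  obtain y v where yv [simp]: "dim_row y = 1" "dim_col y = n" "dim_row v = n" "dim_col v = 1"
    and p0: "y * (u * v) = d \<cdot>\<^sub>m 1\<^sub>m 1" using exists_pairing[of u d] u by auto
  \<comment> \<open>\<open>h\<close> is a contracting homotopy for \<open>z\<close>; it turns
    \<open>u v\<close>, which \<open>z\<close> annihilates, into a preimage of \<open>u v\<close>
    under \<open>z\<close>.\<close>
  define w where "w = h * (u * v)"
  have dw [simp]: "dim_row w = n" "dim_col w = 1" by (simp_all add: w_def)
  have uv: "u * v = z * w"
  proof -
    have "u * v = (z * h + h * z) * (u * v)" unfolding e(1) by (simp add: mm)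
    also have "\<dots> = z * w + h * ((z * u) * v)" by (simp add: w_def mm)
    finally show ?thesis by (simp add: zu mm)
  qed
  have uw: "u * w = 0\<^sub>m n 1"
  proof -
    have "u * w = c * (z * w)" by (simp add: cz[symmetric] mm)
    also have "\<dots> = (c * u) * v" by (simp add: uv[symmetric] mm)
    finally show ?thesis by (simp add: cu mm)
  qed
  have p: "y * (z * w) = d \<cdot>\<^sub>m 1\<^sub>m 1" using p0 by (simp add: uv)
  \<comment> \<open>The second summand makes \<open>w' * w\<close> vanish.\<close>
  define w' where "w' = y * c + (di * (y * (c * w)) $$ (0, 0)) \<cdot>\<^sub>m (y * z)"
  have dw' [simp]: "dim_row w' = 1" "dim_col w' = n" by (simp_all add: w'_def)
  have w'z: "w' * z = y * u" and w'u: "w' * u = 0\<^sub>m 1 n" by (simp_all add: w'_def mm cz cu zz zu)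
  have w'w: "w' * w = 0\<^sub>m 1 1"
    by (intro eq_matI) (simp_all add: w'_def mm p c2s di algebra_simps del: index_mult_mat(1))
  have r: "z * (z * X) = 0\<^sub>m n (dim_col X)" "u * (u * X) = 0\<^sub>m n (dim_col X)" "u * (z * X) = 0\<^sub>m n (dim_col X)"
    "z * (u * X) = 0\<^sub>m n (dim_col X)" "w' * (z * X) = y * (u * X)" "w' * (u * X) = 0\<^sub>m 1 (dim_col X)"
    if "dim_row X = n" for X
    using mat_assoc_rule[OF zz] mat_assoc_rule[OF uu] mat_assoc_rule[OF uz] mat_assoc_rule[OF zu]
      mat_assoc_rule2[OF w'z] mat_assoc_rule[OF w'u] that by (simp_all add: mm)
  \<comment> \<open>In terms of \<open>v\<close> and \<open>w\<close>, the image of the tensor basis of \<open>V \<otimes> V\<close>; the rows mirror the columns.\<close>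
  define e01 where "e01 = di \<cdot>\<^sub>m w"
  define e10 where "e10 = z * v + di \<cdot>\<^sub>m w + (l1 * di) \<cdot>\<^sub>m (z * w)"
  define e11 where "e11 = di \<cdot>\<^sub>m (z * w)"
  define r00 where "r00 = di \<cdot>\<^sub>m (y * u)"
  define r01 where "r01 = y * z + di \<cdot>\<^sub>m w' + (l1 * di) \<cdot>\<^sub>m (y * u)"
  define r10 where "r10 = di \<cdot>\<^sub>m w'"
  note defs = e01_def e10_def e11_def r00_def r01_def r10_def
  have dims [simp]: "dim_row e01 = n" "dim_row e10 = n" "dim_row e11 = n" "dim_col e01 = 1" "dim_col e10 = 1" "dim_col e11 = 1"
    "dim_col r00 = n" "dim_col r01 = n" "dim_col r10 = n" "dim_row r00 = 1" "dim_row r01 = 1" "dim_row r10 = 1"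
    by (simp_all add: defs)
  let ?P = "hcat (hcat v e01) (hcat e10 e11)"
  let ?Q = "vcat (vcat r00 r01) (vcat r10 y)"
  obtain R where R: "dim_row R = 4" "dim_col R = 4" "R * (?Q * ?P) = 1\<^sub>m 4" "(?Q * ?P) * R = 1\<^sub>m 4"
    by (rule unitriangular_pairing4[of v n e01 e10 e11 r00 r01 r10 y])
      (simp_all add: defs mm p r uv uw w'w w'z w'u, (intro eq_matI; simp add: algebra_simps c2s di l2)+)
  show thesis
  proof (rule that[of ?P ?Q R])
    show "?P * kronecker_mat (mat2 1 0 l1 1) (mat2 1 0 l1 1) = (1\<^sub>m n + l1 \<cdot>\<^sub>m z) * ?P"
      by (rule columns_equivariant4)
        (simp_all add: defs mm r uv uw, (intro eq_matI; simp add: algebra_simps c2s di l2 del: index_mult_mat(1))+)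
    show "?Q * (1\<^sub>m n + l1 \<cdot>\<^sub>m z) = kronecker_mat (mat2 1 0 l1 1) (mat2 1 0 l1 1) * ?Q"
      by (rule rows_equivariant4)
        (simp_all add: defs mm r zz uz zu uu w'z w'u, (intro eq_matI; simp add: algebra_simps c2s di l2 del: index_mult_mat(1))+)
    show "?P * kronecker_mat (mat2 1 0 l2 1) (mat2 1 0 l2 1) = (1\<^sub>m n + l2 \<cdot>\<^sub>m (z + u)) * ?P"
      by (rule columns_equivariant4)
        (simp_all add: defs mm r uv uw, (intro eq_matI; simp add: algebra_simps c2s di l2 del: index_mult_mat(1))+)
    show "?Q * (1\<^sub>m n + l2 \<cdot>\<^sub>m (z + u)) = kronecker_mat (mat2 1 0 l2 1) (mat2 1 0 l2 1) * ?Q"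
      by (rule rows_equivariant4)
        (simp_all add: defs mm r zz uz zu uu w'z w'u, (intro eq_matI; simp add: algebra_simps c2s di l2 del: index_mult_mat(1))+)
  qed (use R in simp_all)
qed

text \<open>The product \<open>z u\<close> spans the socle of the group algebra, so
  \<open>z u v \<noteq> 0\<close> makes \<open>v\<close> generate a free submodule, which splits off
  because the group algebra is self-injective; the rows built from \<open>y\<close> make this
  explicit.\<close>

lemma split_pair_case3:
  fixes z u :: "'k::field mat"
  assumes c2: "CHAR('k) = 2"
    and d [simp]: "dim_row z = n" "dim_col z = n" "dim_row u = n" "dim_col u = n"
    and zz: "z * z = 0\<^sub>m n n" and uu: "u * u = 0\<^sub>m n n" and uz: "u * z = z * u"
    and zu: "z * u \<noteq> 0\<^sub>m n n" and l12: "l1 + l2 \<noteq> 0"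
  obtains P Q R where "dim_row P = n" "dim_col P = 4" "dim_row Q = 4" "dim_col Q = n"
    "dim_row R = 4" "dim_col R = 4" "R * (Q * P) = 1\<^sub>m 4" "(Q * P) * R = 1\<^sub>m 4"
    "P * kronecker_mat (mat2 1 0 l1 1) (mat2 1 0 (l1 * l1) 1) = (1\<^sub>m n + l1 \<cdot>\<^sub>m z) * P"
    "Q * (1\<^sub>m n + l1 \<cdot>\<^sub>m z) = kronecker_mat (mat2 1 0 l1 1) (mat2 1 0 (l1 * l1) 1) * Q"
    "P * kronecker_mat (mat2 1 0 l2 1) (mat2 1 0 (l2 * l2) 1) = (1\<^sub>m n + l2 \<cdot>\<^sub>m (z + u)) * P"
    "Q * (1\<^sub>m n + l2 \<cdot>\<^sub>m (z + u)) = kronecker_mat (mat2 1 0 l2 1) (mat2 1 0 (l2 * l2) 1) * Q"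
proof -
  note c2s = char2_two[OF c2] char2_add_self[OF c2] char2_add_left_self[OF c2]
  define d where "d = l1 + l2"
  define di where "di = inverse d"
  have di: "d * di = 1" "d * (di * x) = x" for x using l12 by (simp_all add: di_def d_def)
  have l2: "l2 = l1 + d" by (simp add: d_def c2s)
  obtain y v where yv [simp]: "dim_row y = 1" "dim_col y = n" "dim_row v = n" "dim_col v = 1"
    and p0: "y * ((z * u) * v) = d \<cdot>\<^sub>m 1\<^sub>m 1" using exists_pairing[of "z * u" d] zu by auto
  have p: "y * (z * (u * v)) = d \<cdot>\<^sub>m 1\<^sub>m 1" using p0 by (simp add: mm)
  have r: "z * (z * X) = 0\<^sub>m n (dim_col X)" "u * (u * X) = 0\<^sub>m n (dim_col X)" "u * (z * X) = z * (u * X)"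
    if "dim_row X = n" for X
    using mat_assoc_rule[OF zz] mat_assoc_rule[OF uu] mat_assoc_rule2[OF uz] that by (simp_all add: mm)
  \<comment> \<open>With \<open>v = e00\<close>, equivariance at \<open>v\<close> reads
    \<open>e10 + l1 e01 + l1^2 e11 = z v\<close> and
    \<open>e10 + l2 e01 + l2^2 e11 = (z + u) v\<close>. In characteristic 2 the difference is
    \<open>d e01 + d^2 e11 = u v\<close>; together with \<open>e11 = z e01\<close> this determines
    all three vectors.\<close>
  define e01 where "e01 = di \<cdot>\<^sub>m (u * v) + z * (u * v)"
  define e10 where "e10 = z * v + (l1 * di) \<cdot>\<^sub>m (u * v) + (l1 + l1 * l1 * di) \<cdot>\<^sub>m (z * (u * v))"
  define e11 where "e11 = di \<cdot>\<^sub>m (z * (u * v))"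
  define r00 where "r00 = di \<cdot>\<^sub>m (y * (z * u))"
  define r01 where "r01 = y * z + (l1 * di) \<cdot>\<^sub>m (y * u) + (l1 + l1 * l1 * di) \<cdot>\<^sub>m (y * (z * u))"
  define r10 where "r10 = di \<cdot>\<^sub>m (y * u) + y * (z * u)"
  note defs = e01_def e10_def e11_def r00_def r01_def r10_def
  have dims [simp]: "dim_row e01 = n" "dim_row e10 = n" "dim_row e11 = n" "dim_col e01 = 1" "dim_col e10 = 1" "dim_col e11 = 1"
    "dim_col r00 = n" "dim_col r01 = n" "dim_col r10 = n" "dim_row r00 = 1" "dim_row r01 = 1" "dim_row r10 = 1"
    by (simp_all add: defs)
  let ?P = "hcat (hcat v e01) (hcat e10 e11)"
  let ?Q = "vcat (vcat r00 r01) (vcat r10 y)"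
  obtain R where R: "dim_row R = 4" "dim_col R = 4" "R * (?Q * ?P) = 1\<^sub>m 4" "(?Q * ?P) * R = 1\<^sub>m 4"
    by (rule unitriangular_pairing4[of v n e01 e10 e11 r00 r01 r10 y])
      (simp_all add: defs mm p r, (intro eq_matI; simp add: algebra_simps c2s di l2)+)
  show thesis
  proof (rule that[of ?P ?Q R])
    show "?P * kronecker_mat (mat2 1 0 l1 1) (mat2 1 0 (l1 * l1) 1) = (1\<^sub>m n + l1 \<cdot>\<^sub>m z) * ?P"
      by (rule columns_equivariant4)
        (simp_all add: defs mm r, (intro eq_matI; simp add: algebra_simps c2s di l2 del: index_mult_mat(1))+)
    show "?Q * (1\<^sub>m n + l1 \<cdot>\<^sub>m z) = kronecker_mat (mat2 1 0 l1 1) (mat2 1 0 (l1 * l1) 1) * ?Q"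
      by (rule rows_equivariant4)
        (simp_all add: defs mm r zz uz uu, (intro eq_matI; simp add: algebra_simps c2s di l2 del: index_mult_mat(1))+)
    show "?P * kronecker_mat (mat2 1 0 l2 1) (mat2 1 0 (l2 * l2) 1) = (1\<^sub>m n + l2 \<cdot>\<^sub>m (z + u)) * ?P"
      by (rule columns_equivariant4)
        (simp_all add: defs mm r, (intro eq_matI; simp add: algebra_simps c2s di l2 del: index_mult_mat(1))+)
    show "?Q * (1\<^sub>m n + l2 \<cdot>\<^sub>m (z + u)) = kronecker_mat (mat2 1 0 l2 1) (mat2 1 0 (l2 * l2) 1) * ?Q"
      by (rule rows_equivariant4)
        (simp_all add: defs mm r zz uz uu, (intro eq_matI; simp add: algebra_simps c2s di l2 del: index_mult_mat(1))+)
  qed (use R in simp_all)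
qed

subsection \<open>The group \<open>SL\<^sub>2\<close> and its modules of small highest weight\<close>

lemma SL2_simps [simp]:
  "x \<otimes>\<^bsub>SL2\<^esub> y = x * y" "\<one>\<^bsub>SL2\<^esub> = 1\<^sub>m 2"
  by (simp_all add: SL2_def)

lemma mat2_in_SL2: "mat2 a b c d \<in> carrier SL2 \<longleftrightarrow> a * d - b * c = 1"
  by (auto simp: SL2_def det_mat2 intro!: carrier_matI)

lemma SL2_cases:
  assumes "g \<in> carrier SL2"
  obtains a b c d where "g = mat2 a b c d" "a * d - b * c = 1"
proof -
  have g: "g = mat2 (g $$ (0, 0)) (g $$ (0, 1)) (g $$ (1, 0)) (g $$ (1, 1))"
    using assms by (intro mat2_cases) (auto simp: SL2_def)
  show thesis by (rule that[OF g]) (use assms g mat2_in_SL2 in metis)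
qed

lemma SL2_dims: "g \<in> carrier SL2 \<Longrightarrow> dim_row g = 2" "g \<in> carrier SL2 \<Longrightarrow> dim_col g = 2"
  by (auto simp: SL2_def)

lemma group_SL2: "group (SL2 :: 'k::field mat monoid)"
proof (rule groupI)
  fix x y z :: "'k mat" assume x: "x \<in> carrier SL2" and y: "y \<in> carrier SL2" and z: "z \<in> carrier SL2"
  show "x \<otimes>\<^bsub>SL2\<^esub> y \<in> carrier SL2"
    using x y by (auto simp: SL2_def det_mult)
  show "x \<otimes>\<^bsub>SL2\<^esub> y \<otimes>\<^bsub>SL2\<^esub> z = x \<otimes>\<^bsub>SL2\<^esub> (y \<otimes>\<^bsub>SL2\<^esub> z)"
    using x y z by (simp add: SL2_dims mm)
  show "\<one>\<^bsub>SL2\<^esub> \<otimes>\<^bsub>SL2\<^esub> x = x" using x by (simp add: SL2_dims mm)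
  show "\<exists>y\<in>carrier SL2. y \<otimes>\<^bsub>SL2\<^esub> x = \<one>\<^bsub>SL2\<^esub>"
    using x
  proof (rule SL2_cases)
    fix a b c d assume *: "x = mat2 a b c d" "a * d - b * c = 1"
    then have "mat2 d (- b) (- c) a * x = 1\<^sub>m 2" 
      by (simp add: mat2_mult mat2_one[symmetric] mat2_inject algebra_simps)
    moreover have "mat2 d (- b) (- c) a \<in> carrier SL2" using * by (simp add: mat2_in_SL2 algebra_simps)
    ultimately show ?thesis by auto
  qed
qed (simp add: SL2_def)

definition natural_rep :: "('k::field mat, 'k) rep" where
  "natural_rep = \<lparr>rdim = 2, act = (\<lambda>g. g)\<rparr>"

definition trivial_rep :: "('g, 'k::field) rep" where
  "trivial_rep = \<lparr>rdim = 1, act = (\<lambda>g. 1\<^sub>m 1)\<rparr>"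

definition frobenius_rep :: "('k::field mat, 'k) rep" where
  "frobenius_rep = \<lparr>rdim = 2, act = (\<lambda>g. mat2 (g $$ (0, 0) * g $$ (0, 0)) (g $$ (0, 1) * g $$ (0, 1))
     (g $$ (1, 0) * g $$ (1, 0)) (g $$ (1, 1) * g $$ (1, 1)))\<rparr>"

lemma small_rep_simps [simp]:
  "rdim natural_rep = 2" "act natural_rep g = g"
  "rdim trivial_rep = 1" "act trivial_rep g' = 1\<^sub>m 1"
  "rdim frobenius_rep = 2" "act frobenius_rep (mat2 a b c d) = mat2 (a * a) (b * b) (c * c) (d * d)"
  by (simp_all add: natural_rep_def trivial_rep_def frobenius_rep_def)

lemma is_rep_natural: "is_rep SL2 natural_rep"
  by (rule is_repI) (auto simp: SL2_dims)

lemma is_rep_trivial: "is_rep G trivial_rep"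
  by (rule is_repI) (auto simp: mm)

lemma is_rep_frobenius:
  assumes "CHAR('k) = 2"
  shows "is_rep SL2 (frobenius_rep :: ('k::field mat, 'k) rep)"
proof (rule is_repI)
  fix g h :: "'k mat" assume "g \<in> carrier SL2" "h \<in> carrier SL2"
  then show "act frobenius_rep (g \<otimes>\<^bsub>SL2\<^esub> h) = act frobenius_rep g * act frobenius_rep h"
    by (elim SL2_cases)
      (simp add: mat2_mult mat2_inject algebra_simps char2_add_left_self[OF assms] char2_two[OF assms])
qed (auto simp: mat2_one[symmetric] elim!: SL2_cases)

text \<open>By Steinberg and Donkin, \<open>T\<^sub>1 = V\<close>, \<open>T\<^sub>2 = V \<otimes> V\<close> and \<open>T\<^sub>3 = V \<otimes> V\<^sup>(\<^sup>1\<^sup>)\<close> in characteristic 2; the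
  second tensor factor is given here.\<close>

definition second_factor :: "nat \<Rightarrow> ('k::field mat, 'k) rep" where
  "second_factor i = (if i = 1 then trivial_rep else if i = 2 then natural_rep else frobenius_rep)"

lemma is_rep_second_factor: "CHAR('k) = 2 \<Longrightarrow> is_rep SL2 (second_factor i :: ('k::field mat, 'k) rep)"
  by (simp add: second_factor_def is_rep_natural is_rep_trivial is_rep_frobenius)

definition small_tilting :: "nat \<Rightarrow> ('k::field mat, 'k) rep" where
  "small_tilting i = rep_tensor natural_rep (second_factor i)"

lemma is_rep_small_tilting: "CHAR('k) = 2 \<Longrightarrow> is_rep SL2 (small_tilting i :: ('k::field mat, 'k) rep)"
  unfolding small_tilting_def by (simp add: is_rep_tensor2 is_rep_natural is_rep_second_factor)

subsection \<open>Restriction to the Klein four-group\<close>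

lemma rep_homI_generate:
  assumes E: "group E" and gen: "generate E S = carrier E" and S: "S \<subseteq> carrier E"
    and M: "is_rep E M" and N: "is_rep E N" and A: "dim_row A = rdim N" "dim_col A = rdim M"
    and eq: "\<And>g. g \<in> S \<Longrightarrow> A * act M g = act N g * A"
  shows "A \<in> rep_hom E M N"
proof (rule rep_homI[OF A])
  interpret group E by (rule E)
  fix g assume "g \<in> carrier E"
  then have "g \<in> generate E S" by (simp add: gen)
  then show "A * act M g = act N g * A"
  proof induction
    case one
    show ?case using A by (simp add: is_repD(1)[OF M] is_repD(1)[OF N] mm)
  next
    case (incl h)
    then show ?case by (rule eq)
  next
    case (inv h)
    then have h: "h \<in> carrier E" "inv\<^bsub>E\<^esub> h \<in> carrier E" using S by auto
    note d = A is_rep_dims[OF M h(1)] is_rep_dims[OF N h(1)] is_rep_dims[OF M h(2)] is_rep_dims[OF N h(2)]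
    have i: "act M h * act M (inv\<^bsub>E\<^esub> h) = 1\<^sub>m (rdim M)" "act N (inv\<^bsub>E\<^esub> h) * act N h = 1\<^sub>m (rdim N)"
      using is_repD[OF M] is_repD[OF N] h by (metis r_inv, metis l_inv)
    have "A * act M (inv\<^bsub>E\<^esub> h) = (act N (inv\<^bsub>E\<^esub> h) * act N h) * (A * act M (inv\<^bsub>E\<^esub> h))" unfolding i using d by (simp add: mm)
    also have "\<dots> = act N (inv\<^bsub>E\<^esub> h) * ((act N h * A) * act M (inv\<^bsub>E\<^esub> h))" using d by (simp add: mm)
    also have "\<dots> = act N (inv\<^bsub>E\<^esub> h) * ((A * act M h) * act M (inv\<^bsub>E\<^esub> h))" using eq[OF inv] by simp
    also have "\<dots> = act N (inv\<^bsub>E\<^esub> h) * (A * (act M h * act M (inv\<^bsub>E\<^esub> h)))" using d by (simp add: mm)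
    finally show ?case unfolding i using d by (simp add: mm)
  next
    case (eng h1 h2)
    then have h: "h1 \<in> carrier E" "h2 \<in> carrier E" using gen by auto
    note d = A is_rep_dims[OF M h(1)] is_rep_dims[OF N h(1)] is_rep_dims[OF M h(2)] is_rep_dims[OF N h(2)]
    have "A * act M (h1 \<otimes>\<^bsub>E\<^esub> h2) = (A * act M h1) * act M h2" using d h by (simp add: is_repD(2)[OF M] mm)
    also have "\<dots> = act N h1 * (A * act M h2)" unfolding eng(3) using d by (simp add: mm)
    also have "\<dots> = act N (h1 \<otimes>\<^bsub>E\<^esub> h2) * A" unfolding eng(4) using d h by (simp add: is_repD(2)[OF N] mm)
    finally show ?case .
  qed
qed

lemma klein_four:
  assumes "group E" "E \<cong> integer_mod_group 2 \<times>\<times> integer_mod_group 2" "g \<in> carrier E" "h \<in> carrier E"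
  shows "g \<otimes>\<^bsub>E\<^esub> g = \<one>\<^bsub>E\<^esub>" "g \<otimes>\<^bsub>E\<^esub> h = h \<otimes>\<^bsub>E\<^esub> g"
proof -
  interpret group E by fact
  let ?K = "integer_mod_group 2 \<times>\<times> integer_mod_group 2"
  interpret K: group ?K by (intro DirProd_group) auto
  from assms(2) obtain f where f: "f \<in> iso E ?K" by (auto simp: is_iso_def)
  then interpret group_hom E ?K f
    by (auto simp: group_hom_def group_hom_axioms_def iso_def is_group K.is_group)
  have inj: "inj_on f (carrier E)" using f by (auto simp: iso_def bij_betw_def)
  have K: "x \<otimes>\<^bsub>?K\<^esub> x = \<one>\<^bsub>?K\<^esub>" "x \<otimes>\<^bsub>?K\<^esub> y = y \<otimes>\<^bsub>?K\<^esub> x" for x y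
    by (cases x; cases y; simp add: integer_mod_group_def integer_group_def add.commute mult_2[symmetric])+
  show "g \<otimes>\<^bsub>E\<^esub> g = \<one>\<^bsub>E\<^esub>" using assms(3) K(1)[of "f g"] by (intro inj_onD[OF inj]) auto
  show "g \<otimes>\<^bsub>E\<^esub> h = h \<otimes>\<^bsub>E\<^esub> g" using assms(3,4) K(2)[of "f g" "f h"] by (intro inj_onD[OF inj]) auto
qed

locale klein_embedding =
  fixes E :: "'e monoid" and g1 g2 :: 'e
    and l1 l2 :: "'k::field"
    and \<phi> :: "'e \<Rightarrow> 'k mat"
  assumes char2: "CHAR('k) = 2"
    and E: "group E" "E \<cong> integer_mod_group 2 \<times>\<times> integer_mod_group 2"
    and gens: "g1 \<in> carrier E" "g2 \<in> carrier E" "generate E {g1, g2} = carrier E"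
    and indep: "\<forall>a\<in>{0, 1}. \<forall>b\<in>{0, 1}. a * l1 + b * l2 = 0 \<longrightarrow> a = 0 \<and> b = 0"
    and embedding: "\<phi> \<in> hom E SL2" "\<phi> g1 = mat2 1 0 l1 1" "\<phi> g2 = mat2 1 0 l2 1"
begin

text \<open>The three nonzero combinations over the field with two elements; the last is the scalar
  \<open>d\<close> that the splitting lemmas invert.\<close>

lemma l_nonzero: "l1 \<noteq> 0" "l2 \<noteq> 0" "l1 + l2 \<noteq> 0"
  using indep by (auto dest: bspec[of _ _ 1] bspec[of _ _ 0])

lemmas c2s = char2_two[OF char2] char2_add_self[OF char2] char2_add_left_self[OF char2]

text \<open>Scaled so that \<open>zop\<close> is the matrix unit \<open>E\<^sub>1\<^sub>0\<close> and \<open>uop\<close> is 0 on the natural module; recall \<open>1 = - 1\<close>.\<close>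

definition zop :: "('e, 'k) rep \<Rightarrow> 'k mat" where
  "zop M = inverse l1 \<cdot>\<^sub>m (act M g1 + 1\<^sub>m (rdim M))"

definition uop :: "('e, 'k) rep \<Rightarrow> 'k mat" where
  "uop M = zop M + inverse l2 \<cdot>\<^sub>m (act M g2 + 1\<^sub>m (rdim M))"

context
  fixes M :: "('e, 'k) rep"
  assumes M: "is_rep E M"
begin

lemma op_dims [simp]:
  "dim_row (zop M) = rdim M" "dim_col (zop M) = rdim M" "dim_row (uop M) = rdim M" "dim_col (uop M) = rdim M"
  by (simp_all add: zop_def uop_def)

lemma act_dims [simp]:
  "dim_row (act M g1) = rdim M" "dim_col (act M g1) = rdim M"
  "dim_row (act M g2) = rdim M" "dim_col (act M g2) = rdim M"
  using is_rep_dims[OF M] gens by auto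

lemma act_eq_op:
  "act M g1 = 1\<^sub>m (rdim M) + l1 \<cdot>\<^sub>m zop M"
  "act M g2 = 1\<^sub>m (rdim M) + l2 \<cdot>\<^sub>m (zop M + uop M)"
  using l_nonzero by (auto intro!: eq_matI simp: zop_def uop_def c2s algebra_simps)

lemma op_relations:
  "zop M * zop M = 0\<^sub>m (rdim M) (rdim M)" "uop M * uop M = 0\<^sub>m (rdim M) (rdim M)"
  "uop M * zop M = zop M * uop M"
proof -
  have r: "act M g1 * act M g1 = 1\<^sub>m (rdim M)" "act M g2 * act M g2 = 1\<^sub>m (rdim M)"
    "act M g2 * act M g1 = act M g1 * act M g2"
    using klein_four[OF E] is_repD[OF M] gens by metis+
  show "zop M * zop M = 0\<^sub>m (rdim M) (rdim M)" 
    unfolding zop_def by (simp add: mm r) (rule eq_matI; simp add: c2s algebra_simps)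
  show "uop M * zop M = zop M * uop M"
    unfolding zop_def uop_def by (simp add: mm r) (rule eq_matI; simp add: c2s algebra_simps del: index_mult_mat(1))
  show "uop M * uop M = 0\<^sub>m (rdim M) (rdim M)" 
    unfolding zop_def uop_def by (simp add: mm r) (rule eq_matI; simp add: c2s algebra_simps del: index_mult_mat(1))
qed

end

lemma hom_op:
  assumes "is_rep E M" "is_rep E N" "A \<in> rep_hom E M N"
  shows "A * zop M = zop N * A" "A * uop M = uop N * A"
proof -
  note d = rep_homD(1,2)[OF assms(3)] act_dims[OF assms(1)] act_dims[OF assms(2)]
  have r: "A * act M g1 = act N g1 * A" "A * act M g2 = act N g2 * A" using rep_homD(3)[OF assms(3)] gens by auto
  show "A * zop M = zop N * A" "A * uop M = uop N * A"
    by (simp_all add: zop_def uop_def d mm r)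
qed

lemma exists_tilting_summand:
  assumes M: "is_rep E M" and sp: "split_pair (rdim M) (zop M) (uop M)" and n: "rdim M > 0"
  obtains i P Q where "i \<in> {1, 2, 3}" "P \<in> rep_hom E (rep_restrict \<phi> (small_tilting i)) M"
    "Q \<in> rep_hom E M (rep_restrict \<phi> (small_tilting i))" "Q * P = 1\<^sub>m (rdim (small_tilting i :: ('k mat, 'k) rep))"
proof -
  note main = that
  note od = op_dims[OF M] and rel = op_relations[OF M]
  \<comment> \<open>Common end of the three cases: commutation with the two generators gives
    homomorphisms, and \<open>split_hom\<close> turns an invertible composite into 1.\<close>
  have finish: thesis if i: "i \<in> {1, 2, 3}" and d: "dim_row P = rdim M"
      "dim_col P = rdim (small_tilting i :: ('k mat, 'k) rep)"
      "dim_row Q = rdim (small_tilting i :: ('k mat, 'k) rep)" "dim_col Q = rdim M"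
      "dim_row R = rdim (small_tilting i :: ('k mat, 'k) rep)" "dim_col R = rdim (small_tilting i :: ('k mat, 'k) rep)"
      "R * (Q * P) = 1\<^sub>m (rdim (small_tilting i :: ('k mat, 'k) rep))"
      "(Q * P) * R = 1\<^sub>m (rdim (small_tilting i :: ('k mat, 'k) rep))"
    and e: "\<And>g. g \<in> {g1, g2} \<Longrightarrow> P * act (small_tilting i) (\<phi> g) = act M g * P"
      "\<And>g. g \<in> {g1, g2} \<Longrightarrow> Q * act M g = act (small_tilting i) (\<phi> g) * Q"
    for i P Q R
  proof -
    have N: "is_rep E (rep_restrict \<phi> (small_tilting i))"
      by (rule is_rep_restrict[OF is_rep_small_tilting[OF char2] embedding(1) E(1) group_SL2])
    have P: "P \<in> rep_hom E (rep_restrict \<phi> (small_tilting i)) M"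
      by (rule rep_homI_generate[OF E(1) gens(3) _ N M]) (use gens d e in auto)
    have Q: "Q \<in> rep_hom E M (rep_restrict \<phi> (small_tilting i))"
      by (rule rep_homI_generate[OF E(1) gens(3) _ M N]) (use gens d e in auto)
    from split_hom[OF M N P Q] d obtain Q' where "Q' \<in> rep_hom E M (rep_restrict \<phi> (small_tilting i))"
      "Q' * P = 1\<^sub>m (rdim (small_tilting i :: ('k mat, 'k) rep))" by auto
    then show thesis using main[OF i P] by blast
  qed
  let ?z = "zop M" and ?u = "uop M" and ?n = "rdim M"
  show thesis
  proof (cases "?z * ?u = 0\<^sub>m ?n ?n")
    case False
    from split_pair_case3[OF char2 od rel False l_nonzero(3)] obtain P Q R where PQ:
      "dim_row P = ?n" "dim_col P = 4" "dim_row Q = 4" "dim_col Q = ?n"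
      "dim_row R = 4" "dim_col R = 4" "R * (Q * P) = 1\<^sub>m 4" "(Q * P) * R = 1\<^sub>m 4"
      "P * kronecker_mat (mat2 1 0 l1 1) (mat2 1 0 (l1 * l1) 1) = act M g1 * P"
      "Q * act M g1 = kronecker_mat (mat2 1 0 l1 1) (mat2 1 0 (l1 * l1) 1) * Q"
      "P * kronecker_mat (mat2 1 0 l2 1) (mat2 1 0 (l2 * l2) 1) = act M g2 * P"
      "Q * act M g2 = kronecker_mat (mat2 1 0 l2 1) (mat2 1 0 (l2 * l2) 1) * Q"
      unfolding act_eq_op[OF M] by metis
    show thesis
      by (rule finish[of 3 P Q R]) (use PQ embedding in \<open>auto simp: small_tilting_def second_factor_def\<close>)
  next
    case zu: True
    show thesis
    proof (cases "?u = 0\<^sub>m ?n ?n")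
      case False
      have uz: "?u * ?z = 0\<^sub>m ?n ?n" using zu rel by simp
      from split_pair_case2[OF char2 od rel(1,2) uz zu sp False l_nonzero(3)] obtain P Q R where PQ:
        "dim_row P = ?n" "dim_col P = 4" "dim_row Q = 4" "dim_col Q = ?n"
        "dim_row R = 4" "dim_col R = 4" "R * (Q * P) = 1\<^sub>m 4" "(Q * P) * R = 1\<^sub>m 4"
        "P * kronecker_mat (mat2 1 0 l1 1) (mat2 1 0 l1 1) = act M g1 * P"
        "Q * act M g1 = kronecker_mat (mat2 1 0 l1 1) (mat2 1 0 l1 1) * Q"
        "P * kronecker_mat (mat2 1 0 l2 1) (mat2 1 0 l2 1) = act M g2 * P"
        "Q * act M g2 = kronecker_mat (mat2 1 0 l2 1) (mat2 1 0 l2 1) * Q"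
        unfolding act_eq_op[OF M] by metis
      show thesis
        by (rule finish[of 2 P Q R]) (use PQ embedding in \<open>auto simp: small_tilting_def second_factor_def\<close>)
    next
      case True
      have sp': "split_pair ?n ?z (0\<^sub>m ?n ?n)" using sp True by simp
      have g2: "act M g2 = 1\<^sub>m ?n + l2 \<cdot>\<^sub>m ?z"
        unfolding act_eq_op[OF M] True by (simp add: mm od)
      from split_pair_case1[OF od(1,2) rel(1) sp' n] obtain P Q R where PQ:
        "dim_row P = ?n" "dim_col P = 2" "dim_row Q = 2" "dim_col Q = ?n"
        "dim_row R = 2" "dim_col R = 2" "R * (Q * P) = 1\<^sub>m 2" "(Q * P) * R = 1\<^sub>m 2"
        "P * kronecker_mat (mat2 1 0 l1 1) (1\<^sub>m 1) = act M g1 * P"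
        "Q * act M g1 = kronecker_mat (mat2 1 0 l1 1) (1\<^sub>m 1) * Q"
        "P * kronecker_mat (mat2 1 0 l2 1) (1\<^sub>m 1) = act M g2 * P"
        "Q * act M g2 = kronecker_mat (mat2 1 0 l2 1) (1\<^sub>m 1) * Q"
        unfolding act_eq_op(1)[OF M] g2 by metis
      show thesis
        by (rule finish[of 1 P Q R]) (use PQ embedding in \<open>auto simp: small_tilting_def second_factor_def\<close>)
    qed
  qed
qed

text \<open>Induction on the dimension. The modules \<open>S i\<close> are known only up to
  isomorphism with the models, so that the list can later be formed from the given tilting modules
  themselves.\<close>

lemma split_pair_imp_direct_sum:
  assumes S: "\<And>i. i \<in> {1, 2, 3} \<Longrightarrow> is_rep E (S i)"
    "\<And>i. i \<in> {1, 2, 3} \<Longrightarrow> rep_iso E (S i) (rep_restrict \<phi> (small_tilting i))"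
    and M: "is_rep E M" and sp: "split_pair (rdim M) (zop M) (uop M)"
  shows "\<exists>ns. set ns \<subseteq> {1, 2, 3} \<and> rep_iso E M (rep_direct_sum (map S ns))"
  using M sp
proof (induction "rdim M" arbitrary: M rule: less_induct)
  case (less M)
  note M = less.prems(1)
  show ?case
  proof (cases "rdim M = 0")
    case True
    then show ?thesis using rep_iso_zero[OF M] by (intro exI[of _ "[]"]) simp
  next
    case False
    from exists_tilting_summand[OF less.prems] False obtain i P Q where i: "i \<in> {1, 2, 3}"
      and P: "P \<in> rep_hom E (rep_restrict \<phi> (small_tilting i)) M"
      and Q: "Q \<in> rep_hom E M (rep_restrict \<phi> (small_tilting i))"
      and QP: "Q * P = 1\<^sub>m (rdim (small_tilting i :: ('k mat, 'k) rep))" by auto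
    have N: "is_rep E (rep_restrict \<phi> (small_tilting i))"
      by (rule is_rep_restrict[OF is_rep_small_tilting[OF char2] embedding(1) E(1) group_SL2])
    from rep_isoE[OF S(2)[OF i] S(1)[OF i] N] obtain A B where
      A: "A \<in> rep_hom E (S i) (rep_restrict \<phi> (small_tilting i))" and
      B: "B \<in> rep_hom E (rep_restrict \<phi> (small_tilting i)) (S i)" and
      AB: "A * B = 1\<^sub>m (rdim (rep_restrict \<phi> (small_tilting i :: ('k mat, 'k) rep)))" "B * A = 1\<^sub>m (rdim (S i))" .
    note d = rep_homD(1,2)[OF P] rep_homD(1,2)[OF Q] rep_homD(1,2)[OF A] rep_homD(1,2)[OF B]
    have "B * Q * (P * A) = B * ((Q * P) * A)" using d by (simp add: mm)
    also have "\<dots> = 1\<^sub>m (rdim (S i))" unfolding QP using d AB by (simp add: mm)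
    finally have QP': "B * Q * (P * A) = 1\<^sub>m (rdim (S i))" .
    have PA: "P * A \<in> rep_hom E (S i) M" by (rule rep_hom_comp[OF S(1)[OF i] N M A P])
    have BQ: "B * Q \<in> rep_hom E M (S i)" by (rule rep_hom_comp[OF M N S(1)[OF i] Q B])
    from split_summand[OF M S(1)[OF i] PA BQ QP'] obtain K I J where K: "is_rep E K"
      and I: "I \<in> rep_hom E K M" and J: "J \<in> rep_hom E M K" and JI: "J * I = 1\<^sub>m (rdim K)"
      and iso: "rep_iso E M (rep_sum (S i) K)" and dim: "rdim M = rdim (S i) + rdim K" .
    have "rdim (small_tilting i :: ('k mat, 'k) rep) > 0" by (simp add: small_tilting_def second_factor_def)
    \<comment> \<open>This makes the complement smaller. If \<open>S i\<close> were zero, then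
      \<open>A * B = 1\<close> would read \<open>0 = 1\<close> on a nonzero model.\<close>
    then have "rdim (S i) > 0"
    proof (rule contrapos_pp)
      assume "\<not> rdim (S i) > 0"
      then have "A = 0\<^sub>m (rdim (small_tilting i :: ('k mat, 'k) rep)) 0" using d by (intro eq_matI) auto
      then have "1\<^sub>m (rdim (small_tilting i :: ('k mat, 'k) rep)) = (0\<^sub>m (rdim (small_tilting i :: ('k mat, 'k) rep)) (rdim (small_tilting i :: ('k mat, 'k) rep)) :: 'k mat)"
        using AB(1) d by (simp add: mm)
      from arg_cong[OF this, of "\<lambda>A. A $$ (0, 0)"]
      show "\<not> rdim (small_tilting i :: ('k mat, 'k) rep) > 0"
        by (cases "rdim (small_tilting i :: ('k mat, 'k) rep) = 0") simp_all
    qed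
    then have lt: "rdim K < rdim M" using dim by simp
    have spK: "split_pair (rdim K) (zop K) (uop K)"
      by (rule split_pair_summand[OF less.prems(2), where I = I and J = J])
        (use op_dims[OF M] op_dims[OF K] rep_homD[OF I] rep_homD[OF J] JI hom_op[OF K M I] hom_op[OF M K J] in auto)
    from less.hyps[OF lt K spK] obtain ns where ns: "set ns \<subseteq> {1, 2, 3}" "rep_iso E K (rep_direct_sum (map S ns))"
      by blast
    have D: "is_rep E (rep_direct_sum (map S ns))" using ns(1) S(1) by (intro is_rep_direct_sum) auto
    have "rep_iso E M (rep_sum (S i) (rep_direct_sum (map S ns)))"
      using rep_iso_trans[OF iso rep_iso_sum_cong[OF ns(2) S(1)[OF i] K D] M is_rep_sum[OF S(1)[OF i] K]
          is_rep_sum[OF S(1)[OF i] D]] .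
    then show ?thesis using ns(1) i by (intro exI[of _ "i # ns"]) auto
  qed
qed

lemma split_pair_natural_tensor:
  assumes X: "is_rep E X"
  defines "M \<equiv> rep_tensor (rep_restrict \<phi> natural_rep) X"
  shows "split_pair (rdim M) (zop M) (uop M)"
proof -
  let ?n = "rdim X"
  define a where "a = zop X"
  \<comment> \<open>This is \<open>z\<^sub>2\<close> of \<open>X\<close>, as
    \<open>u = z\<^sub>1 + z\<^sub>2\<close> and \<open>2 = 0\<close>.\<close>
  define b where "b = zop X + uop X"
  have d [simp]: "dim_row a = ?n" "dim_col a = ?n" "dim_row b = ?n" "dim_col b = ?n"
    by (simp_all add: a_def b_def op_dims[OF X])
  have rel: "a * a = 0\<^sub>m ?n ?n" "b * b = 0\<^sub>m ?n ?n" "b * a = a * b"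
    using op_relations[OF X] op_dims[OF X] unfolding a_def b_def
    by (simp_all add: mm) (rule eq_matI; simp add: c2s del: index_mult_mat(1))
  have act: "act X g1 = 1\<^sub>m ?n + l1 \<cdot>\<^sub>m a" "act X g2 = 1\<^sub>m ?n + l2 \<cdot>\<^sub>m b"
    using act_eq_op[OF X] by (simp_all add: a_def b_def)
  have M: "rdim M = ?n + ?n" "act M g1 = kronecker_mat (mat2 1 0 l1 1) (1\<^sub>m ?n + l1 \<cdot>\<^sub>m a)"
    "act M g2 = kronecker_mat (mat2 1 0 l2 1) (1\<^sub>m ?n + l2 \<cdot>\<^sub>m b)"
    by (simp_all add: M_def embedding act)
  have z: "zop M = four_block_mat a (0\<^sub>m ?n ?n) (1\<^sub>m ?n + l1 \<cdot>\<^sub>m a) a"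
    unfolding zop_def M
    by (rule eq_matI) (use l_nonzero in \<open>auto simp: kron2 c2s algebra_simps\<close>)
  have z2: "inverse l2 \<cdot>\<^sub>m (act M g2 + 1\<^sub>m (rdim M)) = four_block_mat b (0\<^sub>m ?n ?n) (1\<^sub>m ?n + l2 \<cdot>\<^sub>m b) b"
    unfolding M
    by (rule eq_matI) (use l_nonzero in \<open>auto simp: kron2 c2s algebra_simps\<close>)
  have u: "uop M = four_block_mat (a + b) (0\<^sub>m ?n ?n) (l1 \<cdot>\<^sub>m a + l2 \<cdot>\<^sub>m b) (a + b)"
    unfolding uop_def z z2
    by (rule eq_matI) (auto simp: c2s algebra_simps)
  show ?thesis unfolding z u M(1) by (rule split_pair_tensor[OF char2 d rel])
qed

end

subsection \<open>Laurent polynomial functions\<close>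

text \<open>Over a finite field, 1 plus the product of all linear factors would have positive degree
  and no root.\<close>

lemma infinite_UNIV_alg_closed: "infinite (UNIV :: 'k::alg_closed_field set)"
proof
  assume fin: "finite (UNIV :: 'k set)"
  define q where "q = (\<Prod>a\<in>(UNIV :: 'k set). [:- a, 1:])"
  have "degree q = (\<Sum>a\<in>(UNIV :: 'k set). degree [:- a, 1:])"
    unfolding q_def by (rule degree_prod_eq_sum_degree) auto
  also have "\<dots> = card (UNIV :: 'k set)" by simp
  finally have dq: "degree q > 0" using fin by (simp add: card_gt_0_iff)
  then have "degree (q + 1) > 0" by (simp add: degree_add_eq_left)
  from alg_closed_imp_poly_has_root[OF this] obtain z where z: "poly (q + 1) z = 0" by blast
  have "poly q z = 0" using fin by (auto simp: q_def poly_prod intro!: prod_zero)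
  then show False using z by simp
qed

text \<open>A function on the punctured line together with its coefficient family; its value at 0 is
  free. The finite support is hidden, so that two families can be compared directly.\<close>

definition laurent_coeffs :: "(int \<Rightarrow> 'k::field) \<Rightarrow> ('k \<Rightarrow> 'k) \<Rightarrow> bool" where
  "laurent_coeffs c F \<longleftrightarrow> (\<exists>S. finite S \<and> (\<forall>m. m \<notin> S \<longrightarrow> c m = 0) \<and>
     (\<forall>t. t \<noteq> 0 \<longrightarrow> F t = (\<Sum>m\<in>S. c m * t powi m)))"

lemma laurent_coeffs_superset:
  fixes t :: "'k::field"
  assumes "finite S" "\<And>m. m \<notin> S \<Longrightarrow> c m = 0" "F t = (\<Sum>m\<in>S. c m * t powi m)" "S \<subseteq> S'" "finite S'"
  shows "F t = (\<Sum>m\<in>S'. c m * t powi m)"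
  unfolding assms(3) by (rule sum.mono_neutral_left) (use assms in auto)

text \<open>After multiplication by a power of \<open>t\<close> the difference is a polynomial that
  vanishes at every nonzero \<open>t\<close>, hence the zero polynomial over an infinite
  field.\<close>

lemma laurent_coeffs_unique:
  fixes F :: "'k::alg_closed_field \<Rightarrow> 'k"
  assumes "laurent_coeffs c F" "laurent_coeffs c' F'" "\<And>t. t \<noteq> 0 \<Longrightarrow> F t = F' t"
  shows "c = c'"
proof -
  from assms(1) obtain S where S: "finite S" "\<And>m. m \<notin> S \<Longrightarrow> c m = 0"
    "\<And>t. t \<noteq> 0 \<Longrightarrow> F t = (\<Sum>m\<in>S. c m * t powi m)" by (auto simp: laurent_coeffs_def)
  from assms(2) obtain S' where S': "finite S'" "\<And>m. m \<notin> S' \<Longrightarrow> c' m = 0"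
    "\<And>t. t \<noteq> 0 \<Longrightarrow> F' t = (\<Sum>m\<in>S'. c' m * t powi m)" by (auto simp: laurent_coeffs_def)
  define T where "T = S \<union> S'"
  define d where "d m = c m - c' m" for m
  have T: "finite T" using S S' by (simp add: T_def)
  have zero: "(\<Sum>m\<in>T. d m * t powi m) = 0" if "t \<noteq> 0" for t
  proof -
    have "F t = (\<Sum>m\<in>T. c m * t powi m)"
      by (rule laurent_coeffs_superset[of S]) (use S T that in \<open>auto simp: T_def\<close>)
    moreover have "F' t = (\<Sum>m\<in>T. c' m * t powi m)"
      by (rule laurent_coeffs_superset[of S']) (use S' T that in \<open>auto simp: T_def\<close>)
    ultimately show ?thesis using assms(3)[OF that] by (simp add: d_def left_diff_distrib sum_subtractf)
  qed
  define N where "N = Max (insert 0 ((\<lambda>m. - m) ` T))"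
  have N: "m + N \<ge> 0" if "m \<in> T" for m
  proof -
    have "- m \<le> N" unfolding N_def by (rule Max_ge) (use T that in auto)
    then show ?thesis by simp
  qed
  define p where "p = (\<Sum>m\<in>T. monom (d m) (nat (m + N)))"
  have "poly p t = 0" if t: "t \<noteq> 0" for t
  proof -
    have "poly p t = (\<Sum>m\<in>T. t powi N * (d m * t powi m))"
      unfolding p_def poly_sum
    proof (rule sum.cong[OF refl])
      fix m assume m: "m \<in> T"
      have "t ^ nat (m + N) = t powi (m + N)" using N[OF m] by (simp add: power_int_def)
      also have "\<dots> = t powi m * t powi N" using t by (simp add: power_int_add)
      finally show "poly (monom (d m) (nat (m + N))) t = t powi N * (d m * t powi m)"
        by (simp add: poly_monom)
    qed
    also have "\<dots> = 0" using zero[OF t] by (simp add: sum_distrib_left[symmetric])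
    finally show ?thesis .
  qed
  then have "UNIV - {0} \<subseteq> {t. poly p t = 0}" by auto
  moreover have "infinite (UNIV - {0 :: 'k})" using infinite_UNIV_alg_closed by simp
  ultimately have "infinite {t. poly p t = 0}" using finite_subset by blast
  then have p: "p = 0" using poly_roots_finite by blast
  have dT: "d m = 0" if m: "m \<in> T" for m
  proof -
    have "coeff p (nat (m + N)) = (\<Sum>k\<in>T. if k = m then d k else 0)"
      unfolding p_def coeff_sum
      by (rule sum.cong) (use N m in \<open>auto simp: nat_eq_iff\<close>)
    also have "\<dots> = d m" using T m by simp
    finally show ?thesis using p by simp
  qed
  show ?thesis
  proof
    fix m show "c m = c' m" using dT[of m] S(2)[of m] S'(2)[of m] by (cases "m \<in> T") (auto simp: d_def T_def)
  qed
qed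

lemma laurent_coeffs_lincomb:
  assumes "\<And>k. k < n \<Longrightarrow> laurent_coeffs (c k) (F k)"
  shows "laurent_coeffs (\<lambda>m. \<Sum>k<n. a k * c k m) (\<lambda>t. \<Sum>k<(n::nat). a k * F k t)"
proof -
  from assms have "\<forall>k. \<exists>S. k < n \<longrightarrow> finite S \<and> (\<forall>m. m \<notin> S \<longrightarrow> c k m = 0) \<and>
     (\<forall>t. t \<noteq> 0 \<longrightarrow> F k t = (\<Sum>m\<in>S. c k m * t powi m))" by (auto simp: laurent_coeffs_def)
  then obtain S where S: "\<And>k. k < n \<Longrightarrow> finite (S k)" "\<And>k m. k < n \<Longrightarrow> m \<notin> S k \<Longrightarrow> c k m = 0"
     "\<And>k t. k < n \<Longrightarrow> t \<noteq> 0 \<Longrightarrow> F k t = (\<Sum>m\<in>S k. c k m * t powi m)" by metis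
  define T where "T = (\<Union>k<n. S k)"
  have T: "finite T" using S by (auto simp: T_def)
  show ?thesis unfolding laurent_coeffs_def
  proof (intro exI[of _ T] conjI allI impI T)
    fix m assume "m \<notin> T" then show "(\<Sum>k<n. a k * c k m) = 0" using S(2) by (auto simp: T_def intro!: sum.neutral)
  next
    fix t :: 'a assume t: "t \<noteq> 0"
    have "(\<Sum>k<n. a k * F k t) = (\<Sum>k<n. \<Sum>m\<in>T. a k * (c k m * t powi m))"
      unfolding sum_distrib_left[symmetric]
    proof (rule sum.cong[OF refl])
      fix k assume k: "k \<in> {..<n}"
      have "F k t = (\<Sum>m\<in>T. c k m * t powi m)"
        by (rule laurent_coeffs_superset[of "S k"]) (use S T t k in \<open>auto simp: T_def\<close>)
      then show "a k * F k t = a k * (\<Sum>m\<in>T. c k m * t powi m)" by simp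
    qed
    also have "\<dots> = (\<Sum>m\<in>T. \<Sum>k<n. a k * (c k m * t powi m))" by (rule sum.swap)
    also have "\<dots> = (\<Sum>m\<in>T. (\<Sum>k<n. a k * c k m) * t powi m)" by (simp add: sum_distrib_right mult.assoc)
    finally show "(\<Sum>k<n. a k * F k t) = (\<Sum>m\<in>T. (\<Sum>k<n. a k * c k m) * t powi m)" .
  qed
qed

lemma laurent_coeffs_shift:
  assumes "laurent_coeffs c F"
  shows "laurent_coeffs (\<lambda>m. c (m - k)) (\<lambda>t. t powi k * F t)"
proof -
  from assms obtain S where S: "finite S" "\<And>m. m \<notin> S \<Longrightarrow> c m = 0"
    "\<And>t. t \<noteq> 0 \<Longrightarrow> F t = (\<Sum>m\<in>S. c m * t powi m)" by (auto simp: laurent_coeffs_def)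
  show ?thesis unfolding laurent_coeffs_def
  proof (intro exI[of _ "(\<lambda>m. m + k) ` S"] conjI allI impI)
    fix m assume "m \<notin> (\<lambda>m. m + k) ` S"
    then have "m - k \<notin> S" by force
    then show "c (m - k) = 0" by (rule S)
  next
    fix t :: 'a assume t: "t \<noteq> 0"
    show "t powi k * F t = (\<Sum>m\<in>(\<lambda>m. m + k) ` S. c (m - k) * t powi m)"
      using t S(3)[OF t] by (simp add: sum.reindex sum_distrib_left power_int_add algebra_simps)
  qed (use S in simp)
qed

lemma laurent_coeffs_scale:
  assumes "laurent_coeffs c F" "a \<noteq> 0"
  shows "laurent_coeffs (\<lambda>m. a powi m * c m) (\<lambda>t. F (a * t))"
proof -
  from assms obtain S where S: "finite S" "\<And>m. m \<notin> S \<Longrightarrow> c m = 0"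
    "\<And>t. t \<noteq> 0 \<Longrightarrow> F t = (\<Sum>m\<in>S. c m * t powi m)" by (auto simp: laurent_coeffs_def)
  show ?thesis unfolding laurent_coeffs_def
    by (intro exI[of _ S]) (use S assms(2) in \<open>auto simp: power_int_mult_distrib algebra_simps\<close>)
qed

lemma laurent_coeffs_inverse:
  assumes "laurent_coeffs c F"
  shows "laurent_coeffs (\<lambda>m. c (- m)) (\<lambda>t. F (inverse t))"
proof -
  from assms obtain S where S: "finite S" "\<And>m. m \<notin> S \<Longrightarrow> c m = 0"
    "\<And>t. t \<noteq> 0 \<Longrightarrow> F t = (\<Sum>m\<in>S. c m * t powi m)" by (auto simp: laurent_coeffs_def)
  show ?thesis unfolding laurent_coeffs_def
  proof (intro exI[of _ "uminus ` S"] conjI allI impI)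
    fix m assume "m \<notin> uminus ` S"
    then have "- m \<notin> S" by force
    then show "c (- m) = 0" by (rule S)
  next
    fix t :: 'a assume t: "t \<noteq> 0"
    have "inverse t powi m = t powi (- m)" for m by (simp add: power_int_minus power_int_inverse)
    then show "F (inverse t) = (\<Sum>m\<in>uminus ` S. c (- m) * t powi m)"
      using t S(3)[of "inverse t"] by (simp add: sum.reindex)
  qed (use S in simp)
qed

lemma laurent_coeffs_powi: "laurent_coeffs (\<lambda>m. if m = k then a else 0) (\<lambda>t. t powi k * a)"
  unfolding laurent_coeffs_def by (intro exI[of _ "{k}"]) auto

lemma laurent_coeffs_poly: "laurent_coeffs (\<lambda>m. if m \<ge> 0 then coeff p (nat m) else 0) (poly p)"
  unfolding laurent_coeffs_def
proof (intro exI[of _ "int ` {..degree p}"] conjI allI impI)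
  fix m assume "m \<notin> int ` {..degree p}"
  then have "m < 0 \<or> nat m > degree p" by (metis atMost_iff image_eqI int_nat_eq linorder_not_le nat_0_le)
  then show "(if m \<ge> 0 then coeff p (nat m) else 0) = 0" by (auto simp: coeff_eq_0)
qed (simp_all add: sum.reindex poly_altdef)

lemma laurent_coeffs_exists:
  assumes "\<And>t. t \<noteq> 0 \<Longrightarrow> F t * t ^ N = poly p t"
  shows "\<exists>c. laurent_coeffs c F"
proof -
  have "F t = t powi (- int N) * poly p t" if "t \<noteq> 0" for t
    using assms[OF that] that by (simp add: power_int_minus field_simps)
  then have "laurent_coeffs c (\<lambda>t. t powi (- int N) * poly p t) \<Longrightarrow> laurent_coeffs c F" for c
    by (auto simp: laurent_coeffs_def)
  then show ?thesis using laurent_coeffs_shift[OF laurent_coeffs_poly] by blast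
qed

subsection \<open>Matrix-valued curves\<close>

text \<open>\<open>C m\<close> is the coefficient of \<open>t\<^sup>m\<close>; the value \<open>F 0\<close> is unconstrained.\<close>

definition mat_curve :: "nat \<Rightarrow> nat \<Rightarrow> (int \<Rightarrow> 'k::field mat) \<Rightarrow> ('k \<Rightarrow> 'k mat) \<Rightarrow> bool" where
  "mat_curve r s C F \<longleftrightarrow> (\<forall>m. C m \<in> carrier_mat r s) \<and> (\<forall>t. t \<noteq> 0 \<longrightarrow> F t \<in> carrier_mat r s) \<and>
     (\<forall>i<r. \<forall>j<s. laurent_coeffs (\<lambda>m. C m $$ (i, j)) (\<lambda>t. F t $$ (i, j)))"

lemma laurent_coeffs_cong:
  assumes "\<And>t. t \<noteq> 0 \<Longrightarrow> F t = F' t"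
  shows "laurent_coeffs c F \<longleftrightarrow> laurent_coeffs c F'"
  using assms by (auto simp: laurent_coeffs_def)

lemma mat_curve_dims:
  assumes "mat_curve r s C F"
  shows "dim_row (C m) = r" "dim_col (C m) = s" "t \<noteq> 0 \<Longrightarrow> dim_row (F t) = r" "t \<noteq> 0 \<Longrightarrow> dim_col (F t) = s"
  using assms by (auto simp: mat_curve_def carrier_matD)

text \<open>Comparison of coefficients: an identity between group elements that depend on
  \<open>t\<close> yields one identity of matrices for each power of \<open>t\<close>. It takes the
  place of Lie algebra and divided power relations.\<close>

lemma mat_curve_unique:
  fixes F :: "'k::alg_closed_field \<Rightarrow> 'k mat"
  assumes "mat_curve r s C F" "mat_curve r s C' F'" "\<And>t. t \<noteq> 0 \<Longrightarrow> F t = F' t"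
  shows "C m = C' m"
proof (rule eq_matI)
  fix i j assume "i < dim_row (C' m)" "j < dim_col (C' m)"
  then have ij: "i < r" "j < s" using mat_curve_dims[OF assms(2)] by auto
  have "(\<lambda>m. C m $$ (i, j)) = (\<lambda>m. C' m $$ (i, j))"
    by (rule laurent_coeffs_unique[of _ "\<lambda>t. F t $$ (i, j)" _ "\<lambda>t. F' t $$ (i, j)"])
      (use assms ij in \<open>auto simp: mat_curve_def\<close>)
  then show "C m $$ (i, j) = C' m $$ (i, j)" by (rule fun_cong)
qed (use mat_curve_dims[OF assms(1)] mat_curve_dims[OF assms(2)] in auto)

lemma mat_curve_mult_left:
  assumes "mat_curve r s C F" "dim_row A = q" "dim_col A = r"
  shows "mat_curve q s (\<lambda>m. A * C m) (\<lambda>t. A * F t)"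
  unfolding mat_curve_def
proof (intro conjI allI impI)
  note d = assms(2,3) mat_curve_dims[OF assms(1)]
  fix i j assume ij: "i < q" "j < s"
  have "laurent_coeffs (\<lambda>m. \<Sum>k<r. A $$ (i, k) * C m $$ (k, j)) (\<lambda>t. \<Sum>k<r. A $$ (i, k) * F t $$ (k, j))"
    by (rule laurent_coeffs_lincomb) (use assms ij in \<open>auto simp: mat_curve_def\<close>)
  moreover have "laurent_coeffs c (\<lambda>t. \<Sum>k<r. A $$ (i, k) * F t $$ (k, j)) \<Longrightarrow>
      laurent_coeffs c (\<lambda>t. (A * F t) $$ (i, j))" for c
    by (subst laurent_coeffs_cong[where F' = "\<lambda>t. \<Sum>k<r. A $$ (i, k) * F t $$ (k, j)"])
      (use d ij in \<open>auto simp: mat_mult_entry simp del: index_mult_mat(1)\<close>)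
  ultimately show "laurent_coeffs (\<lambda>m. (A * C m) $$ (i, j)) (\<lambda>t. (A * F t) $$ (i, j))"
    using d ij by (simp add: mat_mult_entry del: index_mult_mat(1))
qed (use assms mat_curve_dims[OF assms(1)] in \<open>auto intro!: carrier_matI\<close>)

lemma mat_curve_mult_right:
  assumes "mat_curve r s C F" "dim_row A = s" "dim_col A = q"
  shows "mat_curve r q (\<lambda>m. C m * A) (\<lambda>t. F t * A)"
  unfolding mat_curve_def
proof (intro conjI allI impI)
  note d = assms(2,3) mat_curve_dims[OF assms(1)]
  fix i j assume ij: "i < r" "j < q"
  have "laurent_coeffs (\<lambda>m. \<Sum>k<s. A $$ (k, j) * C m $$ (i, k)) (\<lambda>t. \<Sum>k<s. A $$ (k, j) * F t $$ (i, k))"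
    by (rule laurent_coeffs_lincomb) (use assms ij in \<open>auto simp: mat_curve_def\<close>)
  moreover have "laurent_coeffs c (\<lambda>t. \<Sum>k<s. A $$ (k, j) * F t $$ (i, k)) \<Longrightarrow>
      laurent_coeffs c (\<lambda>t. (F t * A) $$ (i, j))" for c
    by (subst laurent_coeffs_cong[where F' = "\<lambda>t. \<Sum>k<s. A $$ (k, j) * F t $$ (i, k)"])
      (use d ij in \<open>auto simp: mat_mult_entry mult.commute simp del: index_mult_mat(1)\<close>)
  ultimately show "laurent_coeffs (\<lambda>m. (C m * A) $$ (i, j)) (\<lambda>t. (F t * A) $$ (i, j))"
    using d ij by (simp add: mat_mult_entry mult.commute del: index_mult_mat(1))
qed (use assms mat_curve_dims[OF assms(1)] in \<open>auto intro!: carrier_matI\<close>)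

text \<open>\<open>G\<close> is the scalar version of the same change of variable. It is
  instantiated with \<open>t\<close> replaced by \<open>a * t\<close> and by
  \<open>inverse t\<close>.\<close>

lemma mat_curve_reparam:
  assumes F: "mat_curve r s C F" and \<rho>: "\<And>t. t \<noteq> 0 \<Longrightarrow> \<rho> t \<noteq> 0"
    and G: "\<And>c f. laurent_coeffs c f \<Longrightarrow> laurent_coeffs (\<lambda>m. a m * c (\<sigma> m)) (\<lambda>t. b t * f (\<rho> t))"
  shows "mat_curve r s (\<lambda>m. a m \<cdot>\<^sub>m C (\<sigma> m)) (\<lambda>t. b t \<cdot>\<^sub>m F (\<rho> t))"
  unfolding mat_curve_def
proof (intro conjI allI impI)
  note d = mat_curve_dims[OF F]
  fix i j assume ij: "i < r" "j < s"
  have "laurent_coeffs (\<lambda>m. C m $$ (i, j)) (\<lambda>t. F t $$ (i, j))" using F ij by (auto simp: mat_curve_def)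
  then have "laurent_coeffs (\<lambda>m. a m * C (\<sigma> m) $$ (i, j)) (\<lambda>t. b t * F (\<rho> t) $$ (i, j))" by (rule G)
  moreover have "laurent_coeffs c (\<lambda>t. b t * F (\<rho> t) $$ (i, j)) \<Longrightarrow>
      laurent_coeffs c (\<lambda>t. (b t \<cdot>\<^sub>m F (\<rho> t)) $$ (i, j))" for c
    by (subst laurent_coeffs_cong[where F' = "\<lambda>t. b t * F (\<rho> t) $$ (i, j)"]) (use d ij \<rho> in auto)
  ultimately show "laurent_coeffs (\<lambda>m. (a m \<cdot>\<^sub>m C (\<sigma> m)) $$ (i, j)) (\<lambda>t. (b t \<cdot>\<^sub>m F (\<rho> t)) $$ (i, j))"
    using d ij by simp
qed (use \<rho> mat_curve_dims[OF F] in \<open>auto intro!: carrier_matI\<close>)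

lemma mat_curve_scale:
  assumes "mat_curve r s C F" "a \<noteq> 0"
  shows "mat_curve r s (\<lambda>m. a powi m \<cdot>\<^sub>m C m) (\<lambda>t. F (a * t))"
proof -
  have "mat_curve r s (\<lambda>m. a powi m \<cdot>\<^sub>m C m) (\<lambda>t. 1 \<cdot>\<^sub>m F (a * t))"
    by (rule mat_curve_reparam[OF assms(1)]) (use assms(2) laurent_coeffs_scale in auto)
  then show ?thesis by (simp add: mm_smult_one)
qed

lemma mat_curve_flip:
  assumes "mat_curve r s C F"
  shows "mat_curve r s (\<lambda>m. C (k - m)) (\<lambda>t. t powi k \<cdot>\<^sub>m F (inverse t))"
proof -
  have "mat_curve r s (\<lambda>m. 1 \<cdot>\<^sub>m C (k - m)) (\<lambda>t. t powi k \<cdot>\<^sub>m F (inverse t))"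
  proof (rule mat_curve_reparam[OF assms])
    fix c :: "int \<Rightarrow> 'a" and f assume "laurent_coeffs c f"
    from laurent_coeffs_shift[OF laurent_coeffs_inverse[OF this], of k]
    show "laurent_coeffs (\<lambda>m. 1 * c (k - m)) (\<lambda>t. t powi k * f (inverse t))" by simp
  qed auto
  then show ?thesis by (simp add: mm_smult_one)
qed

lemma mat_curve_powi:
  assumes "dim_row A = r" "dim_col A = s"
  shows "mat_curve r s (\<lambda>m. if m = k then A else 0\<^sub>m r s) (\<lambda>t. t powi k \<cdot>\<^sub>m A)"
  unfolding mat_curve_def
proof (intro conjI allI impI)
  fix i j assume "i < r" "j < s"
  then show "laurent_coeffs (\<lambda>m. (if m = k then A else 0\<^sub>m r s) $$ (i, j)) (\<lambda>t. (t powi k \<cdot>\<^sub>m A) $$ (i, j))"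
    using laurent_coeffs_powi[of k "A $$ (i, j)"] assms by (simp add: if_distrib[where f = "\<lambda>A. A $$ (i, j)"] cong: if_cong)
qed (use assms in \<open>auto intro!: carrier_matI\<close>)

lemma mat_curve_exists:
  assumes "\<And>t. t \<noteq> 0 \<Longrightarrow> dim_row (F t) = r" "\<And>t. t \<noteq> 0 \<Longrightarrow> dim_col (F t) = s"
    "\<And>i j. i < r \<Longrightarrow> j < s \<Longrightarrow> \<exists>c. laurent_coeffs c (\<lambda>t. F t $$ (i, j))"
  obtains C where "mat_curve r s C F"
proof -
  from assms(3) obtain c where c: "\<And>i j. i < r \<Longrightarrow> j < s \<Longrightarrow> laurent_coeffs (c i j) (\<lambda>t. F t $$ (i, j))" by metis
  have "mat_curve r s (\<lambda>m. mat r s (\<lambda>(i, j). c i j m)) F"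
    unfolding mat_curve_def using assms c by (auto intro!: carrier_matI)
  then show thesis by (rule that)
qed

text \<open>The last clause recovers the value at 0, on which \<open>mat_curve\<close> is silent;
  for an orbit this is the value at the identity.\<close>

definition mat_poly_curve :: "nat \<Rightarrow> nat \<Rightarrow> (int \<Rightarrow> 'k::field mat) \<Rightarrow> ('k \<Rightarrow> 'k mat) \<Rightarrow> bool" where
  "mat_poly_curve r s C F \<longleftrightarrow> mat_curve r s C F \<and> (\<forall>m<0. C m = 0\<^sub>m r s) \<and> F 0 = C 0"

lemma mat_poly_curve_exists:
  assumes "\<And>t. dim_row (F t) = r" "\<And>t. dim_col (F t) = s"
    "\<And>i j. i < r \<Longrightarrow> j < s \<Longrightarrow> \<exists>p. \<forall>t. F t $$ (i, j) = poly p t"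
  obtains C where "mat_poly_curve r s C F"
proof -
  from assms(3) obtain p where p: "\<And>i j t. i < r \<Longrightarrow> j < s \<Longrightarrow> F t $$ (i, j) = poly (p i j) t" by metis
  define C where "C m = mat r s (\<lambda>(i, j). if m \<ge> 0 then coeff (p i j) (nat m) else 0)" for m
  have "laurent_coeffs (\<lambda>m. C m $$ (i, j)) (\<lambda>t. F t $$ (i, j))" if "i < r" "j < s" for i j
    using laurent_coeffs_poly[of "p i j"] p that by (simp add: C_def)
  then have "mat_curve r s C F" using assms by (auto simp: mat_curve_def C_def intro!: carrier_matI)
  moreover have "F 0 = C 0" by (rule eq_matI) (use assms p in \<open>auto simp: C_def poly_0_coeff_0\<close>)
  moreover have "\<forall>m<0. C m = 0\<^sub>m r s" by (auto simp: C_def intro!: eq_matI)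
  ultimately show thesis using that by (auto simp: mat_poly_curve_def)
qed

lemma mat_poly_curve_eval:
  assumes F: "mat_poly_curve r s C F" and C: "\<And>m. m > int n \<Longrightarrow> C m = 0\<^sub>m r s" and ij: "i < r" "j < s"
  shows "F t $$ (i, j) = (\<Sum>k\<le>n. t ^ k * C (int k) $$ (i, j))"
proof (cases "t = 0")
  case True
  then show ?thesis using F by (simp add: mat_poly_curve_def power_0_left if_distrib[where f = "\<lambda>x. x * y" for y] cong: if_cong)
next
  case False
  have "laurent_coeffs (\<lambda>m. C m $$ (i, j)) (\<lambda>t. F t $$ (i, j))"
    using F ij by (auto simp: mat_poly_curve_def mat_curve_def)
  then obtain S where S: "finite S" "\<And>m. m \<notin> S \<Longrightarrow> C m $$ (i, j) = 0"
    "F t $$ (i, j) = (\<Sum>m\<in>S. C m $$ (i, j) * t powi m)" 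
    using False by (auto simp: laurent_coeffs_def)
  have z: "C m $$ (i, j) = 0" if "m \<notin> int ` {..n}" for m
  proof -
    have "m < 0 \<or> m > int n" using that by (metis atMost_iff image_eqI int_nat_eq linorder_not_le nat_0_le zle_int)
    then show ?thesis using F C ij by (auto simp: mat_poly_curve_def)
  qed
  have "F t $$ (i, j) = (\<Sum>m\<in>S \<union> int ` {..n}. C m $$ (i, j) * t powi m)"
    unfolding S(3) by (rule sum.mono_neutral_left) (use S in auto)
  also have "\<dots> = (\<Sum>m\<in>int ` {..n}. C m $$ (i, j) * t powi m)"
    by (rule sum.mono_neutral_right) (use S z in auto)
  also have "\<dots> = (\<Sum>k\<le>n. t ^ k * C (int k) $$ (i, j))" by (simp add: sum.reindex mult.commute)
  finally show ?thesis .
qed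

subsection \<open>One-parameter subgroups of \<open>SL\<^sub>2\<close>\<close>

abbreviation upper :: "'k::field \<Rightarrow> 'k mat" where "upper t \<equiv> mat2 1 t 0 1"
abbreviation lower :: "'k::field \<Rightarrow> 'k mat" where "lower t \<equiv> mat2 1 0 t 1"
abbreviation torus :: "'k::field \<Rightarrow> 'k mat" where "torus t \<equiv> mat2 t 0 0 (inverse t)"

text \<open>In characteristic 2 this has determinant 1 and represents the nontrivial Weyl group element.\<close>

abbreviation weyl_elt :: "'k::field mat" where "weyl_elt \<equiv> mat2 0 1 1 0"

lemma subgroup_elements [simp]:
  "upper t \<in> carrier SL2" "lower t \<in> carrier SL2" "t \<noteq> 0 \<Longrightarrow> torus t \<in> carrier SL2"
  by (simp_all add: mat2_in_SL2)

lemma weyl_elt_in_SL2: "CHAR('k) = 2 \<Longrightarrow> (weyl_elt :: 'k::field mat) \<in> carrier SL2"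
  by (simp add: mat2_in_SL2 uminus_CHAR_2)

text \<open>The three families generate the group: \<open>upper t\<close> is \<open>lower t\<close>
  conjugated by \<open>weyl_elt\<close>, a matrix with nonzero upper left entry is a product of
  lower, torus and upper elements, and multiplication by \<open>weyl_elt\<close> reduces the
  remaining matrices to this case.\<close>

lemma rep_generated:
  fixes P :: "'k::field mat" and M N :: "('k mat, 'k) rep"
  assumes c2: "CHAR('k) = 2" and M: "is_rep SL2 M" and N: "is_rep SL2 N"
    and d: "dim_row P = rdim N" "dim_col P = rdim M"
    and lower: "\<And>t. P * act M (lower t) = act N (lower t) * P"
    and torus: "\<And>t. t \<noteq> 0 \<Longrightarrow> P * act M (torus t) = act N (torus t) * P"
    and weyl: "P * act M weyl_elt = act N weyl_elt * P"
  shows "P \<in> rep_hom SL2 M N"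
proof (rule rep_homI[OF d])
  note w = weyl_elt_in_SL2[OF c2]
  have mult: "P * act M (g * h) = act N (g * h) * P"
    if g: "g \<in> carrier SL2" "h \<in> carrier SL2" "P * act M g = act N g * P" "P * act M h = act N h * P" for g h
  proof -
    note dd = d is_rep_dims[OF M g(1)] is_rep_dims[OF N g(1)] is_rep_dims[OF M g(2)] is_rep_dims[OF N g(2)]
    have "P * act M (g * h) = (P * act M g) * act M h" using dd is_repD(2)[OF M g(1,2)] by (simp add: mm)
    also have "\<dots> = act N g * (P * act M h)" unfolding g(3) using dd by (simp add: mm)
    also have "\<dots> = act N (g * h) * P" unfolding g(4) using dd is_repD(2)[OF N g(1,2)] by (simp add: mm)
    finally show ?thesis .
  qed
  have closed: "g * h \<in> carrier SL2" if "g \<in> carrier SL2" "h \<in> carrier SL2" for g h :: "'k mat"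
    using group.is_monoid[OF group_SL2, THEN monoid.m_closed, of g h] that by simp
  have upper: "P * act M (upper t) = act N (upper t) * P" for t
  proof -
    have "upper t = weyl_elt * (lower t * weyl_elt)" by (simp add: mat2_mult)
    then show ?thesis
      using mult[of weyl_elt "lower t * weyl_elt"] mult[of "lower t" weyl_elt] closed[of "lower t" weyl_elt] w weyl lower
      by simp
  qed
  have big: "P * act M g = act N g * P" if g: "g = mat2 a b c e" "a * e - b * c = 1" "a \<noteq> 0" for g a b c e
  proof -
    have "g = lower (c / a) * (torus a * upper (b / a))"
      using g by (simp add: mat2_mult mat2_inject field_simps)
    then show ?thesis
      using mult[of "lower (c / a)" "torus a * upper (b / a)"] mult[of "torus a" "upper (b / a)"]
        closed[of "torus a" "upper (b / a)"] lower torus upper g(3)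
      by simp
  qed
  fix g :: "'k mat" assume "g \<in> carrier SL2"
  then show "P * act M g = act N g * P"
  proof (rule SL2_cases)
    fix a b c e assume g: "g = mat2 a b c e" "a * e - b * c = 1"
    show ?thesis
    proof (cases "a = 0")
      case False then show ?thesis using big g by blast
    next
      case True
      have e: "weyl_elt * mat2 c e a b = g" using g by (simp add: mat2_mult)
      have d1: "c * b - e * a = 1" "c \<noteq> 0" using g True by (auto simp: uminus_CHAR_2[OF c2] algebra_simps)
      then have "mat2 c e a b \<in> carrier SL2" by (simp add: mat2_in_SL2)
      then show ?thesis using mult[of weyl_elt "mat2 c e a b"] w weyl big[OF refl d1] e by simp
    qed
  qed
qed

text \<open>Only the restrictions of matrix coefficients to three one-parameter subgroups are
  recorded. Comparison of coefficients works with these, and they are easy to control on transposes,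
  submodules and quotients.\<close>

definition algebraic_rep :: "('k::field mat, 'k) rep \<Rightarrow> bool" where
  "algebraic_rep M \<longleftrightarrow> is_rep SL2 M \<and> (\<forall>i<rdim M. \<forall>j<rdim M.
     (\<exists>p. \<forall>t. act M (upper t) $$ (i, j) = poly p t) \<and>
     (\<exists>p. \<forall>t. act M (lower t) $$ (i, j) = poly p t) \<and>
     (\<exists>N p. \<forall>t. t \<noteq> 0 \<longrightarrow> act M (torus t) $$ (i, j) * t ^ N = poly p t))"

lemma algebraic_rep_entries:
  assumes "algebraic_rep M" "i < rdim M" "j < rdim M"
  shows "\<exists>p. \<forall>t. act M (upper t) $$ (i, j) = poly p t" "\<exists>p. \<forall>t. act M (lower t) $$ (i, j) = poly p t"
    "\<exists>N p. \<forall>t. t \<noteq> 0 \<longrightarrow> act M (torus t) $$ (i, j) * t ^ N = poly p t"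
  using assms unfolding algebraic_rep_def by blast+

lemma poly_fun_upper: "f \<in> poly_fun \<Longrightarrow> \<exists>p. \<forall>t. f (upper t) = poly p t"
proof (induction rule: poly_fun.induct)
  case (const c) show ?case by (intro exI[of _ "[:c:]"]) simp
next
  case (entry i j)
  have "\<forall>t. upper t $$ (i, j) = poly (if i = 0 then if j = 0 then 1 else [:0, 1:] else if j = 0 then 0 else 1) t"
    using entry by (auto simp: less_2_cases_iff)
  then show ?case by blast
next
  case (add f h) then show ?case by (metis poly_add)
next
  case (mult f h) then show ?case by (metis poly_mult)
qed

lemma poly_fun_lower: "f \<in> poly_fun \<Longrightarrow> \<exists>p. \<forall>t. f (lower t) = poly p t"
proof (induction rule: poly_fun.induct)
  case (const c) show ?case by (intro exI[of _ "[:c:]"]) simp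
next
  case (entry i j)
  have "\<forall>t. lower t $$ (i, j) = poly (if i = 1 then if j = 0 then [:0, 1:] else 1 else if j = 0 then 1 else 0) t"
    using entry by (auto simp: less_2_cases_iff)
  then show ?case by blast
next
  case (add f h) then show ?case by (metis poly_add)
next
  case (mult f h) then show ?case by (metis poly_mult)
qed

lemma poly_fun_torus: "f \<in> poly_fun \<Longrightarrow> \<exists>N p. \<forall>t. t \<noteq> 0 \<longrightarrow> f (torus t) * t ^ N = poly p t"
proof (induction rule: poly_fun.induct)
  case (const c) show ?case by (intro exI[of _ 0] exI[of _ "[:c:]"]) simp
next
  case (entry i j)
  have "\<forall>t. t \<noteq> 0 \<longrightarrow> torus t $$ (i, j) * t ^ 1 = poly (if i = 0 then if j = 0 then [:0, 0, 1:] else 0 else if j = 0 then 0 else 1) t"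
    using entry by (auto simp: less_2_cases_iff)
  then show ?case by blast
next
  case (add f h)
  then obtain N p N' p' where *: "\<And>t. t \<noteq> 0 \<Longrightarrow> f (torus t) * t ^ N = poly p t"
    "\<And>t. t \<noteq> 0 \<Longrightarrow> h (torus t) * t ^ N' = poly p' t" by metis
  have "\<forall>t. t \<noteq> 0 \<longrightarrow> (f (torus t) + h (torus t)) * t ^ (N + N') = poly (p * monom 1 N' + p' * monom 1 N) t"
    by (simp add: *[symmetric] poly_monom power_add algebra_simps)
  then show ?case by blast
next
  case (mult f h)
  then obtain N p N' p' where *: "\<And>t. t \<noteq> 0 \<Longrightarrow> f (torus t) * t ^ N = poly p t"
    "\<And>t. t \<noteq> 0 \<Longrightarrow> h (torus t) * t ^ N' = poly p' t" by metis
  have "\<forall>t. t \<noteq> 0 \<longrightarrow> (f (torus t) * h (torus t)) * t ^ (N + N') = poly (p * p') t"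
    by (simp add: *[symmetric] power_add algebra_simps)
  then show ?case by blast
qed

lemma SL2_module_algebraic: 
  assumes "SL2_module M"
  shows "algebraic_rep M"
  unfolding algebraic_rep_def
proof (intro conjI allI impI)
  show "is_rep SL2 M" using assms by (simp add: SL2_module_def)
  fix i j assume "i < rdim M" "j < rdim M"
  then obtain f where f: "f \<in> poly_fun" "\<And>g. g \<in> carrier SL2 \<Longrightarrow> act M g $$ (i, j) = f g"
    using assms unfolding SL2_module_def by blast
  show "\<exists>p. \<forall>t. act M (upper t) $$ (i, j) = poly p t" using poly_fun_upper[OF f(1)] f(2) by simp
  show "\<exists>p. \<forall>t. act M (lower t) $$ (i, j) = poly p t" using poly_fun_lower[OF f(1)] f(2) by simp
  show "\<exists>N p. \<forall>t. t \<noteq> 0 \<longrightarrow> act M (torus t) $$ (i, j) * t ^ N = poly p t" using poly_fun_torus[OF f(1)] f(2) by simp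
qed

lemma algebraic_repD: "algebraic_rep M \<Longrightarrow> is_rep SL2 M"
  by (simp add: algebraic_rep_def)

subsection \<open>Weight vectors\<close>

text \<open>Vectors are one-column matrices, so that the matrix rewriting applies to them. The zero
  vector has every weight here; where it matters, nonvanishing is stated separately.\<close>

definition weight_vec :: "('k::field mat, 'k) rep \<Rightarrow> int \<Rightarrow> 'k mat \<Rightarrow> bool" where
  "weight_vec M m v \<longleftrightarrow> dim_row v = rdim M \<and> dim_col v = 1 \<and>
     (\<forall>t. t \<noteq> 0 \<longrightarrow> act M (torus t) * v = t powi m \<cdot>\<^sub>m v)"

lemma weight_vecD:
  assumes "weight_vec M m v"
  shows "dim_row v = rdim M" "dim_col v = 1" "t \<noteq> 0 \<Longrightarrow> act M (torus t) * v = t powi m \<cdot>\<^sub>m v"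
  using assms by (auto simp: weight_vec_def)

definition weights_le :: "('k::field mat, 'k) rep \<Rightarrow> int \<Rightarrow> bool" where
  "weights_le M n \<longleftrightarrow> (\<forall>m v. m > n \<longrightarrow> weight_vec M m v \<longrightarrow> v = 0\<^sub>m (rdim M) 1)"

lemma torus_curve:
  assumes "algebraic_rep M"
  obtains A where "mat_curve (rdim M) (rdim M) A (\<lambda>t. act M (torus t))"
proof (rule mat_curve_exists)
  fix i j assume "i < rdim M" "j < rdim M"
  then obtain N p where "\<And>t. t \<noteq> 0 \<Longrightarrow> act M (torus t) $$ (i, j) * t ^ N = poly p t"
    using algebraic_rep_entries(3)[OF assms] by metis
  then show "\<exists>c. laurent_coeffs c (\<lambda>t. act M (torus t) $$ (i, j))" by (rule laurent_coeffs_exists)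
qed (use is_rep_dims[OF algebraic_repD[OF assms]] that in auto)

lemma torus_mult:
  assumes "is_rep SL2 M" "s \<noteq> 0" "t \<noteq> 0"
  shows "act M (torus s) * act M (torus t) = act M (torus (s * t))"
  using is_repD(2)[OF assms(1), of "torus s" "torus t"] assms(2,3) by (simp add: mat2_mult)

text \<open>\<open>A\<close> is the coefficient of \<open>t\<^sup>m\<close> in the action of the torus; the last clause compares coefficients.\<close>

definition weight_projector :: "('k::field mat, 'k) rep \<Rightarrow> int \<Rightarrow> 'k mat \<Rightarrow> bool" where
  "weight_projector M m A \<longleftrightarrow> dim_row A = rdim M \<and> dim_col A = rdim M \<and>
    (\<forall>t. t \<noteq> 0 \<longrightarrow> act M (torus t) * A = t powi m \<cdot>\<^sub>m A) \<and>
    (\<forall>t. t \<noteq> 0 \<longrightarrow> A * act M (torus t) = t powi m \<cdot>\<^sub>m A) \<and>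
    (\<forall>B y z. dim_col B = rdim M \<longrightarrow> dim_row y = rdim M \<longrightarrow>
       (\<forall>t. t \<noteq> 0 \<longrightarrow> B * (act M (torus t) * y) = t powi m \<cdot>\<^sub>m z) \<longrightarrow> B * (A * y) = z)"

lemma weight_projectorD:
  assumes "weight_projector M m A"
  shows "dim_row A = rdim M" "dim_col A = rdim M"
    "t \<noteq> 0 \<Longrightarrow> act M (torus t) * A = t powi m \<cdot>\<^sub>m A"
    "t \<noteq> 0 \<Longrightarrow> A * act M (torus t) = t powi m \<cdot>\<^sub>m A"
    "dim_col B = rdim M \<Longrightarrow> dim_row y = rdim M \<Longrightarrow> 
       (\<And>t. t \<noteq> 0 \<Longrightarrow> B * (act M (torus t) * y) = t powi m \<cdot>\<^sub>m z) \<Longrightarrow> B * (A * y) = z"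
  using assms by (auto simp: weight_projector_def)

text \<open>Both eigenvalue equations compare coefficients of \<open>t\<close> in
  \<open>act M (torus s) * act M (torus t) = act M (torus (s * t))\<close>, where scaling by
  \<open>s\<close> multiplies the coefficient of \<open>t^m\<close> by \<open>s^m\<close>.\<close>

lemma weight_projector_exists:
  fixes M :: "('k::alg_closed_field mat, 'k) rep"
  assumes M: "algebraic_rep M"
  obtains A where "weight_projector M m A"
proof -
  note R = algebraic_repD[OF M]
  have dt: "dim_row (act M (torus t)) = rdim M" "dim_col (act M (torus t)) = rdim M" if "t \<noteq> 0" for t
    using is_rep_dims[OF R] that by auto
  from torus_curve[OF M] obtain C where C: "mat_curve (rdim M) (rdim M) C (\<lambda>t. act M (torus t))" .
  note dC = mat_curve_dims(1,2)[OF C]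
  show thesis
  proof (rule that[of "C m"], unfold weight_projector_def, intro conjI allI impI)
    fix s :: 'k assume s: "s \<noteq> 0"
    note sc = mat_curve_scale[OF C s]
    show "act M (torus s) * C m = s powi m \<cdot>\<^sub>m C m"
      by (rule mat_curve_unique[OF mat_curve_mult_left[OF C dt[OF s]] sc]) (simp add: torus_mult[OF R s])
    show "C m * act M (torus s) = s powi m \<cdot>\<^sub>m C m"
      by (rule mat_curve_unique[OF mat_curve_mult_right[OF C dt[OF s]] sc])
        (use s in \<open>simp add: torus_mult[OF R] mult.commute\<close>)
  next
    fix B y z assume *: "dim_col B = rdim M" "dim_row y = rdim M"
      "\<forall>t. t \<noteq> 0 \<longrightarrow> B * (act M (torus t) * y) = t powi m \<cdot>\<^sub>m (z :: 'k mat)"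
    have dz: "dim_row z = dim_row B" "dim_col z = dim_col y"
      using arg_cong[OF *(3)[rule_format, of 1], of dim_row] arg_cong[OF *(3)[rule_format, of 1], of dim_col] by simp_all
    \<comment> \<open>The coefficient of \<open>t^m\<close> on both sides; the conditional is the
      coefficient family of the curve \<open>t powi m \<cdot>\<^sub>m z\<close>, taken at the index
      \<open>m\<close>.\<close>
    have "B * (C m * y) = (if m = m then z else 0\<^sub>m (dim_row B) (dim_col y))"
      by (rule mat_curve_unique[OF mat_curve_mult_left[OF mat_curve_mult_right[OF C *(2) refl] refl *(1)]
          mat_curve_powi[OF dz]]) (rule *(3)[rule_format])
    then show "B * (C m * y) = z" by simp
  qed (use dC in auto)
qed

subsection \<open>Contravariant transposition\<close>

text \<open>The dual module twisted by the anti-automorphism \<open>g\<close> to its transpose. In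
  contrast to the plain dual it keeps every weight, so that functionals dual to highest weight
  vectors are again highest weight vectors.\<close>

definition transpose_rep :: "('k::field mat, 'k) rep \<Rightarrow> ('k mat, 'k) rep" where
  "transpose_rep M = \<lparr>rdim = rdim M, act = (\<lambda>g. transpose_mat (act M (transpose_mat g)))\<rparr>"

lemma transpose_rep_simps [simp]:
  "rdim (transpose_rep M) = rdim M" "act (transpose_rep M) g = transpose_mat (act M (transpose_mat g))"
  by (simp_all add: transpose_rep_def)

lemma transpose_mult_dims: "dim_col A = dim_row B \<Longrightarrow> transpose_mat (A * B) = transpose_mat B * transpose_mat (A :: 'k::field mat)"
  by (rule transpose_mult[of A "dim_row A" "dim_col A" B "dim_col B"]) auto

lemma transpose_smult: "transpose_mat (c \<cdot>\<^sub>m A) = c \<cdot>\<^sub>m transpose_mat (A :: 'k::field mat)"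
  by (rule eq_matI) auto

lemma transpose_in_SL2: "g \<in> carrier SL2 \<Longrightarrow> transpose_mat g \<in> carrier SL2"
  by (elim SL2_cases) (simp add: mat2_transpose mat2_in_SL2 mult.commute)

lemma is_rep_transpose:
  assumes "is_rep SL2 M"
  shows "is_rep SL2 (transpose_rep M)"
proof (rule is_repI)
  fix g h :: "'a mat" assume g: "g \<in> carrier SL2" and h: "h \<in> carrier SL2"
  note g' = transpose_in_SL2[OF g] and h' = transpose_in_SL2[OF h]
  show "dim_row (act (transpose_rep M) g) = rdim (transpose_rep M)"
    "dim_col (act (transpose_rep M) g) = rdim (transpose_rep M)"
    by (simp_all add: is_rep_dims[OF assms g'])
  have "transpose_mat (g * h) = transpose_mat h * transpose_mat g"
    by (rule transpose_mult_dims) (simp add: SL2_dims g h)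
  then have "act M (transpose_mat (g * h)) = act M (transpose_mat h) * act M (transpose_mat g)"
    using is_repD(2)[OF assms h' g'] by simp
  then show "act (transpose_rep M) (g \<otimes>\<^bsub>SL2\<^esub> h) = act (transpose_rep M) g * act (transpose_rep M) h"
    by (simp add: transpose_mult_dims is_rep_dims[OF assms g'] is_rep_dims[OF assms h'])
qed (use is_repD(1)[OF assms] in simp)

lemma algebraic_rep_transpose:
  assumes M: "algebraic_rep M"
  shows "algebraic_rep (transpose_rep M)"
  unfolding algebraic_rep_def
proof (intro conjI allI impI)
  note R = algebraic_repD[OF M]
  show "is_rep SL2 (transpose_rep M)" by (rule is_rep_transpose[OF R])
  fix i j assume ij: "i < rdim (transpose_rep M)" "j < rdim (transpose_rep M)"
  show "\<exists>p. \<forall>t. act (transpose_rep M) (upper t) $$ (i, j) = poly p t"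
    "\<exists>p. \<forall>t. act (transpose_rep M) (lower t) $$ (i, j) = poly p t"
    using algebraic_rep_entries(1,2)[OF M, of j i] ij by (simp_all add: mat2_transpose is_rep_dims[OF R])
  from algebraic_rep_entries(3)[OF M, of j i] ij
  obtain N p where "\<forall>t. t \<noteq> 0 \<longrightarrow> act M (torus t) $$ (j, i) * t ^ N = poly p t" by auto
  then have "\<forall>t. t \<noteq> 0 \<longrightarrow> act (transpose_rep M) (torus t) $$ (i, j) * t ^ N = poly p t"
    using ij by (simp add: mat2_transpose is_rep_dims[OF R])
  then show "\<exists>N p. \<forall>t. t \<noteq> 0 \<longrightarrow> act (transpose_rep M) (torus t) $$ (i, j) * t ^ N = poly p t" by blast
qed

text \<open>The columns of the projector \<open>A\<close> to a weight \<open>m > n\<close> are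
  weight vectors of \<open>M\<close>, so \<open>A = 0\<close>; but a weight vector of the transpose
  is fixed by the transpose of \<open>A\<close>.\<close>

lemma weights_le_transpose:
  fixes M :: "('k::alg_closed_field mat, 'k) rep"
  assumes M: "algebraic_rep M" and n: "weights_le M n"
  shows "weights_le (transpose_rep M) n"
  unfolding weights_le_def
proof (intro allI impI)
  fix m v assume m: "m > n" and v: "weight_vec (transpose_rep M) m v"
  note dv = weight_vecD(1,2)[OF v, simplified]
  have dt: "dim_row (act M (torus t)) = rdim M" "dim_col (act M (torus t)) = rdim M" if "t \<noteq> 0" for t
    using is_rep_dims[OF algebraic_repD[OF M]] that by auto
  from weight_projector_exists[OF M] obtain A where "weight_projector M m A" .
  note A = weight_projectorD[OF this]
  have A0: "A * y = 0\<^sub>m (rdim M) 1" if "dim_row y = rdim M" "dim_col y = 1" for y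
  proof -
    have "weight_vec M m (A * y)"
      unfolding weight_vec_def
    proof (intro conjI allI impI)
      fix t :: 'k assume t: "t \<noteq> 0"
      have "act M (torus t) * (A * y) = (act M (torus t) * A) * y" using A(1,2) that dt[OF t] by (simp add: mm)
      also have "\<dots> = t powi m \<cdot>\<^sub>m (A * y)" unfolding A(3)[OF t] using A(1,2) that by (simp add: mm)
      finally show "act M (torus t) * (A * y) = t powi m \<cdot>\<^sub>m (A * y)" .
    qed (use A(1) that in simp_all)
    then show ?thesis using n m by (auto simp: weights_le_def)
  qed
  have "A = 0\<^sub>m (rdim M) (rdim M)"
  proof (rule ccontr)
    assume "A \<noteq> 0\<^sub>m (rdim M) (rdim M)"
    then obtain y z where "dim_row y = 1" "dim_col y = rdim M" "dim_row z = rdim M" "dim_col z = 1"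
      "y * (A * z) = 1 \<cdot>\<^sub>m 1\<^sub>m 1" using exists_pairing[of A 1] A by metis
    moreover from this A0[of z] have "y * (A * z) = 0\<^sub>m 1 1" by (simp add: mm)
    ultimately have "1 \<cdot>\<^sub>m 1\<^sub>m 1 = (0\<^sub>m 1 1 :: 'k mat)" by simp
    from arg_cong[OF this, of "\<lambda>A. A $$ (0, 0)"] show False by simp
  qed
  moreover have "transpose_mat v * (A * 1\<^sub>m (rdim M)) = transpose_mat v"
  proof (rule A(5))
    fix t :: 'k assume t: "t \<noteq> 0"
    have "transpose_mat (act M (torus t)) * v = t powi m \<cdot>\<^sub>m v"
      using weight_vecD(3)[OF v t] by (simp add: mat2_transpose)
    from arg_cong[OF this, of transpose_mat]
    show "transpose_mat v * (act M (torus t) * 1\<^sub>m (rdim M)) = t powi m \<cdot>\<^sub>m transpose_mat v"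
      using dv dt[OF t] by (simp add: transpose_mult_dims mm transpose_smult)
  qed (use dv in simp_all)
  ultimately have "transpose_mat v = 0\<^sub>m 1 (rdim M)" using dv by (simp add: mm)
  from arg_cong[OF this, of transpose_mat] show "v = 0\<^sub>m (rdim (transpose_rep M)) 1" by simp
qed

subsection \<open>Maps out of \<open>V \<otimes> W\<close>\<close>

lemma polynomial_sum:
  assumes "\<And>k. k < n \<Longrightarrow> \<exists>p. \<forall>t. f k t = poly p (t :: 'k::field)"
  shows "\<exists>p. \<forall>t. (\<Sum>k<(n::nat). f k t) = poly p t"
  using assms
proof (induction n)
  case 0 show ?case by (intro exI[of _ 0]) simp
next
  case (Suc n)
  from Suc.IH Suc.prems obtain p where p: "\<And>t. (\<Sum>k<n. f k t) = poly p t" by (metis less_SucI)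
  from Suc.prems[of n] obtain q where q: "\<And>t. f n t = poly q t" by auto
  show ?case by (intro exI[of _ "p + q"]) (simp add: p q)
qed

lemma polynomial_mat_mult:
  assumes "\<And>t. dim_row (A t) = r" "\<And>t. dim_col (A t) = k" "\<And>t. dim_row (B t) = k" "\<And>t. dim_col (B t) = s"
    and A: "\<And>i j. i < r \<Longrightarrow> j < k \<Longrightarrow> \<exists>p. \<forall>t. A t $$ (i, j) = poly p (t :: 'k::field)"
    and B: "\<And>i j. i < k \<Longrightarrow> j < s \<Longrightarrow> \<exists>p. \<forall>t. B t $$ (i, j) = poly p t"
    and ij: "i < r" "j < s"
  shows "\<exists>p. \<forall>t. (A t * B t) $$ (i, j) = poly p t"
proof -
  have "\<exists>p. \<forall>t. (\<Sum>l<k. A t $$ (i, l) * B t $$ (l, j)) = poly p t"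
  proof (rule polynomial_sum)
    fix l assume l: "l < k"
    from A[OF ij(1) l] B[OF l ij(2)] obtain p q where "\<And>t. A t $$ (i, l) = poly p t" "\<And>t. B t $$ (l, j) = poly q t"
      by metis
    then show "\<exists>p. \<forall>t. A t $$ (i, l) * B t $$ (l, j) = poly p t" by (intro exI[of _ "p * q"]) simp
  qed
  then show ?thesis using assms(1-4) ij by (simp add: mat_mult_entry del: index_mult_mat(1))
qed

lemma rep_mult_eq:
  assumes "is_rep SL2 M" "g \<in> carrier SL2" "h \<in> carrier SL2" "g * h = x"
  shows "act M g * act M h = act M x"
  using is_repD(2)[OF assms(1-3)] assms(4) by simp

lemma rep_mult_eq2:
  assumes "is_rep SL2 M" "g \<in> carrier SL2" "h \<in> carrier SL2" "g * h = x" "dim_row X = rdim M"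
  shows "act M g * (act M h * X) = act M x * (X :: 'k::field mat)"
  by (rule mat_assoc_rule[OF rep_mult_eq[OF assms(1-4)]]) (use assms in \<open>simp_all add: is_rep_dims\<close>)

text \<open>\<open>C\<close> is a highest weight vector of weight \<open>n\<close> in
  \<open>Hom(W, M)\<close>, or a Borel-equivariant map from \<open>k\<^sub>n \<otimes> W\<close> to
  \<open>M\<close>: upper unipotents act trivially on \<open>k\<^sub>n\<close> and the torus by
  \<open>t^n\<close>. For trivial \<open>W\<close> it is a vector of weight \<open>n\<close> fixed
  by the upper unipotents.\<close>

locale weight_hom =
  fixes M W :: "('k::alg_closed_field mat, 'k) rep" and C :: "'k mat" and n :: int
  assumes char2: "CHAR('k) = 2" and M: "algebraic_rep M" and W: "algebraic_rep W"
    and C_dims: "dim_row C = rdim M" "dim_col C = rdim W"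
    and upper: "\<And>t. act M (upper t) * C = C * act W (upper t)"
    and torus: "\<And>t. t \<noteq> 0 \<Longrightarrow> act M (torus t) * C = t powi n \<cdot>\<^sub>m (C * act W (torus t))"
begin

lemmas c2s = char2_two[OF char2] char2_add_self[OF char2] char2_add_left_self[OF char2]

lemmas repM = algebraic_repD[OF M] and repW = algebraic_repD[OF W]

lemmas wey = weyl_elt_in_SL2[OF char2]

lemma sg_dims [simp]:
  "dim_row (act M (upper t)) = rdim M" "dim_col (act M (upper t)) = rdim M"
  "dim_row (act M (lower t)) = rdim M" "dim_col (act M (lower t)) = rdim M"
  "dim_row (act M weyl_elt) = rdim M" "dim_col (act M weyl_elt) = rdim M"
  "t \<noteq> 0 \<Longrightarrow> dim_row (act M (torus t)) = rdim M" "t \<noteq> 0 \<Longrightarrow> dim_col (act M (torus t)) = rdim M"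
  "dim_row (act W (upper t)) = rdim W" "dim_col (act W (upper t)) = rdim W"
  "dim_row (act W (lower t)) = rdim W" "dim_col (act W (lower t)) = rdim W"
  "dim_row (act W weyl_elt) = rdim W" "dim_col (act W weyl_elt) = rdim W"
  "t \<noteq> 0 \<Longrightarrow> dim_row (act W (torus t)) = rdim W" "t \<noteq> 0 \<Longrightarrow> dim_col (act W (torus t)) = rdim W"
  by (simp_all add: is_rep_dims[OF repM] is_rep_dims[OF repW] wey)

lemmas C_dims [simp]

text \<open>The orbit of \<open>C\<close> under the lower unipotent subgroup acting on \<open>Hom(W, M)\<close>; note \<open>lower t\<close> is an
  involution.\<close>

definition orbit :: "'k \<Rightarrow> 'k mat" where
  "orbit t = act M (lower t) * (C * act W (lower t))"

lemma orbit_dims [simp]: "dim_row (orbit t) = rdim M" "dim_col (orbit t) = rdim W"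
  by (simp_all add: orbit_def)

lemma lower_mult [simp]:
  "act M (lower s) * act M (lower t) = act M (lower (s + t))"
  "act W (lower s) * act W (lower t) = act W (lower (s + t))"
  by (rule rep_mult_eq, simp_all add: repM repW mat2_mult add.commute)+

lemma lower_mult2 [simp]:
  "dim_row X = rdim M \<Longrightarrow> act M (lower s) * (act M (lower t) * X) = act M (lower (s + t)) * X"
  "dim_row Y = rdim W \<Longrightarrow> act W (lower s) * (act W (lower t) * Y) = act W (lower (s + t)) * Y"
  by (rule rep_mult_eq2, simp_all add: repM repW mat2_mult add.commute)+

lemma lower_zero [simp]: "act M (lower 0) = 1\<^sub>m (rdim M)" "act W (lower 0) = 1\<^sub>m (rdim W)"
  using is_repD(1)[OF repM] is_repD(1)[OF repW] by (simp_all add: mat2_one)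

lemma weyl_square [simp]:
  "act M weyl_elt * act M weyl_elt = 1\<^sub>m (rdim M)" "act W weyl_elt * act W weyl_elt = 1\<^sub>m (rdim W)"
  "dim_row X = rdim M \<Longrightarrow> act M weyl_elt * (act M weyl_elt * X) = X"
  "dim_row Y = rdim W \<Longrightarrow> act W weyl_elt * (act W weyl_elt * Y) = Y"
proof -
  have w: "weyl_elt * weyl_elt = (1\<^sub>m 2 :: 'k mat)" by (simp add: mat2_mult mat2_one)
  show "act M weyl_elt * act M weyl_elt = 1\<^sub>m (rdim M)" "act W weyl_elt * act W weyl_elt = 1\<^sub>m (rdim W)"
    using rep_mult_eq[OF repM wey wey w] rep_mult_eq[OF repW wey wey w]
      is_repD(1)[OF repM] is_repD(1)[OF repW] by simp_all
  show "dim_row X = rdim M \<Longrightarrow> act M weyl_elt * (act M weyl_elt * X) = X"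
    "dim_row Y = rdim W \<Longrightarrow> act W weyl_elt * (act W weyl_elt * Y) = Y"
    using rep_mult_eq2[OF repM wey wey w] rep_mult_eq2[OF repW wey wey w]
      is_repD(1)[OF repM] is_repD(1)[OF repW] by (simp_all add: mm)
qed

lemma orbit_lower: "act M (lower s) * orbit t = orbit (s + t) * act W (lower s)"
  by (simp add: orbit_def mm add.commute[of s] add.assoc c2s)

lemma orbit_torus:
  assumes a: "a \<noteq> 0"
  shows "act M (torus a) * orbit t = a powi n \<cdot>\<^sub>m (orbit (inverse a * inverse a * t) * act W (torus a))"
proof -
  let ?t = "inverse a * inverse a * t"
  have e: "torus a * lower t = lower ?t * torus a" 
    using a by (simp add: mat2_mult mat2_inject)
  have cM: "act M (torus a) * act M (lower t) = act M (lower ?t) * act M (torus a)"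
    using rep_mult_eq[OF repM _ _ e] rep_mult_eq[OF repM _ _ refl, of "lower ?t" "torus a"] a by simp
  have cW: "act W (torus a) * act W (lower t) = act W (lower ?t) * act W (torus a)"
    using rep_mult_eq[OF repW _ _ e] rep_mult_eq[OF repW _ _ refl, of "lower ?t" "torus a"] a by simp
  have "act M (torus a) * orbit t = (act M (torus a) * act M (lower t)) * (C * act W (lower t))"
    using a by (simp add: orbit_def mm)
  also have "\<dots> = act M (lower ?t) * ((act M (torus a) * C) * act W (lower t))"
    unfolding cM using a by (simp add: mm)
  also have "\<dots> = a powi n \<cdot>\<^sub>m (act M (lower ?t) * (C * (act W (torus a) * act W (lower t))))"
    unfolding torus[OF a] using a by (simp add: mm)
  also have "\<dots> = a powi n \<cdot>\<^sub>m (orbit ?t * act W (torus a))"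
    unfolding cW using a by (simp add: orbit_def mm)
  finally show ?thesis .
qed

text \<open>As \<open>2 = 0\<close>, \<open>lower t\<close> is the product of
  \<open>weyl_elt\<close>, \<open>lower (inverse t)\<close>, \<open>torus t\<close> and
  \<open>upper (inverse t)\<close>. The last two scale \<open>C\<close> by \<open>t^n\<close>, so
  the orbit at infinity is the reflection of the orbit at 0.\<close>

lemma orbit_weyl:
  assumes t: "t \<noteq> 0"
  shows "orbit t = t powi n \<cdot>\<^sub>m (act M weyl_elt * (orbit (inverse t) * act W weyl_elt))"
proof -
  let ?s = "inverse t"
  let ?x = "torus t * upper ?s"
  have x: "?x \<in> carrier SL2" "lower ?s * ?x \<in> carrier SL2"
    using t by (simp_all add: mat2_mult mat2_in_SL2 c2s algebra_simps)
  have e: "weyl_elt * (lower ?s * ?x) = lower t" using t by (simp add: mat2_mult c2s mat2_inject)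
  have lM: "act M (lower t) = act M weyl_elt * (act M (lower ?s) * (act M (torus t) * act M (upper ?s)))"
    using rep_mult_eq[OF repM wey x(2) e] rep_mult_eq[OF repM _ x(1) refl, of "lower ?s"]
      rep_mult_eq[OF repM _ _ refl, of "torus t" "upper ?s"] t by simp
  have lW: "act W (lower t) = act W weyl_elt * (act W (lower ?s) * (act W (torus t) * act W (upper ?s)))"
    using rep_mult_eq[OF repW wey x(2) e] rep_mult_eq[OF repW _ x(1) refl, of "lower ?s"]
      rep_mult_eq[OF repW _ _ refl, of "torus t" "upper ?s"] t by simp
  \<comment> \<open>The same factorisation on \<open>W\<close>, solved for the torus and upper
    factors. Multiplying by the involution \<open>lower t\<close> turns the product of
    \<open>torus t\<close>, \<open>upper ?s\<close> and \<open>lower t\<close> into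
    \<open>lower ?s\<close> times \<open>weyl_elt\<close>.\<close>
  have "act W (lower ?s) * (act W weyl_elt * act W (lower t)) = act W (torus t) * act W (upper ?s)"
    unfolding lW using t by (simp add: mm c2s)
  then have tW: "act W (torus t) * (act W (upper ?s) * act W (lower t)) = 
      act W (lower ?s) * (act W weyl_elt * (act W (lower t) * act W (lower t)))"
    using t mm_assoc[of "act W (torus t)" "act W (upper ?s)" "act W (lower t)"] 
      mm_assoc[of "act W (lower ?s)" "act W weyl_elt * act W (lower t)" "act W (lower t)"] by (simp add: mm)
  have "act M (lower t) * (C * act W (lower t)) =
     act M weyl_elt * (act M (lower ?s) * (act M (torus t) * ((act M (upper ?s) * C) * act W (lower t))))"
    unfolding lM using t by (simp add: mm)
  also have "\<dots> = act M weyl_elt * (act M (lower ?s) * ((act M (torus t) * C) * (act W (upper ?s) * act W (lower t))))"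
    unfolding upper using t by (simp add: mm)
  also have "\<dots> = t powi n \<cdot>\<^sub>m (act M weyl_elt * (act M (lower ?s) * (C * (act W (torus t) * (act W (upper ?s) * act W (lower t))))))"
    unfolding torus[OF t] using t by (simp add: mm)
  also have "\<dots> = t powi n \<cdot>\<^sub>m (act M weyl_elt * (orbit ?s * act W weyl_elt))"
    unfolding tW using t by (simp add: orbit_def mm c2s)
  finally show ?thesis by (simp add: orbit_def)
qed

lemma orbit_poly_curve: "\<exists>D. mat_poly_curve (rdim M) (rdim W) D orbit"
proof -
  have 1: "\<exists>p. \<forall>t. (C * act W (lower t)) $$ (i, j) = poly p t" if "i < rdim M" "j < rdim W" for i j
  proof (rule polynomial_mat_mult[of "\<lambda>t. C" "rdim M" "rdim W" "\<lambda>t. act W (lower t)" "rdim W"])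
    show "\<exists>p. \<forall>t. C $$ (i, j) = poly p t" for i j by (intro exI[of _ "[:C $$ (i, j):]"]) simp
  qed (use that algebraic_rep_entries(2)[OF W] in auto)
  have "\<exists>p. \<forall>t. orbit t $$ (i, j) = poly p t" if "i < rdim M" "j < rdim W" for i j
    unfolding orbit_def
    by (rule polynomial_mat_mult[of "\<lambda>t. act M (lower t)" "rdim M" "rdim M" "\<lambda>t. C * act W (lower t)" "rdim W"])
      (use that 1 algebraic_rep_entries(2)[OF M] in auto)
  then show ?thesis using mat_poly_curve_exists[of orbit "rdim M" "rdim W"] orbit_dims by metis
qed

definition orbit_coeff :: "int \<Rightarrow> 'k mat" where
  "orbit_coeff = (SOME D. mat_poly_curve (rdim M) (rdim W) D orbit)"

lemma orbit_coeff: "mat_poly_curve (rdim M) (rdim W) orbit_coeff orbit"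
  unfolding orbit_coeff_def by (rule someI_ex[OF orbit_poly_curve])

lemma orbit_coeff_curve: "mat_curve (rdim M) (rdim W) orbit_coeff orbit"
  using orbit_coeff by (simp add: mat_poly_curve_def)

lemma orbit_coeff_dims [simp]: "dim_row (orbit_coeff j) = rdim M" "dim_col (orbit_coeff j) = rdim W"
  using mat_curve_dims[OF orbit_coeff_curve] by auto

lemma orbit_coeff_0: "orbit_coeff 0 = C"
proof -
  have "orbit_coeff 0 = orbit 0" using orbit_coeff by (simp add: mat_poly_curve_def)
  then show ?thesis by (simp add: orbit_def mm)
qed

lemma orbit_coeff_weyl: "act M weyl_elt * (orbit_coeff (n - j) * act W weyl_elt) = orbit_coeff j"
proof -
  have "mat_curve (rdim M) (rdim W) (\<lambda>j. act M weyl_elt * (orbit_coeff (n - j) * act W weyl_elt))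
     (\<lambda>t. act M weyl_elt * ((t powi n \<cdot>\<^sub>m orbit (inverse t)) * act W weyl_elt))"
    by (rule mat_curve_mult_left[OF mat_curve_mult_right[OF mat_curve_flip[OF orbit_coeff_curve]]]) simp_all
  from this orbit_coeff_curve show ?thesis
  proof (rule mat_curve_unique)
    fix t :: 'k assume t: "t \<noteq> 0"
    show "act M weyl_elt * ((t powi n \<cdot>\<^sub>m orbit (inverse t)) * act W weyl_elt) = orbit t"
      using orbit_weyl[OF t] by (simp add: mm)
  qed
qed

text \<open>The orbit has no negative powers of \<open>t\<close>, and the reflection exchanges the
  coefficients \<open>j\<close> and \<open>n - j\<close>; this bounds the degree by
  \<open>n\<close>.\<close>

lemma orbit_coeff_high: "j > n \<Longrightarrow> orbit_coeff j = 0\<^sub>m (rdim M) (rdim W)"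
  using orbit_coeff orbit_coeff_weyl[of j, symmetric] by (simp add: mat_poly_curve_def mm)

lemma orbit_coeff_torus:
  assumes a: "a \<noteq> 0"
  shows "act M (torus a) * orbit_coeff j = a powi (n - 2 * j) \<cdot>\<^sub>m (orbit_coeff j * act W (torus a))"
proof -
  have a': "inverse a * inverse a \<noteq> 0" using a by simp
  have 1: "mat_curve (rdim M) (rdim W) (\<lambda>j. act M (torus a) * orbit_coeff j) (\<lambda>t. act M (torus a) * orbit t)"
    by (rule mat_curve_mult_left[OF orbit_coeff_curve]) (use a in simp_all)
  \<comment> \<open>The scalar \<open>a powi n\<close> is written as a scalar matrix, so that the
    rule for left multiplication covers it.\<close>
  have 2: "mat_curve (rdim M) (rdim W) (\<lambda>j. (a powi n \<cdot>\<^sub>m 1\<^sub>m (rdim M)) * (((inverse a * inverse a) powi j \<cdot>\<^sub>m orbit_coeff j) * act W (torus a)))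
      (\<lambda>t. (a powi n \<cdot>\<^sub>m 1\<^sub>m (rdim M)) * (orbit (inverse a * inverse a * t) * act W (torus a)))"
    by (rule mat_curve_mult_left[OF mat_curve_mult_right[OF mat_curve_scale[OF orbit_coeff_curve a']]]) (use a in simp_all)
  have "act M (torus a) * orbit_coeff j = 
      (a powi n \<cdot>\<^sub>m 1\<^sub>m (rdim M)) * (((inverse a * inverse a) powi j \<cdot>\<^sub>m orbit_coeff j) * act W (torus a))"
    by (rule mat_curve_unique[OF 1 2]) (use a in \<open>simp add: orbit_torus mm\<close>)
  also have "\<dots> = (a powi n * (inverse a * inverse a) powi j) \<cdot>\<^sub>m (orbit_coeff j * act W (torus a))"
    using a by (simp add: mm mult.commute)
  also have "(inverse a * inverse a) powi j = a powi (- 2 * j)"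
    using a by (simp add: power_int_mult_distrib power_int_minus power_int_mult power2_eq_square
      flip: power_int_inverse)
  also have "a powi n * a powi (- 2 * j) = a powi (n - 2 * j)"
    using a by (simp flip: power_int_add)
  finally show ?thesis .
qed

end

text \<open>For \<open>n = 1\<close>, Frobenius reciprocity extends a Borel-equivariant map \<open>k\<^sub>1 \<otimes> W \<rightarrow> M\<close> to \<open>V \<otimes> W\<close>: \<open>V\<close> is
  the Weyl module of highest weight 1.\<close>

locale weight_one_hom = weight_hom M W C 1 for M W C
begin

definition C' :: "'a mat" where
  "C' = act M weyl_elt * (C * act W weyl_elt)"

lemma C'_dims [simp]: "dim_row C' = rdim M" "dim_col C' = rdim W"
  by (simp_all add: C'_def)

lemma orbit_coeff_1: "orbit_coeff 1 = C'"
  using orbit_coeff_weyl[of 1] by (simp add: orbit_coeff_0 C'_def)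

lemma orbit_eq: "orbit t = C + t \<cdot>\<^sub>m C'"
proof (rule eq_matI)
  fix i j assume "i < dim_row (C + t \<cdot>\<^sub>m C')" "j < dim_col (C + t \<cdot>\<^sub>m C')"
  then have ij: "i < rdim M" "j < rdim W" by auto
  have "orbit t $$ (i, j) = (\<Sum>k\<le>1. t ^ k * orbit_coeff (int k) $$ (i, j))"
    by (rule mat_poly_curve_eval[OF orbit_coeff _ ij]) (use orbit_coeff_high in auto)
  then show "orbit t $$ (i, j) = (C + t \<cdot>\<^sub>m C') $$ (i, j)"
    using ij by (simp add: orbit_coeff_0 orbit_coeff_1)
qed simp_all

lemma induced_hom: "hcat C C' \<in> rep_hom SL2 (rep_tensor natural_rep W) M"
proof (rule rep_generated[OF char2 is_rep_tensor2[OF is_rep_natural _ repW] repM])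
  show "hcat C C' * act (rep_tensor natural_rep W) weyl_elt = act M weyl_elt * hcat C C'"
    by (simp add: hcat_kron2 mult_hcat mm) (simp add: C'_def mm)
  have 1: "act M (lower t) * C = (C + t \<cdot>\<^sub>m C') * act W (lower t)" for t
    using orbit_lower[of t 0] by (simp add: orbit_eq mm)
  \<comment> \<open>The orbit is affine in its parameter, so its equivariance at 1 compared with
    that at 0 isolates \<open>C'\<close>.\<close>
  have "act M (lower t) * (C + 1 \<cdot>\<^sub>m C') = (C + (t + 1) \<cdot>\<^sub>m C') * act W (lower t)" for t
    using orbit_lower[of t 1] by (simp add: orbit_eq)
  then have 2: "act M (lower t) * C + act M (lower t) * C' = (C + (t + 1) \<cdot>\<^sub>m C') * act W (lower t)" for t
    by (simp add: mm)
  have 3: "act M (lower t) * C' = C' * act W (lower t)" for t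
  proof (rule eq_matI)
    fix i j assume "i < dim_row (C' * act W (lower t))" "j < dim_col (C' * act W (lower t))"
    then have ij: "i < rdim M" "j < rdim W" by auto
    from arg_cong[OF 2[of t], of "\<lambda>A. A $$ (i, j)"] ij 
    show "(act M (lower t) * C') $$ (i, j) = (C' * act W (lower t)) $$ (i, j)"
      by (simp add: 1 mm algebra_simps del: index_mult_mat(1))
  qed simp_all
  show "hcat C C' * act (rep_tensor natural_rep W) (lower t) = act M (lower t) * hcat C C'" for t
    by (simp add: hcat_kron2 mult_hcat mm 1 3)
  show "hcat C C' * act (rep_tensor natural_rep W) (torus t) = act M (torus t) * hcat C C'" if t: "t \<noteq> 0" for t
    using orbit_coeff_torus[OF t, of 1] torus[OF t] t
    by (simp add: hcat_kron2 mult_hcat mm orbit_coeff_1 power_int_minus)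
qed (simp_all add: mult_2)

end

lemma transpose_hcat: "dim_row A = dim_row B \<Longrightarrow> transpose_mat (hcat A B) = vcat (transpose_mat A) (transpose_mat B)"
  by (rule eq_matI) (auto simp: hcat_def vcat_def)

lemma transpose_kron2:
  assumes "dim_row A = 2" "dim_col A = 2"
  shows "transpose_mat (kronecker_mat A B) = kronecker_mat (transpose_mat A) (transpose_mat B)"
proof -
  have "transpose_mat (kronecker_mat A B) = 
     four_block_mat (A $$ (0, 0) \<cdot>\<^sub>m transpose_mat B) (A $$ (1, 0) \<cdot>\<^sub>m transpose_mat B)
      (A $$ (0, 1) \<cdot>\<^sub>m transpose_mat B) (A $$ (1, 1) \<cdot>\<^sub>m transpose_mat B)"
    unfolding kron2[OF assms] by (rule eq_matI) auto
  then show ?thesis using assms by (simp add: kron2)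
qed

text \<open>The complement of the nonzero retract \<open>N\<close> has dimension 0, so
  \<open>Q\<close> is a one-sided inverse of a square matrix and hence an isomorphism.\<close>

lemma indecomposable_split_iso:
  assumes M: "rep_indecomposable G M" and N: "is_rep G N" "rdim N > 0"
    and P: "P \<in> rep_hom G N M" and Q: "Q \<in> rep_hom G M N" and QP: "Q * P = 1\<^sub>m (rdim N)"
  shows "rep_iso G M N"
proof -
  have R: "is_rep G M" using M by (simp add: rep_indecomposable_def)
  note d = rep_homD(1,2)[OF P] rep_homD(1,2)[OF Q]
  from split_summand[OF R N(1) P Q QP] obtain K I J where K: "is_rep G K" 
    "rep_iso G M (rep_sum N K)" "rdim M = rdim N + rdim K" by metis
  then have "rdim K = 0" using M N by (auto simp: rep_indecomposable_def)
  then have MN: "rdim M = rdim N" using K by simp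
  have "P * Q = 1\<^sub>m (rdim M)"
    by (rule mat_mult_left_right_inverse[of Q "rdim M"]) (use d QP MN in \<open>auto intro!: carrier_matI\<close>)
  then show ?thesis by (intro rep_isoI[OF Q _ _ QP]) (use d in auto)
qed

text \<open>Reduces the identification of \<open>M\<close> to Borel data: \<open>C\<close> and the
  transpose of \<open>R\<close> are equivariant maps from \<open>k\<^sub>1 \<otimes> W\<close> to
  \<open>M\<close> and to its contravariant transpose. The symmetry assumed of \<open>W\<close>
  makes \<open>V \<otimes> W\<close> its own contravariant transpose, so the second induced map can
  be transposed into one from \<open>M\<close> to \<open>V \<otimes> W\<close>.\<close>

lemma indecomposable_iso_tensor:
  fixes M W :: "('k::alg_closed_field mat, 'k) rep"
  assumes char2: "CHAR('k) = 2" and M: "algebraic_rep M" "rep_indecomposable SL2 M"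
    and W: "algebraic_rep W" "rdim W > 0"
      "\<And>g. g \<in> carrier SL2 \<Longrightarrow> act W (transpose_mat g) = transpose_mat (act W g)"
    and d: "dim_row C = rdim M" "dim_col C = rdim W" "dim_row R = rdim W" "dim_col R = rdim M"
    and C: "\<And>t. act M (upper t) * C = C * act W (upper t)"
      "\<And>t. t \<noteq> 0 \<Longrightarrow> act M (torus t) * C = t \<cdot>\<^sub>m (C * act W (torus t))"
    and R: "\<And>t. R * act M (lower t) = act W (lower t) * R"
      "\<And>t. t \<noteq> 0 \<Longrightarrow> R * act M (torus t) = t \<cdot>\<^sub>m (act W (torus t) * R)"
    and RC: "R * C = 1\<^sub>m (rdim W)"
  shows "rep_iso SL2 M (rep_tensor natural_rep W)"
proof -
  interpret C: weight_one_hom M W C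
    by unfold_locales (use assms in auto)
  note wey = weyl_elt_in_SL2[OF char2]
  have Wsym: "transpose_mat (act W (mat2 a b c e)) = act W (mat2 a c b e)" if "mat2 a b c e \<in> carrier SL2" for a b c e
    using W(3)[OF that] by (simp add: mat2_transpose)
  let ?M = "transpose_rep M"
  interpret R: weight_one_hom ?M W "transpose_mat R"
  proof unfold_locales
    show "act ?M (upper t) * transpose_mat R = transpose_mat R * act W (upper t)" for t
      using arg_cong[OF R(1)[of t], of transpose_mat] d by (simp add: mat2_transpose transpose_mult_dims Wsym)
    show "act ?M (torus t) * transpose_mat R = t powi 1 \<cdot>\<^sub>m (transpose_mat R * act W (torus t))" if "t \<noteq> 0" for t
      using arg_cong[OF R(2)[OF that], of transpose_mat] d that
      by (simp add: mat2_transpose transpose_mult_dims transpose_smult Wsym)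
  qed (use assms algebraic_rep_transpose in auto)
  have dims [simp]: "dim_row C = rdim M" "dim_col C = rdim W" "dim_row R = rdim W" "dim_col R = rdim M"
    using d by auto
  define R' where "R' = act W weyl_elt * (R * act M weyl_elt)"
  have R'_dims [simp]: "dim_row R' = rdim W" "dim_col R' = rdim M" by (simp_all add: R'_def)
  have R'_eq: "transpose_mat R.C' = R'"
    unfolding R.C'_def R'_def by (simp add: transpose_mult_dims mat2_transpose Wsym wey mm)
  let ?N = "rep_tensor natural_rep W"
  have N: "is_rep SL2 ?N" by (rule is_rep_tensor2[OF is_rep_natural _ C.repW]) simp
  have Q: "vcat R R' \<in> rep_hom SL2 M ?N"
  proof (rule rep_homI)
    fix g :: "'k mat" assume g: "g \<in> carrier SL2"
    note g' = transpose_in_SL2[OF g]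
    note dg = SL2_dims[OF g] is_rep_dims[OF C.repM g] is_rep_dims[OF C.repW g]
    have "hcat (transpose_mat R) R.C' * kronecker_mat (transpose_mat g) (act W (transpose_mat g)) =
       transpose_mat (act M g) * hcat (transpose_mat R) R.C'"
      using rep_homD(3)[OF R.induced_hom g'] by simp
    from arg_cong[OF this, of transpose_mat]
    have "kronecker_mat g (act W g) * vcat R R' = vcat R R' * act M g"
      using dg by (simp add: transpose_mult_dims kron2_dim transpose_hcat transpose_kron2 W(3)[OF g] R'_eq)
    then show "vcat R R' * act M g = act ?N g * vcat R R'" by simp
  qed (simp_all add: mult_2)
  note P = C.induced_hom
  \<comment> \<open>The composite is 1 up to off-diagonal blocks, which vanish because it commutes with \<open>lower 1\<close>.\<close>
  let ?Z = "vcat R R' * hcat C C.C'"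
  have ZZ: "?Z \<in> rep_hom SL2 ?N ?N" by (rule rep_hom_comp[OF N C.repM N P Q])
  let ?U = "act W (lower 1)" and ?n = "rdim W"
  let ?E = "R * C.C'" and ?E' = "R' * C"
  have R'C': "R' * C.C' = 1\<^sub>m ?n"
  proof -
    have "R' * C.C' = act W weyl_elt * ((R * C) * act W weyl_elt)" by (simp add: R'_def C.C'_def mm)
    then show ?thesis unfolding RC by (simp add: mm)
  qed
  have Z: "?Z = four_block_mat (1\<^sub>m ?n) ?E ?E' (1\<^sub>m ?n)"
    by (simp add: vcat_mult_hcat RC R'C')
  have "?Z * kronecker_mat (lower 1) ?U = kronecker_mat (lower 1) ?U * ?Z"
    using rep_homD(3)[OF ZZ, of "lower 1"] by simp
  then have "four_block_mat (?U + ?E * ?U) (?E * ?U) (?E' * ?U + ?U) ?U = 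
      four_block_mat ?U (?U * ?E) (?U + ?U * ?E') (?U * ?E + ?U)"
    unfolding Z by (simp add: kron2 four_block_mult mm)
  then have b: "?U + ?E * ?U = ?U"
  proof -
    assume *: "four_block_mat (?U + ?E * ?U) (?E * ?U) (?E' * ?U + ?U) ?U = 
      four_block_mat ?U (?U * ?E) (?U + ?U * ?E') (?U * ?E + ?U)"
    show ?thesis
    proof (rule eq_matI)
      fix i j assume "i < dim_row ?U" "j < dim_col ?U"
      then show "(?U + ?E * ?U) $$ (i, j) = ?U $$ (i, j)"
        using arg_cong[OF *, of "\<lambda>A. A $$ (i, j)"] by (simp del: index_mult_mat(1))
    qed simp_all
  qed
  have "?E * ?U = 0\<^sub>m ?n ?n"
  proof (rule eq_matI)
    fix i j assume "i < dim_row (0\<^sub>m ?n ?n :: 'k mat)" "j < dim_col (0\<^sub>m ?n ?n :: 'k mat)"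
    then show "(?E * ?U) $$ (i, j) = 0\<^sub>m ?n ?n $$ (i, j)"
      using arg_cong[OF b, of "\<lambda>A. A $$ (i, j)"] by (simp del: index_mult_mat(1))
  qed simp_all
  \<comment> \<open>\<open>?U\<close> is an involution, as \<open>lower 1\<close> is, and so it
    cancels.\<close>
  then have "(?E * ?U) * ?U = 0\<^sub>m ?n ?n" by (simp add: mm)
  moreover have "(?E * ?U) * ?U = ?E * (?U * ?U)" by (rule mm_assoc) simp_all
  ultimately have E: "?E = 0\<^sub>m ?n ?n" by (simp only: C.lower_mult C.c2s C.lower_zero) (simp add: mm)
  have "?E' = act W weyl_elt * (?E * act W weyl_elt)" by (simp add: R'_def C.C'_def mm)
  then have E': "?E' = 0\<^sub>m ?n ?n" unfolding E by (simp add: mm)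
  have QP: "?Z = 1\<^sub>m (rdim ?N)" unfolding Z E E' by (simp add: mult_2)
  show ?thesis by (rule indecomposable_split_iso[OF M(2) N _ P Q QP]) (use W in simp)
qed

subsection \<open>Highest weight vectors\<close>

lemma algebraic_trivial: "algebraic_rep (trivial_rep :: ('k::field mat, 'k) rep)"
  unfolding algebraic_rep_def
proof (intro conjI allI impI is_rep_trivial)
  fix i j assume "i < rdim (trivial_rep :: ('k mat, 'k) rep)" "j < rdim (trivial_rep :: ('k mat, 'k) rep)"
  then have [simp]: "i = 0" "j = 0" by auto
  show "\<exists>p. \<forall>t. act trivial_rep (upper t) $$ (i, j) = poly p (t :: 'k)"
    "\<exists>p. \<forall>t. act trivial_rep (lower t) $$ (i, j) = poly p (t :: 'k)" by (intro exI[of _ 1]; simp)+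
  show "\<exists>N p. \<forall>t. t \<noteq> 0 \<longrightarrow> act trivial_rep (torus t) $$ (i, j) * t ^ N = poly p (t :: 'k)"
    by (intro exI[of _ 0] exI[of _ 1]) simp
qed

lemma algebraic_natural: "algebraic_rep (natural_rep :: ('k::field mat, 'k) rep)"
  unfolding algebraic_rep_def
proof (intro conjI allI impI is_rep_natural)
  fix i j assume "i < rdim (natural_rep :: ('k mat, 'k) rep)" "j < rdim (natural_rep :: ('k mat, 'k) rep)"
  then have "(\<lambda>g. g $$ (i, j)) \<in> (poly_fun :: ('k mat \<Rightarrow> 'k) set)" by (auto intro: poly_fun.entry)
  from poly_fun_upper[OF this] poly_fun_lower[OF this] poly_fun_torus[OF this]
  show "\<exists>p. \<forall>t. act natural_rep (upper t) $$ (i, j) = poly p (t :: 'k)"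
    "\<exists>p. \<forall>t. act natural_rep (lower t) $$ (i, j) = poly p (t :: 'k)"
    "\<exists>N p. \<forall>t. t \<noteq> 0 \<longrightarrow> act natural_rep (torus t) $$ (i, j) * t ^ N = poly p (t :: 'k)" by simp_all
qed

lemma algebraic_frobenius:
  assumes "CHAR('k) = 2"
  shows "algebraic_rep (frobenius_rep :: ('k::field mat, 'k) rep)"
  unfolding algebraic_rep_def
proof (intro conjI allI impI is_rep_frobenius assms)
  fix i j assume "i < rdim (frobenius_rep :: ('k mat, 'k) rep)" "j < rdim (frobenius_rep :: ('k mat, 'k) rep)"
  then have ij: "i < 2" "j < 2" by auto
  then have "(\<lambda>g. g $$ (i, j) * g $$ (i, j)) \<in> (poly_fun :: ('k mat \<Rightarrow> 'k) set)"
    by (auto intro: poly_fun.entry poly_fun.mult)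
  note p = poly_fun_upper[OF this] poly_fun_lower[OF this] poly_fun_torus[OF this]
  have e: "act frobenius_rep (mat2 a b c d) $$ (i, j) = mat2 a b c d $$ (i, j) * mat2 a b c d $$ (i, j)" for a b c d :: 'k
    using ij by (auto simp: less_2_cases_iff)
  show "\<exists>p. \<forall>t. act frobenius_rep (upper t) $$ (i, j) = poly p (t :: 'k)"
    "\<exists>p. \<forall>t. act frobenius_rep (lower t) $$ (i, j) = poly p (t :: 'k)"
    "\<exists>N p. \<forall>t. t \<noteq> 0 \<longrightarrow> act frobenius_rep (torus t) $$ (i, j) * t ^ N = poly p (t :: 'k)"
    unfolding e using p by simp_all
qed

lemma frobenius_transpose: "g \<in> carrier SL2 \<Longrightarrow> act frobenius_rep (transpose_mat g) = transpose_mat (act frobenius_rep g)"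
  by (elim SL2_cases) (simp add: mat2_transpose)

lemma algebraic_torus_dims:
  assumes "algebraic_rep M"
  shows "dim_row (act M (upper t)) = rdim M" "dim_col (act M (upper t)) = rdim M"
    "dim_row (act M (lower t)) = rdim M" "dim_col (act M (lower t)) = rdim M"
    "t \<noteq> 0 \<Longrightarrow> dim_row (act M (torus t)) = rdim M" "t \<noteq> 0 \<Longrightarrow> dim_col (act M (torus t)) = rdim M"
  by (simp_all add: is_rep_dims[OF algebraic_repD[OF assms]])

text \<open>\<open>D j\<close> is the divided power \<open>e^(j)\<close> applied to
  \<open>v\<close>. Conjugation by \<open>torus a\<close> multiplies \<open>t\<close> by
  \<open>a^2\<close>, which adds \<open>2 * j\<close> to the weight.\<close>

lemma upper_curve:
  fixes M :: "('k::alg_closed_field mat, 'k) rep"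
  assumes M: "algebraic_rep M" and v: "weight_vec M k v"
  obtains D where "mat_poly_curve (rdim M) 1 D (\<lambda>t. act M (upper t) * v)" "\<And>j. weight_vec M (k + 2 * j) (D j)" "D 0 = v"
proof -
  note R = algebraic_repD[OF M]
  note d [simp] = weight_vecD(1,2)[OF v] algebraic_torus_dims[OF M]
  have p: "\<exists>p. \<forall>t. (act M (upper t) * v) $$ (i, j) = poly p t" if "i < rdim M" "j < 1" for i j
  proof (rule polynomial_mat_mult[of "\<lambda>t. act M (upper t)" "rdim M" "rdim M" "\<lambda>t. v" 1])
    show "\<exists>p. \<forall>t. v $$ (i, j) = poly p t" for i j by (intro exI[of _ "[:v $$ (i, j):]"]) simp
  qed (use that algebraic_rep_entries(1)[OF M] in auto)
  obtain D where D: "mat_poly_curve (rdim M) 1 D (\<lambda>t. act M (upper t) * v)"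
    by (rule mat_poly_curve_exists[of "\<lambda>t. act M (upper t) * v" "rdim M" 1]) (simp_all add: p del: index_mult_mat(1))
  then have c: "mat_curve (rdim M) 1 D (\<lambda>t. act M (upper t) * v)" by (simp add: mat_poly_curve_def)
  note dD = mat_curve_dims(1,2)[OF c]
  have "weight_vec M (k + 2 * j) (D j)" for j
    unfolding weight_vec_def
  proof (intro conjI allI impI dD)
    fix a :: 'k assume a: "a \<noteq> 0"
    have aa: "a * a \<noteq> 0" using a by simp
    have e: "torus a * upper t = upper (a * a * t) * torus a" for t
      using a by (simp add: mat2_mult mat2_inject)
    have eq: "act M (torus a) * (act M (upper t) * v) = (a powi k \<cdot>\<^sub>m 1\<^sub>m (rdim M)) * (act M (upper (a * a * t)) * v)" for t
    proof -
      have "act M (torus a) * (act M (upper t) * v) = act M (upper (a * a * t)) * (act M (torus a) * v)"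
        using rep_mult_eq2[OF R _ _ e[of t], of v] rep_mult_eq2[OF R _ _ refl, of "upper (a * a * t)" "torus a" v] a by simp
      then show ?thesis using weight_vecD(3)[OF v a] by (simp add: mm)
    qed
    have "act M (torus a) * D j = (a powi k \<cdot>\<^sub>m 1\<^sub>m (rdim M)) * ((a * a) powi j \<cdot>\<^sub>m D j)"
      by (rule mat_curve_unique[OF mat_curve_mult_left[OF c] mat_curve_mult_left[OF mat_curve_scale[OF c aa]]])
        (use a eq in simp_all)
    also have "\<dots> = (a powi k * (a * a) powi j) \<cdot>\<^sub>m D j" using dD by (simp add: mm mult.commute)
    also have "(a * a) powi j = a powi (2 * j)" by (simp add: power_int_mult power2_eq_square)
    also have "a powi k * a powi (2 * j) = a powi (k + 2 * j)" using a by (simp add: power_int_add)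
    finally show "act M (torus a) * D j = a powi (k + 2 * j) \<cdot>\<^sub>m D j" .
  qed
  moreover have "D 0 = v"
    using D is_repD(1)[OF R] by (simp add: mat_poly_curve_def mat2_one mm)
  ultimately show thesis using that D by blast
qed

lemma weights_leD: "weights_le M n \<Longrightarrow> weight_vec M m v \<Longrightarrow> m > n \<Longrightarrow> v = 0\<^sub>m (rdim M) 1"
  by (auto simp: weights_le_def)

text \<open>All coefficients of the curve except the constant one have weights beyond the
  bound.\<close>

lemma upper_highest_weight_vec:
  fixes M :: "('k::alg_closed_field mat, 'k) rep"
  assumes M: "algebraic_rep M" and n: "weights_le M n" and v: "weight_vec M n v"
  shows "act M (upper t) * v = v"
proof -
  from upper_curve[OF M v] obtain D where D: "mat_poly_curve (rdim M) 1 D (\<lambda>t. act M (upper t) * v)"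
    "\<And>j. weight_vec M (n + 2 * j) (D j)" "D 0 = v" by blast
  note d [simp] = weight_vecD(1,2)[OF v] algebraic_torus_dims[OF M]
  have z: "D m = 0\<^sub>m (rdim M) 1" if "m > int 0" for m
    using that by (intro weights_leD[OF n D(2)]) simp
  show ?thesis
  proof (rule eq_matI)
    fix i j assume "i < dim_row v" "j < dim_col v"
    then have "(act M (upper t) * v) $$ (i, j) = (\<Sum>k\<le>0. t ^ k * D (int k) $$ (i, j))"
      by (intro mat_poly_curve_eval[OF D(1) z]) auto
    then show "(act M (upper t) * v) $$ (i, j) = v $$ (i, j)" by (simp add: D(3))
  qed simp_all
qed

lemma upper_weight_zero_vec:
  fixes M :: "('k::alg_closed_field mat, 'k) rep"
  assumes M: "algebraic_rep M" and n: "weights_le M 2" and b: "weight_vec M 0 b"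
  obtains v where "weight_vec M 2 v" "\<And>t. act M (upper t) * b = b + t \<cdot>\<^sub>m v"
proof -
  from upper_curve[OF M b] obtain D where D: "mat_poly_curve (rdim M) 1 D (\<lambda>t. act M (upper t) * b)"
    "\<And>j. weight_vec M (0 + 2 * j) (D j)" "D 0 = b" by blast
  note d [simp] = weight_vecD(1,2)[OF b] algebraic_torus_dims[OF M] weight_vecD(1,2)[OF D(2)]
  have z: "D m = 0\<^sub>m (rdim M) 1" if "m > int 1" for m
    using that by (intro weights_leD[OF n D(2)]) simp
  show thesis
  proof (rule that)
    show "weight_vec M 2 (D 1)" using D(2)[of 1] by simp
    show "act M (upper t) * b = b + t \<cdot>\<^sub>m D 1" for t
    proof (rule eq_matI)
      fix i j assume "i < dim_row (b + t \<cdot>\<^sub>m D 1)" "j < dim_col (b + t \<cdot>\<^sub>m D 1)"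
      then have ij: "i < rdim M" "j < 1" by auto
      then have "(act M (upper t) * b) $$ (i, j) = (\<Sum>k\<le>1. t ^ k * D (int k) $$ (i, j))"
        by (intro mat_poly_curve_eval[OF D(1) z]) auto
      then show "(act M (upper t) * b) $$ (i, j) = (b + t \<cdot>\<^sub>m D 1) $$ (i, j)" using ij by (simp add: D(3))
    qed simp_all
  qed
qed

text \<open>Composing any functional that does not vanish at \<open>v\<close> with the weight
  projector, which fixes \<open>v\<close>, gives it weight \<open>n\<close> and leaves its value at
  \<open>v\<close> unchanged.\<close>

lemma dual_weight_vec:
  fixes M :: "('k::alg_closed_field mat, 'k) rep"
  assumes M: "algebraic_rep M" and v: "weight_vec M n v" "v \<noteq> 0\<^sub>m (rdim M) 1"
  obtains f where "weight_vec (transpose_rep M) n f" "transpose_mat f * v = 1\<^sub>m 1"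
proof -
  note d [simp] = weight_vecD(1,2)[OF v(1)] algebraic_torus_dims[OF M]
  from weight_projector_exists[OF M] obtain A where A0: "weight_projector M n A" .
  note A = weight_projectorD[OF A0]
  note A(1,2) [simp]
  have Av: "A * v = v"
    using A(5)[of "1\<^sub>m (rdim M)" v v] weight_vecD(3)[OF v(1)] by (simp add: mm)
  from v(2) obtain y x where yx [simp]: "dim_row y = 1" "dim_col y = rdim M" "dim_row x = 1" "dim_col x = 1"
    and p: "y * (v * x) = 1 \<cdot>\<^sub>m 1\<^sub>m 1" using exists_pairing[of v 1] by auto
  have "v * x = x $$ (0, 0) \<cdot>\<^sub>m v"
    by (rule eq_matI) (simp_all add: mat_mult_entry mult.commute del: index_mult_mat(1))
  then have p': "x $$ (0, 0) \<cdot>\<^sub>m (y * v) = 1\<^sub>m 1" using p by (simp add: mm)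
  define f where "f = transpose_mat (x $$ (0, 0) \<cdot>\<^sub>m (y * A))"
  have df [simp]: "dim_row f = rdim M" "dim_col f = 1" by (simp_all add: f_def)
  have "weight_vec (transpose_rep M) n f"
    unfolding weight_vec_def
  proof (intro conjI allI impI)
    fix t :: 'k assume t: "t \<noteq> 0"
    have "y * A * act M (torus t) = t powi n \<cdot>\<^sub>m (y * A)" using t A(4)[OF t] by (simp add: mm)
    then show "act (transpose_rep M) (torus t) * f = t powi n \<cdot>\<^sub>m f"
      using t by (simp add: f_def mat2_transpose transpose_mult_dims[symmetric] transpose_smult[symmetric] 
          mm_smultl mm_smult_smult mult.commute)
  qed simp_all
  moreover have "transpose_mat f * v = 1\<^sub>m 1" using p' by (simp add: f_def mm Av)
  ultimately show thesis by (rule that)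
qed

lemma weight_orthogonal:
  fixes M :: "('k::alg_closed_field mat, 'k) rep"
  assumes M: "algebraic_rep M" and f: "weight_vec (transpose_rep M) a f" and v: "weight_vec M b v" and ab: "a \<noteq> b"
  shows "transpose_mat f * v = 0\<^sub>m 1 1"
proof -
  note d [simp] = weight_vecD(1,2)[OF v] weight_vecD(1,2)[OF f, simplified] algebraic_torus_dims[OF M]
  let ?x = "transpose_mat f * v"
  have eq: "t powi a \<cdot>\<^sub>m ?x = t powi b \<cdot>\<^sub>m ?x" if t: "t \<noteq> 0" for t
  proof -
    have "transpose_mat f * act M (torus t) = t powi a \<cdot>\<^sub>m transpose_mat f"
      using arg_cong[OF weight_vecD(3)[OF f t], of transpose_mat] t
      by (simp add: mat2_transpose transpose_mult_dims transpose_smult)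
    then have "t powi a \<cdot>\<^sub>m ?x = (transpose_mat f * act M (torus t)) * v" by (simp add: mm)
    also have "\<dots> = transpose_mat f * (act M (torus t) * v)" using t by (simp add: mm)
    also have "\<dots> = t powi b \<cdot>\<^sub>m ?x" using weight_vecD(3)[OF v t] by (simp add: mm)
    finally show ?thesis .
  qed
  \<comment> \<open>As curves in \<open>t\<close> the two sides have a single coefficient each, at
    \<open>a\<close> and at \<open>b\<close>; the coefficient at \<open>a\<close> is
    compared.\<close>
  have "(if a = a then ?x else 0\<^sub>m 1 1) = (if a = b then ?x else 0\<^sub>m 1 1)"
    by (rule mat_curve_unique[OF mat_curve_powi mat_curve_powi eq]) simp_all
  then show ?thesis using ab by simp
qed

lemma mat_curve_cubic:
  assumes "dim_row A0 = r" "dim_row A1 = r" "dim_row A2 = r" "dim_row A3 = r"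
    "dim_col A0 = s" "dim_col A1 = s" "dim_col A2 = s" "dim_col A3 = s"
  shows "mat_curve r s (\<lambda>m. if m = 0 then A0 else if m = 1 then A1 else if m = 2 then A2 else if m = 3 then A3 else 0\<^sub>m r s)
    (\<lambda>t. A0 + t \<cdot>\<^sub>m A1 + t^2 \<cdot>\<^sub>m A2 + t^3 \<cdot>\<^sub>m A3)"
  unfolding mat_curve_def laurent_coeffs_def
proof (intro conjI allI impI)
  fix i j assume ij: "i < r" "j < s"
  let ?C = "\<lambda>m::int. if m = 0 then A0 else if m = 1 then A1 else if m = 2 then A2 else if m = 3 then A3 else 0\<^sub>m r s"
  show "\<exists>S. finite S \<and> (\<forall>m. m \<notin> S \<longrightarrow> ?C m $$ (i, j) = 0) \<and>
    (\<forall>t. t \<noteq> 0 \<longrightarrow> (A0 + t \<cdot>\<^sub>m A1 + t^2 \<cdot>\<^sub>m A2 + t^3 \<cdot>\<^sub>m A3) $$ (i, j) = (\<Sum>m\<in>S. ?C m $$ (i, j) * t powi m))"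
    by (rule exI[of _ "{0, 1, 2, 3}"]) (use ij assms in \<open>auto simp: mult.commute\<close>)
qed (use assms in \<open>auto intro!: carrier_matI\<close>)

text \<open>The action on \<open>v1\<close> is the coefficient of \<open>t\<close> in the orbit at \<open>s + t\<close>, where the term \<open>2 s v2\<close> vanishes.\<close>

lemma highest_weight_orbit:
  fixes M :: "('k::alg_closed_field mat, 'k) rep"
  assumes c2: "CHAR('k) = 2" and M: "algebraic_rep M" and n: "weights_le M n" and v: "weight_vec M n v" and n3: "n \<le> 3"
  obtains v1 v2 v3 where "weight_vec M (n - 2) v1" "weight_vec M (n - 4) v2" "weight_vec M (n - 6) v3"
    "\<And>t. act M (lower t) * v = v + t \<cdot>\<^sub>m v1 + t^2 \<cdot>\<^sub>m v2 + t^3 \<cdot>\<^sub>m v3"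
    "\<And>t. act M (lower t) * v1 = v1 + t^2 \<cdot>\<^sub>m v3"
    "n = 3 \<Longrightarrow> act M weyl_elt * v2 = v1" "n = 3 \<Longrightarrow> act M weyl_elt * v1 = v2" "n = 3 \<Longrightarrow> act M weyl_elt * v3 = v"
    "n = 2 \<Longrightarrow> act M weyl_elt * v1 = v1" "n = 2 \<Longrightarrow> v3 = 0\<^sub>m (rdim M) 1"
proof -
  note dv [simp] = weight_vecD(1,2)[OF v]
  \<comment> \<open>For trivial \<open>W\<close> the map \<open>C\<close> is the vector
    \<open>v\<close> itself.\<close>
  interpret H: weight_hom M trivial_rep v n
    by unfold_locales (use c2 M algebraic_trivial upper_highest_weight_vec[OF M n v] weight_vecD[OF v] in \<open>auto simp: mm\<close>)
  let ?D = H.orbit_coeff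
  have D0: "?D 0 = v" by (rule H.orbit_coeff_0)
  have dD [simp]: "dim_row (?D j) = rdim M" "dim_col (?D j) = 1" for j by simp_all
  have orb: "H.orbit t = act M (lower t) * v" for t by (simp add: H.orbit_def mm)
  have W: "act M weyl_elt * ?D (n - j) = ?D j" for j
    using H.orbit_coeff_weyl[of j] by (simp add: mm)
  have w: "weight_vec M (n - 2 * j) (?D j)" for j
    unfolding weight_vec_def using H.orbit_coeff_torus[of _ j] by (simp add: mm)
  have eval: "act M (lower t) * v = v + t \<cdot>\<^sub>m ?D 1 + t^2 \<cdot>\<^sub>m ?D 2 + t^3 \<cdot>\<^sub>m ?D 3" for t
  proof (rule eq_matI)
    fix i j assume "i < dim_row (v + t \<cdot>\<^sub>m ?D 1 + t^2 \<cdot>\<^sub>m ?D 2 + t^3 \<cdot>\<^sub>m ?D 3)"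
      "j < dim_col (v + t \<cdot>\<^sub>m ?D 1 + t^2 \<cdot>\<^sub>m ?D 2 + t^3 \<cdot>\<^sub>m ?D 3)"
    then have ij: "i < rdim M" "j < 1" by auto
    have "H.orbit t $$ (i, j) = (\<Sum>k\<le>3. t ^ k * ?D (int k) $$ (i, j))"
      by (rule mat_poly_curve_eval[of "rdim M" 1]) (use H.orbit_coeff H.orbit_coeff_high n3 ij in auto)
    then show "(act M (lower t) * v) $$ (i, j) = (v + t \<cdot>\<^sub>m ?D 1 + t^2 \<cdot>\<^sub>m ?D 2 + t^3 \<cdot>\<^sub>m ?D 3) $$ (i, j)"
      using ij D0 by (simp add: orb eval_nat_numeral)
  qed simp_all
  have low: "act M (lower s) * ?D 1 = ?D 1 + s^2 \<cdot>\<^sub>m ?D 3" for s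
  proof -
    \<comment> \<open>Coefficients in \<open>t\<close> of the orbit at \<open>s + t\<close>, by
      \<open>(s + t)^2 = s^2 + t^2\<close> and
      \<open>(s + t)^3 = s^3 + s^2 t + s t^2 + t^3\<close>.\<close>
    let ?A0 = "act M (lower s) * v" and ?A1 = "?D 1 + s^2 \<cdot>\<^sub>m ?D 3" and ?A2 = "?D 2 + s \<cdot>\<^sub>m ?D 3"
    have c: "mat_curve (rdim M) 1 (\<lambda>j. act M (lower s) * ?D j) (\<lambda>t. act M (lower s) * H.orbit t)"
      by (rule mat_curve_mult_left[of "rdim M" 1]) (use H.orbit_coeff_curve in simp_all)
    have eq: "act M (lower s) * H.orbit t = ?A0 + t \<cdot>\<^sub>m ?A1 + t^2 \<cdot>\<^sub>m ?A2 + t^3 \<cdot>\<^sub>m ?D 3" for t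
    proof -
      have "act M (lower s) * H.orbit t = act M (lower (s + t)) * v"
        unfolding orb by simp
      also have "\<dots> = ?A0 + t \<cdot>\<^sub>m ?A1 + t^2 \<cdot>\<^sub>m ?A2 + t^3 \<cdot>\<^sub>m ?D 3"
        unfolding eval by (rule eq_matI) (simp_all add: power2_eq_square power3_eq_cube algebra_simps H.c2s)
      finally show ?thesis .
    qed
    have c': "mat_curve (rdim M) 1 (\<lambda>m. if m = 0 then ?A0 else if m = 1 then ?A1 else if m = 2 then ?A2
        else if m = 3 then ?D 3 else 0\<^sub>m (rdim M) 1) (\<lambda>t. ?A0 + t \<cdot>\<^sub>m ?A1 + t^2 \<cdot>\<^sub>m ?A2 + t^3 \<cdot>\<^sub>m ?D 3)"
      by (rule mat_curve_cubic) simp_all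
    from mat_curve_unique[OF c c' eq, where m = 1] show ?thesis by simp
  qed
  show thesis
  proof (rule that[of "?D 1" "?D 2" "?D 3"])
    show "weight_vec M (n - 2) (?D 1)" "weight_vec M (n - 4) (?D 2)" "weight_vec M (n - 6) (?D 3)"
      using w[of 1] w[of 2] w[of 3] by simp_all
    show "act M weyl_elt * ?D 2 = ?D 1" "act M weyl_elt * ?D 1 = ?D 2" "act M weyl_elt * ?D 3 = v" if "n = 3"
      using W[of 1] W[of 2] W[of 0] that D0 by simp_all
    show "act M weyl_elt * ?D 1 = ?D 1" "?D 3 = 0\<^sub>m (rdim M) 1" if "n = 2"
      using W[of 1] that H.orbit_coeff_high[of 3] by simp_all
  qed (rule eval low)+
qed

lemma upper_conv_lower:
  fixes M :: "('k::field mat, 'k) rep"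
  assumes "CHAR('k) = 2" "is_rep SL2 M" "dim_row X = rdim M"
  shows "act M (upper t) * X = act M weyl_elt * (act M (lower t) * (act M weyl_elt * X))"
proof -
  note w = weyl_elt_in_SL2[OF assms(1)]
  have 1: "lower t * weyl_elt = mat2 0 1 1 t" "weyl_elt * mat2 0 1 1 t = upper t" by (simp_all add: mat2_mult)
  have 2: "mat2 0 1 1 t \<in> carrier SL2" by (simp add: mat2_in_SL2 uminus_CHAR_2[OF assms(1)] char2_two[OF assms(1)])
  show ?thesis
    using rep_mult_eq2[OF assms(2) _ w 1(1) assms(3)] rep_mult_eq2[OF assms(2) w 2 1(2) assms(3)] by simp
qed

section \<open>Recognition of the three tilting modules\<close>

lemma tilting_one_iso:
  fixes M :: "('k::alg_closed_field mat, 'k) rep"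
  assumes c2: "CHAR('k) = 2" and M: "algebraic_rep M" "rep_indecomposable SL2 M" and n: "weights_le M 1"
    and v: "weight_vec M 1 v" "v \<noteq> 0\<^sub>m (rdim M) 1"
  shows "rep_iso SL2 M (small_tilting 1)"
proof -
  from dual_weight_vec[OF M(1) v] obtain f where f: "weight_vec (transpose_rep M) 1 f" "transpose_mat f * v = 1\<^sub>m 1" .
  note d [simp] = weight_vecD(1,2)[OF v(1)] weight_vecD(1,2)[OF f(1), simplified] algebraic_torus_dims[OF M(1)]
  have fu: "transpose_mat f * act M (lower t) = transpose_mat f" for t
    using arg_cong[OF upper_highest_weight_vec[OF algebraic_rep_transpose[OF M(1)] weights_le_transpose[OF M(1) n] f(1), of t], of transpose_mat]
    by (simp add: mat2_transpose transpose_mult_dims)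
  have ft: "transpose_mat f * act M (torus t) = t \<cdot>\<^sub>m transpose_mat f" if "t \<noteq> 0" for t
    using arg_cong[OF weight_vecD(3)[OF f(1) that], of transpose_mat] that
    by (simp add: mat2_transpose transpose_mult_dims transpose_smult)
  have "rep_iso SL2 M (rep_tensor natural_rep trivial_rep)"
    by (rule indecomposable_iso_tensor[OF c2 M algebraic_trivial, of v "transpose_mat f"])
      (use f upper_highest_weight_vec[OF M(1) n v(1)] weight_vecD(3)[OF v(1)] in \<open>simp_all add: mm fu ft\<close>)
  then show ?thesis by (simp add: small_tilting_def second_factor_def)
qed

text \<open>The pair \<open>v\<close>, \<open>v2\<close> is the image of a basis of
  \<open>k\<^sub>1 \<otimes> V\<^sup>(\<^sup>1\<^sup>)\<close>: the weights are
  \<open>3 = 1 + 2\<close> and \<open>-1 = 1 - 2\<close>, and \<open>upper t\<close> acts through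
  \<open>t^2\<close>. The action on \<open>v2\<close> is that of \<open>lower t\<close> on
  \<open>v1\<close>, conjugated by \<open>weyl_elt\<close>.\<close>

lemma tilting_three_data:
  fixes M :: "('k::alg_closed_field mat, 'k) rep"
  assumes c2: "CHAR('k) = 2" and M: "algebraic_rep M" and n: "weights_le M 3" and v: "weight_vec M 3 v"
  obtains v1 v2 v3 where "weight_vec M 1 v1" "weight_vec M (- 1) v2" "weight_vec M (- 3) v3"
    "\<And>t. act M (lower t) * v = v + t \<cdot>\<^sub>m v1 + t^2 \<cdot>\<^sub>m v2 + t^3 \<cdot>\<^sub>m v3"
    "\<And>t. act M (upper t) * v2 = t^2 \<cdot>\<^sub>m v + v2"
proof -
  have "(3::int) \<le> 3" by simp
  from highest_weight_orbit[OF c2 M n v this] obtain v1 v2 v3 where o: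
    "weight_vec M (3 - 2) v1" "weight_vec M (3 - 4) v2" "weight_vec M (3 - 6) v3"
    "\<And>t. act M (lower t) * v = v + t \<cdot>\<^sub>m v1 + t^2 \<cdot>\<^sub>m v2 + t^3 \<cdot>\<^sub>m v3"
    "\<And>t. act M (lower t) * v1 = v1 + t^2 \<cdot>\<^sub>m v3"
    "act M weyl_elt * v2 = v1" "act M weyl_elt * v1 = v2" "act M weyl_elt * v3 = v"
    by metis
  note d [simp] = weight_vecD(1,2)[OF o(1)] weight_vecD(1,2)[OF o(2)] weight_vecD(1,2)[OF o(3)]
    weight_vecD(1,2)[OF v] is_rep_dims[OF algebraic_repD[OF M] weyl_elt_in_SL2[OF c2]]
  have "act M (upper t) * v2 = t^2 \<cdot>\<^sub>m v + v2" for t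
  proof -
    have "act M (upper t) * v2 = act M weyl_elt * (v1 + t^2 \<cdot>\<^sub>m v3)"
      by (simp add: upper_conv_lower[OF c2 algebraic_repD[OF M]] o)
    also have "\<dots> = v2 + t^2 \<cdot>\<^sub>m v" by (simp add: mm o)
    also have "\<dots> = t^2 \<cdot>\<^sub>m v + v2" by (rule eq_matI) (simp_all add: add.commute)
    finally show ?thesis .
  qed
  then show thesis using that o by simp
qed

lemma tilting_three_iso:
  fixes M :: "('k::alg_closed_field mat, 'k) rep"
  assumes c2: "CHAR('k) = 2" and M: "algebraic_rep M" "rep_indecomposable SL2 M" and n: "weights_le M 3"
    and v: "weight_vec M 3 v" "v \<noteq> 0\<^sub>m (rdim M) 1"
  shows "rep_iso SL2 M (small_tilting 3)"
proof -
  let ?M = "transpose_rep M"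
  note M' = algebraic_rep_transpose[OF M(1)] and n' = weights_le_transpose[OF M(1) n]
  from dual_weight_vec[OF M(1) v] obtain f where f: "weight_vec ?M 3 f" "transpose_mat f * v = 1\<^sub>m 1" .
  from tilting_three_data[OF c2 M(1) n v(1)] obtain v1 v2 v3 where V: "weight_vec M 1 v1" "weight_vec M (- 1) v2" "weight_vec M (- 3) v3"
    "\<And>t. act M (lower t) * v = v + t \<cdot>\<^sub>m v1 + t^2 \<cdot>\<^sub>m v2 + t^3 \<cdot>\<^sub>m v3"
    "\<And>t. act M (upper t) * v2 = t^2 \<cdot>\<^sub>m v + v2" by metis
  from tilting_three_data[OF c2 M' n' f(1)] obtain f2 where F: "weight_vec ?M (- 1) f2"
    "\<And>t. act ?M (upper t) * f2 = t^2 \<cdot>\<^sub>m f + f2" by metis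
  note d [simp] = weight_vecD(1,2)[OF V(1)] weight_vecD(1,2)[OF V(2)] weight_vecD(1,2)[OF V(3)] weight_vecD(1,2)[OF v(1)]
    weight_vecD(1,2)[OF f(1), simplified] weight_vecD(1,2)[OF F(1), simplified] algebraic_torus_dims[OF M(1)]
  let ?f = "transpose_mat f" and ?f2 = "transpose_mat f2"
  have fl: "?f * act M (lower t) = ?f" "?f2 * act M (lower t) = t^2 \<cdot>\<^sub>m ?f + ?f2" for t
    using arg_cong[OF upper_highest_weight_vec[OF M' n' f(1), of t], of transpose_mat]
      arg_cong[OF F(2)[of t], of transpose_mat]
    by (simp_all add: mat2_transpose transpose_mult_dims transpose_add[of _ "rdim M" 1] transpose_smult carrier_matI)
  have ft: "?f * act M (torus t) = t powi 3 \<cdot>\<^sub>m ?f" "?f2 * act M (torus t) = t powi (- 1) \<cdot>\<^sub>m ?f2" if "t \<noteq> 0" for t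
    using arg_cong[OF weight_vecD(3)[OF f(1) that], of transpose_mat] arg_cong[OF weight_vecD(3)[OF F(1) that], of transpose_mat] that
    by (simp_all add: mat2_transpose transpose_mult_dims transpose_smult)
  have z: "?f * v2 = 0\<^sub>m 1 1" "?f2 * v = 0\<^sub>m 1 1" "?f2 * v1 = 0\<^sub>m 1 1" "?f2 * v3 = 0\<^sub>m 1 1"
    by (rule weight_orthogonal[OF M(1)], rule f F, rule V v, simp)+
  \<comment> \<open>Evaluated in two ways: the left side is \<open>(f + f2) v = 1\<close>, and on
    the right only \<open>f2 v2\<close> survives, as vectors and functionals of distinct weights are
    orthogonal.\<close>
  have "(?f2 * act M (lower 1)) * v = ?f2 * (act M (lower 1) * v)" by (simp add: mm)
  then have f2v2: "?f2 * v2 = 1\<^sub>m 1" unfolding fl V(4) by (simp add: mm z f(2))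
  have p: "t powi 3 = t * (t * t)" "t powi (- 1) = inverse t" for t :: 'k
    by (simp_all add: power_int_minus power3_eq_cube)
  have RC: "vcat ?f ?f2 * hcat v v2 = 1\<^sub>m 2"
  proof -
    have "vcat ?f ?f2 * hcat v v2 = four_block_mat (1\<^sub>m 1) (0\<^sub>m 1 1) (0\<^sub>m 1 1) (1\<^sub>m 1)"
      by (simp add: vcat_mult_hcat z f2v2 f(2) del: four_block_one_mat)
    then show ?thesis by (simp add: numeral_2_eq_2)
  qed
  have "rep_iso SL2 M (rep_tensor natural_rep frobenius_rep)"
  proof (rule indecomposable_iso_tensor[OF c2 M algebraic_frobenius[OF c2], of "hcat v v2" "vcat ?f ?f2"])
    show "act M (upper t) * hcat v v2 = hcat v v2 * act frobenius_rep (upper t)" for t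
      by (simp add: mult_hcat hcat_mat2 mm V upper_highest_weight_vec[OF M(1) n v(1)] power2_eq_square)
    show "act M (torus t) * hcat v v2 = t \<cdot>\<^sub>m (hcat v v2 * act frobenius_rep (torus t))" if "t \<noteq> 0" for t
      using that by (simp add: mult_hcat hcat_mat2 hcat_smult mm weight_vecD(3)[OF V(2)] weight_vecD(3)[OF v(1)] p power3_eq_cube mult.assoc[symmetric])
    show "vcat ?f ?f2 * act M (lower t) = act frobenius_rep (lower t) * vcat ?f ?f2" for t
      by (simp add: vcat_mult mat2_vcat mm fl power2_eq_square)
    show "vcat ?f ?f2 * act M (torus t) = t \<cdot>\<^sub>m (act frobenius_rep (torus t) * vcat ?f ?f2)" if "t \<noteq> 0" for t
      using that by (simp add: vcat_mult mat2_vcat vcat_smult mm ft p power3_eq_cube mult.assoc[symmetric])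
  qed (simp_all add: RC frobenius_transpose)
  then show ?thesis by (simp add: small_tilting_def second_factor_def)
qed

text \<open>The raising operator maps the weight-0 space onto the weight-2 space.\<close>

definition raises :: "('k::field mat, 'k) rep \<Rightarrow> bool" where
  "raises M \<longleftrightarrow> (\<forall>v. weight_vec M 2 v \<longrightarrow>
     (\<exists>b. weight_vec M 0 b \<and> (\<forall>t. act M (upper t) * b = b + t \<cdot>\<^sub>m v)))"

lemma raisesE:
  assumes "raises M" "weight_vec M 2 v"
  obtains b where "weight_vec M 0 b" "\<And>t. act M (upper t) * b = b + t \<cdot>\<^sub>m v"
  using assms by (auto simp: raises_def)

lemma weight_vec_add:
  assumes "algebraic_rep M" "weight_vec M m v" "weight_vec M m w"
  shows "weight_vec M m (v + c \<cdot>\<^sub>m w)"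
  using weight_vecD[OF assms(2)] weight_vecD[OF assms(3)] algebraic_torus_dims[OF assms(1)]
  by (auto simp: weight_vec_def mm mult.commute)

text \<open>For \<open>W = V\<close> a vector \<open>b\<close> of weight \<open>0 = 1 - 1\<close>
  with \<open>upper t\<close> sending \<open>b\<close> to \<open>b + t v\<close> is required. The
  orbit of \<open>v\<close> offers only \<open>v1 = f v\<close>, which \<open>upper t\<close> fixes
  since \<open>e f v = 2 v = 0\<close>. Hence the assumptions \<open>raises\<close>, on
  \<open>M\<close> and on its transpose.\<close>

lemma tilting_two_iso:
  fixes M :: "('k::alg_closed_field mat, 'k) rep"
  assumes c2: "CHAR('k) = 2" and M: "algebraic_rep M" "rep_indecomposable SL2 M" and n: "weights_le M 2"
    and v: "weight_vec M 2 v" "v \<noteq> 0\<^sub>m (rdim M) 1"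
    and E: "raises M" "raises (transpose_rep M)"
  shows "rep_iso SL2 M (small_tilting 2)"
proof -
  let ?M = "transpose_rep M"
  note M' = algebraic_rep_transpose[OF M(1)] and n' = weights_le_transpose[OF M(1) n]
  note c2s = char2_two[OF c2] char2_add_self[OF c2] char2_add_left_self[OF c2]
  from dual_weight_vec[OF M(1) v] obtain f where f: "weight_vec ?M 2 f" "transpose_mat f * v = 1\<^sub>m 1" .
  from raisesE[OF E(1) v(1)] obtain b0 where b0: "weight_vec M 0 b0" "\<And>t. act M (upper t) * b0 = b0 + t \<cdot>\<^sub>m v" by blast
  from raisesE[OF E(2) f(1)] obtain g where g: "weight_vec ?M 0 g" "\<And>t. act ?M (upper t) * g = g + t \<cdot>\<^sub>m f" by blast
  have "(2::int) \<le> 3" by simp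
  from highest_weight_orbit[OF c2 M(1) n v(1) this] obtain v1 v2 v3 where o:
    "weight_vec M (2 - 2) v1" "weight_vec M (2 - 4) v2" "weight_vec M (2 - 6) v3"
    "\<And>t. act M (lower t) * v = v + t \<cdot>\<^sub>m v1 + t^2 \<cdot>\<^sub>m v2 + t^3 \<cdot>\<^sub>m v3"
    "\<And>t. act M (lower t) * v1 = v1 + t^2 \<cdot>\<^sub>m v3" "act M weyl_elt * v1 = v1" "v3 = 0\<^sub>m (rdim M) 1"
    by metis
  have v1: "weight_vec M 0 v1" and v2: "weight_vec M (- 2) v2" using o by simp_all
  note d [simp] = weight_vecD(1,2)[OF v1] weight_vecD(1,2)[OF v2] weight_vecD(1,2)[OF b0(1)] weight_vecD(1,2)[OF v(1)]
    weight_vecD(1,2)[OF f(1), simplified] weight_vecD(1,2)[OF g(1), simplified] algebraic_torus_dims[OF M(1)]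
    is_rep_dims[OF algebraic_repD[OF M(1)] weyl_elt_in_SL2[OF c2]]
  have uv1: "act M (upper t) * v1 = v1" for t
    by (simp add: upper_conv_lower[OF c2 algebraic_repD[OF M(1)]] o mm)
  let ?f = "transpose_mat f" and ?g = "transpose_mat g"
  have fl: "?f * act M (lower t) = ?f" "?g * act M (lower t) = ?g + t \<cdot>\<^sub>m ?f" for t
    using arg_cong[OF upper_highest_weight_vec[OF M' n' f(1), of t], of transpose_mat]
      arg_cong[OF g(2)[of t], of transpose_mat]
    by (simp_all add: mat2_transpose transpose_mult_dims transpose_add[of _ "rdim M" 1] transpose_smult carrier_matI)
  have ft: "?f * act M (torus t) = t powi 2 \<cdot>\<^sub>m ?f" "?g * act M (torus t) = ?g" if "t \<noteq> 0" for t
    using arg_cong[OF weight_vecD(3)[OF f(1) that], of transpose_mat] arg_cong[OF weight_vecD(3)[OF g(1) that], of transpose_mat] that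
    by (simp_all add: mat2_transpose transpose_mult_dims transpose_smult mm)
  have z: "?f * b0 = 0\<^sub>m 1 1" "?f * v1 = 0\<^sub>m 1 1" "?g * v = 0\<^sub>m 1 1" "?g * v2 = 0\<^sub>m 1 1"
    using weight_orthogonal[OF M(1) f(1) b0(1)] weight_orthogonal[OF M(1) f(1) v1]
      weight_orthogonal[OF M(1) g(1) v(1)] weight_orthogonal[OF M(1) g(1) v2] by simp_all
  \<comment> \<open>Evaluated in two ways: the left side is \<open>(g + f) v = 1\<close>, and on the
    right only the weight-0 part \<open>v1\<close> pairs nontrivially with \<open>g\<close>.\<close>
  have "(?g * act M (lower 1)) * v = ?g * (act M (lower 1) * v)" by (simp add: mm)
  then have gv1: "?g * v1 = 1\<^sub>m 1" unfolding fl o(4) by (simp add: mm z f(2) o(7))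
  \<comment> \<open>As \<open>v1\<close> is invariant and pairs to 1 with \<open>g\<close>, a multiple of it corrects the pairing of \<open>b0\<close>.\<close>
  define b where "b = b0 + (1 + (?g * b0) $$ (0, 0)) \<cdot>\<^sub>m v1"
  have b: "weight_vec M 0 b" unfolding b_def by (rule weight_vec_add[OF M(1) b0(1) v1])
  note db [simp] = weight_vecD(1,2)[OF b]
  have ub: "act M (upper t) * b = t \<cdot>\<^sub>m v + b" for t
    unfolding b_def by (simp add: mm b0 uv1) (rule eq_matI; simp del: index_mult_mat(1))
  have fb: "?f * b = 0\<^sub>m 1 1" by (simp add: b_def mm z)
  have gb: "?g * b = 1\<^sub>m 1"
    by (rule eq_matI) (simp_all add: b_def mm gv1 c2s del: index_mult_mat(1))
  have RC: "vcat ?f ?g * hcat v b = 1\<^sub>m 2"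
  proof -
    have "vcat ?f ?g * hcat v b = four_block_mat (1\<^sub>m 1) (0\<^sub>m 1 1) (0\<^sub>m 1 1) (1\<^sub>m 1)"
      by (simp add: vcat_mult_hcat z fb gb f(2) del: four_block_one_mat)
    then show ?thesis by (simp add: numeral_2_eq_2)
  qed
  have "rep_iso SL2 M (rep_tensor natural_rep natural_rep)"
  proof (rule indecomposable_iso_tensor[OF c2 M algebraic_natural, of "hcat v b" "vcat ?f ?g"])
    show "act M (upper t) * hcat v b = hcat v b * act natural_rep (upper t)" for t
      by (simp add: mult_hcat hcat_mat2 mm ub upper_highest_weight_vec[OF M(1) n v(1)])
    show "act M (torus t) * hcat v b = t \<cdot>\<^sub>m (hcat v b * act natural_rep (torus t))" if "t \<noteq> 0" for t
      using that by (simp add: mult_hcat hcat_mat2 hcat_smult mm weight_vecD(3)[OF b] weight_vecD(3)[OF v(1)] power2_eq_square)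
    show "vcat ?f ?g * act M (lower t) = act natural_rep (lower t) * vcat ?f ?g" for t
      by (simp add: vcat_mult mat2_vcat mm fl) (rule arg_cong[of _ _ "vcat ?f"], rule eq_matI; simp add: add.commute)
    show "vcat ?f ?g * act M (torus t) = t \<cdot>\<^sub>m (act natural_rep (torus t) * vcat ?f ?g)" if "t \<noteq> 0" for t
      using that by (simp add: vcat_mult mat2_vcat vcat_smult mm ft power2_eq_square)
  qed (simp_all add: RC)
  then show ?thesis by (simp add: small_tilting_def second_factor_def)
qed

subsection \<open>Filtrations\<close>

lemma mat_eq_columnsI:
  assumes "dim_row A = dim_row B" "dim_col A = dim_col B" "\<And>j. j < dim_col B \<Longrightarrow> col A j = col B j"
  shows "A = B"
proof (rule eq_matI)
  fix i j assume ij: "i < dim_row B" "j < dim_col B"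
  have "A $$ (i, j) = col A j $ i" "B $$ (i, j) = col B j $ i" 
    using ij(1) ij(2) unfolding assms(1)[symmetric] assms(2)[symmetric] by (simp_all add: assms(1,2))
  then show "A $$ (i, j) = B $$ (i, j)" using assms(3)[OF ij(2)] by simp
qed (rule assms)+

lemma col_mult_dims: "dim_col A = dim_row B \<Longrightarrow> j < dim_col B \<Longrightarrow> col (A * B) j = A *\<^sub>v col B j"
  by (rule eq_vecI) auto

lemma mult_mat_vec_assoc:
  "dim_col A = dim_row B \<Longrightarrow> dim_vec v = dim_col B \<Longrightarrow> A * B *\<^sub>v v = A *\<^sub>v (B *\<^sub>v (v :: 'k::field vec))"
  by (rule assoc_mult_mat_vec[of A "dim_row A" "dim_col A" B "dim_col B"]) (auto intro!: carrier_vecI)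

lemma regular_mat:
  obtains G where "dim_row G = dim_col A" "dim_col G = dim_row A" "A * (G * A) = (A :: 'k::field mat)"
proof -
  have "A \<in> carrier_mat (dim_row A) (dim_col A)" by (rule carrier_matI) simp_all
  from full_rank_factorization[OF this] obtain r X Y L R where F:
    "X \<in> carrier_mat (dim_row A) r" "Y \<in> carrier_mat r (dim_col A)" "L \<in> carrier_mat r (dim_row A)"
    "R \<in> carrier_mat (dim_col A) r" "A = X * Y" "L * X = 1\<^sub>m r" "Y * R = 1\<^sub>m r" .
  note d [simp] = carrier_matD[OF F(1)] carrier_matD[OF F(2)] carrier_matD[OF F(3)] carrier_matD[OF F(4)]
  have "(X * Y) * ((R * L) * (X * Y)) = X * ((Y * R) * ((L * X) * Y))" by (simp add: mm)
  also have "\<dots> = X * Y" unfolding F(6,7) by (simp add: mm)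
  finally show thesis by (intro that[of "R * L"]) (simp_all add: F(5)[symmetric])
qed

text \<open>Translates exactness, stated through sets of vectors, into matrix identities.
  \<open>A'\<close> and \<open>B'\<close> split the sequence only linearly and need not be
  equivariant.\<close>

lemma rep_extension_split:
  assumes "rep_extension G L M N"
  obtains A B A' B' where "A \<in> rep_hom G L M" "B \<in> rep_hom G M N"
    "dim_row A' = rdim L" "dim_col A' = rdim M" "dim_row B' = rdim M" "dim_col B' = rdim N"
    "A' * A = 1\<^sub>m (rdim L)" "B * B' = 1\<^sub>m (rdim N)" "B * A = 0\<^sub>m (rdim N) (rdim L)"
    "A * A' + B' * B = 1\<^sub>m (rdim M)"
proof -
  from assms obtain A B where A: "A \<in> rep_hom G L M" and B: "B \<in> rep_hom G M N"
    and inj: "inj_on (\<lambda>v. A *\<^sub>v v) (carrier_vec (rdim L))"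
    and ex: "(\<lambda>v. A *\<^sub>v v) ` carrier_vec (rdim L) = mat_kernel B"
    and surj: "(\<lambda>v. B *\<^sub>v v) ` carrier_vec (rdim M) = carrier_vec (rdim N)"
    by (auto simp: rep_extension_def)
  note d [simp] = rep_homD(1,2)[OF A] rep_homD(1,2)[OF B]
  have Bc: "B \<in> carrier_mat (rdim N) (rdim M)" by (intro carrier_matI) simp_all
  obtain A' where A' [simp]: "dim_row A' = rdim L" "dim_col A' = rdim M" and AA: "A * (A' * A) = A"
    using regular_mat[of A] by auto
  obtain H where H [simp]: "dim_row H = rdim M" "dim_col H = rdim N" and BH: "B * (H * B) = B"
    using regular_mat[of B] by auto
  have A'A: "A' * A = 1\<^sub>m (rdim L)"
  proof (rule mat_eq_columnsI)
    fix j assume "j < dim_col (1\<^sub>m (rdim L) :: 'b mat)"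
    then have j: "j < rdim L" by simp
    have "A *\<^sub>v col (A' * A) j = A *\<^sub>v col (1\<^sub>m (rdim L)) j"
      using j by (subst (1 2) col_mult_dims[symmetric]) (simp_all add: AA mm)
    then show "col (A' * A) j = col (1\<^sub>m (rdim L)) j"
      by (rule inj_onD[OF inj]) (use j in \<open>auto intro!: carrier_vecI\<close>)
  qed simp_all
  have BH1: "B * H = 1\<^sub>m (rdim N)"
  proof (rule mat_eq_columnsI)
    fix j assume "j < dim_col (1\<^sub>m (rdim N) :: 'b mat)"
    then have j: "j < rdim N" by simp
    have "col (1\<^sub>m (rdim N)) j \<in> carrier_vec (rdim N)" using j by (auto intro!: carrier_vecI)
    then obtain y where y: "y \<in> carrier_vec (rdim M)" "col (1\<^sub>m (rdim N)) j = B *\<^sub>v y" using surj by (metis imageE)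
    have "col (B * H) j = (B * H) *\<^sub>v col (1\<^sub>m (rdim N)) j"
      using j by (subst col_mult_dims[symmetric]) (simp_all add: mm)
    also have "\<dots> = (B * (H * B)) *\<^sub>v y" unfolding y(2) using y(1) 
      by (subst mult_mat_vec_assoc[symmetric]) (simp_all add: mm carrier_vecD)
    finally show "col (B * H) j = col (1\<^sub>m (rdim N)) j" unfolding BH y(2) .
  qed simp_all
  have BA: "B * A = 0\<^sub>m (rdim N) (rdim L)"
  proof (rule mat_eq_columnsI)
    fix j assume "j < dim_col (0\<^sub>m (rdim N) (rdim L) :: 'b mat)"
    then have j: "j < rdim L" by simp
    have "A *\<^sub>v col (1\<^sub>m (rdim L)) j \<in> mat_kernel B" unfolding ex[symmetric] using j by (auto intro!: carrier_vecI)
    then have "B *\<^sub>v (A *\<^sub>v col (1\<^sub>m (rdim L)) j) = 0\<^sub>v (rdim N)" by (rule mat_kernelD(2)[OF Bc])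
    moreover have "col (B * A) j = B *\<^sub>v (A *\<^sub>v col (1\<^sub>m (rdim L)) j)"
    proof -
      have "A *\<^sub>v col (1\<^sub>m (rdim L)) j = col A j"
        using j by (subst col_mult_dims[symmetric]) (simp_all add: mm)
      then show ?thesis using j by (simp add: col_mult_dims)
    qed
    ultimately show "col (B * A) j = col (0\<^sub>m (rdim N) (rdim L)) j" using j by (auto intro!: eq_vecI)
  qed simp_all
  have r: "B * (A * X) = 0\<^sub>m (rdim N) (dim_col X)" if "dim_row X = rdim L" for X
    using mat_assoc_rule[OF BA] that by (simp add: mm)
  have r': "A' * (A * X) = X" if "dim_row X = rdim L" for X
    using mat_assoc_rule[OF A'A] that by (simp add: mm)
  have r'': "B * (H * X) = X" if "dim_row X = rdim N" for X
    using mat_assoc_rule[OF BH1] that by (simp add: mm)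
  \<comment> \<open>Removing the component along the image of \<open>A\<close> gives
    \<open>A' * B' = 0\<close>, so that the two splittings are complementary.\<close>
  define B' where "B' = H - A * (A' * H)"
  have B' [simp]: "dim_row B' = rdim M" "dim_col B' = rdim N" by (simp_all add: B'_def)
  have BB': "B * B' = 1\<^sub>m (rdim N)"
    by (simp add: B'_def mm r BH1) (rule eq_matI; simp)
  have A'B': "A' * B' = 0\<^sub>m (rdim L) (rdim N)"
    by (simp add: B'_def mm r') (rule eq_matI; simp del: index_mult_mat(1))
  \<comment> \<open>Since \<open>B\<close> annihilates this defect, its columns lie in the image of
    \<open>A\<close>, where \<open>A'\<close> is injective; and \<open>A'\<close> annihilates it
    too.\<close>
  define Z where "Z = 1\<^sub>m (rdim M) - A * A' - B' * B"
  have Z [simp]: "dim_row Z = rdim M" "dim_col Z = rdim M" by (simp_all add: Z_def)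
  have r3: "B * (B' * B) = B" "A' * (B' * B) = 0\<^sub>m (rdim L) (rdim M)"
    using mat_assoc_rule[OF BB', of B] mat_assoc_rule[OF A'B', of B] by (simp_all add: mm)
  have BZ: "B * Z = 0\<^sub>m (rdim N) (rdim M)"
    by (simp add: Z_def mm r r3) (rule eq_matI; simp)
  have A'Z: "A' * Z = 0\<^sub>m (rdim L) (rdim M)"
    by (simp add: Z_def mm r' r3) (rule eq_matI; simp)
  have Z0: "Z = 0\<^sub>m (rdim M) (rdim M)"
  proof (rule mat_eq_columnsI)
    fix j assume "j < dim_col (0\<^sub>m (rdim M) (rdim M) :: 'b mat)"
    then have j: "j < rdim M" by simp
    have "B *\<^sub>v col Z j = col (B * Z) j" by (rule col_mult_dims[symmetric]) (use j in simp_all)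
    also have "\<dots> = 0\<^sub>v (rdim N)" unfolding BZ using j by (intro eq_vecI) simp_all
    finally have "B *\<^sub>v col Z j = 0\<^sub>v (rdim N)" .
    then have "col Z j \<in> mat_kernel B" using j by (intro mat_kernelI[OF Bc]) (auto intro!: carrier_vecI)
    then obtain y where y: "y \<in> carrier_vec (rdim L)" "col Z j = A *\<^sub>v y" using ex by (metis imageE)
    have "A' *\<^sub>v col Z j = col (A' * Z) j" by (rule col_mult_dims[symmetric]) (use j in simp_all)
    also have "\<dots> = 0\<^sub>v (rdim L)" unfolding A'Z using j by (intro eq_vecI) simp_all
    finally have "A' *\<^sub>v col Z j = 0\<^sub>v (rdim L)" .
    moreover have "A' *\<^sub>v col Z j = y" unfolding y(2) using y(1)
      by (subst mult_mat_vec_assoc[symmetric]) (simp_all add: A'A carrier_vecD)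
    ultimately have "col Z j = A *\<^sub>v 0\<^sub>v (rdim L)" using y by simp
    also have "\<dots> = col (0\<^sub>m (rdim M) (rdim M)) j" using j by (intro eq_vecI) (simp_all add: scalar_prod_def)
    finally show "col Z j = col (0\<^sub>m (rdim M) (rdim M)) j" .
  qed simp_all
  have "A * A' + B' * B = 1\<^sub>m (rdim M)"
  proof (rule eq_matI)
    fix i j assume "i < dim_row (1\<^sub>m (rdim M) :: 'b mat)" "j < dim_col (1\<^sub>m (rdim M) :: 'b mat)"
    then show "(A * A' + B' * B) $$ (i, j) = 1\<^sub>m (rdim M) $$ (i, j)"
      using arg_cong[OF Z0, of "\<lambda>A. A $$ (i, j)"] unfolding Z_def
      by (simp add: algebra_simps del: index_mult_mat(1) index_one_mat(1))
  qed simp_all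
  then show thesis by (intro that[OF A B A'(1,2) B' A'A BB' BA])
qed

lemma weight_vec_image:
  assumes "A \<in> rep_hom SL2 L M" "algebraic_rep L" "algebraic_rep M" "weight_vec L m v"
  shows "weight_vec M m (A * v)"
  unfolding weight_vec_def
proof (intro conjI allI impI)
  note d = rep_homD(1,2)[OF assms(1)] weight_vecD(1,2)[OF assms(4)] algebraic_torus_dims[OF assms(2)]
    algebraic_torus_dims[OF assms(3)]
  fix t :: 'a assume t: "t \<noteq> 0"
  have "act M (torus t) * (A * v) = (act M (torus t) * A) * v" using d t by (simp add: mm)
  also have "act M (torus t) * A = A * act L (torus t)" using rep_homD(3)[OF assms(1)] t by simp
  also have "A * act L (torus t) * v = A * (act L (torus t) * v)" using d t by (simp add: mm)
  also have "\<dots> = t powi m \<cdot>\<^sub>m (A * v)" using weight_vecD(3)[OF assms(4) t] d by (simp add: mm)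
  finally show "act M (torus t) * (A * v) = t powi m \<cdot>\<^sub>m (A * v)" .
qed (use rep_homD(1,2)[OF assms(1)] weight_vecD(1,2)[OF assms(4)] in simp_all)

locale algebraic_extension =
  fixes L M N :: "('k::alg_closed_field mat, 'k) rep" and A B A' B' :: "'k mat"
  assumes char2: "CHAR('k) = 2"
    and repL: "is_rep SL2 L" and M: "algebraic_rep M" and repN: "is_rep SL2 N"
    and A: "A \<in> rep_hom SL2 L M" and B: "B \<in> rep_hom SL2 M N"
    and dA': "dim_row A' = rdim L" "dim_col A' = rdim M" and dB': "dim_row B' = rdim M" "dim_col B' = rdim N"
    and A'A: "A' * A = 1\<^sub>m (rdim L)" and BB': "B * B' = 1\<^sub>m (rdim N)" and BA: "B * A = 0\<^sub>m (rdim N) (rdim L)"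
    and sum: "A * A' + B' * B = 1\<^sub>m (rdim M)"
    and weights: "weights_le M 2"
begin

lemmas dims [simp] = rep_homD(1,2)[OF A] rep_homD(1,2)[OF B] dA' dB' algebraic_torus_dims[OF M]

lemmas c2s = char2_two[OF char2] char2_add_self[OF char2] char2_add_left_self[OF char2]

lemma act_sub: "g \<in> carrier SL2 \<Longrightarrow> act L g = A' * (act M g * A)"
  using rep_homD(3)[OF A, of g] mat_assoc_rule[OF A'A, of "act L g"] is_rep_dims[OF repL, of g] by (simp add: mm)

lemma act_quot: "g \<in> carrier SL2 \<Longrightarrow> act N g = B * (act M g * B')"
  using rep_homD(3)[OF B, of g] is_rep_dims[OF repN, of g] is_rep_dims[OF algebraic_repD[OF M], of g]
    mm_assoc[of B "act M g" B'] by (simp add: mm BB')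

text \<open>With constant \<open>X\<close> and \<open>Y\<close> the entries of the new action are
  fixed linear combinations of the old ones. Submodules and quotients are both of this form.\<close>

lemma algebraic_compress:
  assumes "is_rep SL2 K" "dim_row X = rdim K" "dim_col X = rdim M" "dim_row Y = rdim M" "dim_col Y = rdim K"
    and K: "\<And>g. g \<in> carrier SL2 \<Longrightarrow> act K g = X * (act M g * Y)"
  shows "algebraic_rep K"
  unfolding algebraic_rep_def
proof (intro conjI allI impI assms(1))
  note [simp] = assms(2-5)
  have const: "\<exists>p. \<forall>t. Z $$ (i, j) = poly p (t :: 'k)" for Z i j by (intro exI[of _ "[:Z $$ (i, j):]"]) simp
  fix i j assume ij: "i < rdim K" "j < rdim K"
  have "\<exists>p. \<forall>t. (X * (act M (upper t) * Y)) $$ (i, j) = poly p (t :: 'k)"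
    by (rule polynomial_mat_mult[where r = "rdim K" and k = "rdim M" and s = "rdim K"],
        simp_all add: const ij del: index_mult_mat(1),
        rule polynomial_mat_mult[where r = "rdim M" and k = "rdim M" and s = "rdim K"],
        simp_all add: const algebraic_rep_entries[OF M])
  then show "\<exists>p. \<forall>t. act K (upper t) $$ (i, j) = poly p t" by (simp add: K)
  have "\<exists>p. \<forall>t. (X * (act M (lower t) * Y)) $$ (i, j) = poly p (t :: 'k)"
    by (rule polynomial_mat_mult[where r = "rdim K" and k = "rdim M" and s = "rdim K"],
        simp_all add: const ij del: index_mult_mat(1),
        rule polynomial_mat_mult[where r = "rdim M" and k = "rdim M" and s = "rdim K"],
        simp_all add: const algebraic_rep_entries[OF M])
  then show "\<exists>p. \<forall>t. act K (lower t) $$ (i, j) = poly p t" by (simp add: K)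
  have "\<forall>i<rdim M. \<forall>j<rdim M. \<exists>N p. \<forall>t. t \<noteq> 0 \<longrightarrow> act M (torus t) $$ (i, j) * t ^ N = poly p t"
    using algebraic_rep_entries(3)[OF M] by blast
  then obtain n p where np: "\<And>i j t. i < rdim M \<Longrightarrow> j < rdim M \<Longrightarrow> t \<noteq> 0 \<Longrightarrow>
    act M (torus t) $$ (i, j) * t ^ n i j = poly (p i j) t" by metis
  \<comment> \<open>A common exponent that clears all denominators; the sum of the separate
    exponents is a crude bound.\<close>
  define m where "m = (\<Sum>i<rdim M. \<Sum>j<rdim M. n i j)"
  have le: "n i j \<le> m" if "i < rdim M" "j < rdim M" for i j
  proof -
    have "n i j \<le> (\<Sum>j<rdim M. n i j)" by (rule member_le_sum) (use that in auto)
    also have "\<dots> \<le> m" unfolding m_def by (rule member_le_sum) (use that in auto)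
    finally show ?thesis .
  qed
  define P where "P t = mat (rdim M) (rdim M) (\<lambda>(i, j). poly (p i j * monom 1 (m - n i j)) t)" for t
  have dP [simp]: "dim_row (P t) = rdim M" "dim_col (P t) = rdim M" for t by (simp_all add: P_def)
  have Pp: "\<exists>q. \<forall>t. P t $$ (i, j) = poly q t" if "i < rdim M" "j < rdim M" for i j
    using that by (intro exI[of _ "p i j * monom 1 (m - n i j)"]) (simp add: P_def)
  have P: "t ^ m \<cdot>\<^sub>m act M (torus t) = P t" if t: "t \<noteq> 0" for t
  proof (rule eq_matI)
    fix i j assume "i < dim_row (P t)" "j < dim_col (P t)"
    then have ij: "i < rdim M" "j < rdim M" by auto
    have "t ^ m = t ^ n i j * t ^ (m - n i j)" using le[OF ij] by (simp flip: power_add)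
    then show "(t ^ m \<cdot>\<^sub>m act M (torus t)) $$ (i, j) = P t $$ (i, j)"
      using np[OF ij t] ij t by (simp add: P_def poly_monom mult_ac)
  qed (use t in simp_all)
  have "\<exists>p. \<forall>t. (X * (P t * Y)) $$ (i, j) = poly p (t :: 'k)"
    by (rule polynomial_mat_mult[where r = "rdim K" and k = "rdim M" and s = "rdim K"],
        simp_all add: const ij del: index_mult_mat(1),
        rule polynomial_mat_mult[where r = "rdim M" and k = "rdim M" and s = "rdim K"],
        simp_all add: const Pp)
  then obtain q where q: "\<And>t. (X * (P t * Y)) $$ (i, j) = poly q t" by blast
  have "act K (torus t) $$ (i, j) * t ^ m = poly q t" if t: "t \<noteq> 0" for t
  proof -
    have "X * (P t * Y) = t ^ m \<cdot>\<^sub>m act K (torus t)"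
      unfolding P[OF t, symmetric] using t by (simp add: K mm)
    then show ?thesis using q[of t] ij t by (simp add: K mult.commute del: index_mult_mat(1))
  qed
  then show "\<exists>N p. \<forall>t. t \<noteq> 0 \<longrightarrow> act K (torus t) $$ (i, j) * t ^ N = poly p t" by blast
qed

lemma algebraic_sub: "algebraic_rep L"
  by (rule algebraic_compress[OF repL, of A' A]) (simp_all add: act_sub)

lemma algebraic_quot: "algebraic_rep N"
  by (rule algebraic_compress[OF repN, of B B']) (simp_all add: act_quot)

lemma weights_sub: "weights_le L 2"
  unfolding weights_le_def
proof (intro allI impI)
  fix m v assume m: "m > 2" and v: "weight_vec L m v"
  note [simp] = weight_vecD(1,2)[OF v]
  have "A * v = 0\<^sub>m (rdim M) 1" by (rule weights_leD[OF weights weight_vec_image[OF A algebraic_sub M v] m])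
  then have "A' * (A * v) = 0\<^sub>m (rdim L) 1" by (simp add: mm)
  then show "v = 0\<^sub>m (rdim L) 1" using mat_assoc_rule[OF A'A, of v] by (simp add: mm)
qed

text \<open>The linear preimage \<open>B' * z\<close> need not be a weight vector. The weight
  projector of \<open>M\<close> moves it into the weight space and does not change its image in
  \<open>N\<close>.\<close>

lemma weight_vec_lift:
  assumes z: "weight_vec N m z"
  obtains y where "weight_vec M m y" "B * y = z"
proof -
  note [simp] = weight_vecD(1,2)[OF z]
  from weight_projector_exists[OF M] obtain P where "weight_projector M m P" .
  note P = weight_projectorD[OF this]
  note P(1,2) [simp]
  have "B * (P * (B' * z)) = z"
  proof (rule P(5))
    fix t :: 'k assume t: "t \<noteq> 0"
    have "B * (act M (torus t) * (B' * z)) = (B * (act M (torus t) * B')) * z" using t by (simp add: mm)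
    also have "\<dots> = t powi m \<cdot>\<^sub>m z" using act_quot[of "torus t"] weight_vecD(3)[OF z t] t by simp
    finally show "B * (act M (torus t) * (B' * z)) = t powi m \<cdot>\<^sub>m z" .
  qed simp_all
  moreover have "weight_vec M m (P * (B' * z))"
    unfolding weight_vec_def
  proof (intro conjI allI impI)
    fix t :: 'k assume t: "t \<noteq> 0"
    show "act M (torus t) * (P * (B' * z)) = t powi m \<cdot>\<^sub>m (P * (B' * z))"
      using mat_assoc_rule[OF P(3)[OF t], of "B' * z"] t by (simp add: mm)
  qed simp_all
  ultimately show thesis using that by blast
qed

lemma weights_quot: "weights_le N 2"
  unfolding weights_le_def
proof (intro allI impI)
  fix m z assume m: "m > 2" and z: "weight_vec N m z"
  from weight_vec_lift[OF z] obtain y where y: "weight_vec M m y" "B * y = z" .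
  have "y = 0\<^sub>m (rdim M) 1" by (rule weights_leD[OF weights y(1) m])
  then show "z = 0\<^sub>m (rdim N) 1" using y(2) by (simp add: mm)
qed

text \<open>A chase in weight spaces. The vector that raises to the image of \<open>v\<close> in
  \<open>N\<close> lifts to some \<open>b1\<close> of weight 0, which raises to some
  \<open>v1\<close>. As \<open>v\<close> and \<open>v1\<close> agree in \<open>N\<close>, their
  difference comes from a weight-2 vector of \<open>L\<close>, and the vector raising to it corrects
  \<open>b1\<close>. Signs disappear in characteristic 2.\<close>

lemma raises_extension:
  assumes L: "raises L" and N: "raises N"
  shows "raises M"
  unfolding raises_def
proof (intro allI impI)
  fix v assume v: "weight_vec M 2 v"
  from raisesE[OF N weight_vec_image[OF B M algebraic_quot v]] obtain z where
    z: "weight_vec N 0 z" "\<And>t. act N (upper t) * z = z + t \<cdot>\<^sub>m (B * v)" by blast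
  from weight_vec_lift[OF z(1)] obtain b1 where b1: "weight_vec M 0 b1" "B * b1 = z" .
  from upper_weight_zero_vec[OF M weights b1(1)] obtain v1 where
    v1: "weight_vec M 2 v1" "\<And>t. act M (upper t) * b1 = b1 + t \<cdot>\<^sub>m v1" by blast
  note [simp] = weight_vecD(1,2)[OF v] weight_vecD(1,2)[OF z(1)] weight_vecD(1,2)[OF b1(1)] weight_vecD(1,2)[OF v1(1)]
    algebraic_torus_dims[OF algebraic_sub] algebraic_torus_dims[OF algebraic_quot]
  have "B * (act M (upper 1) * b1) = act N (upper 1) * (B * b1)"
    using mat_assoc_rule2[OF rep_homD(3)[OF B, of "upper 1"], of b1] by simp
  then have eq: "z + B * v1 = z + B * v" by (simp add: v1 b1 z mm)
  have Bv: "B * v1 = B * v"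
  proof (rule eq_matI)
    fix i j assume "i < dim_row (B * v)" "j < dim_col (B * v)"
    then show "(B * v1) $$ (i, j) = (B * v) $$ (i, j)"
      using arg_cong[OF eq, of "\<lambda>A. A $$ (i, j)"] by (simp del: index_mult_mat(1))
  qed simp_all
  define x where "x = v + 1 \<cdot>\<^sub>m v1"
  have x: "weight_vec M 2 x" unfolding x_def by (rule weight_vec_add[OF M v v1(1)])
  note [simp] = weight_vecD(1,2)[OF x]
  have Bx: "B * x = 0\<^sub>m (rdim N) 1"
    by (simp add: x_def mm Bv) (rule eq_matI; simp add: c2s del: index_mult_mat(1))
  define l where "l = A' * x"
  have dl [simp]: "dim_row l = rdim L" "dim_col l = 1" by (simp_all add: l_def)
  have "x = (A * A' + B' * B) * x" unfolding sum by (simp add: mm)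
  then have Al: "A * l = x" by (simp add: mm Bx l_def)
  have l: "weight_vec L 2 l"
    unfolding weight_vec_def
  proof (intro conjI allI impI)
    fix t :: 'k assume t: "t \<noteq> 0"
    have "act L (torus t) * l = A' * (act M (torus t) * (A * l))" using t by (simp add: act_sub mm)
    also have "\<dots> = t powi 2 \<cdot>\<^sub>m l" unfolding Al using weight_vecD(3)[OF x t] by (simp add: mm l_def)
    finally show "act L (torus t) * l = t powi 2 \<cdot>\<^sub>m l" .
  qed simp_all
  from raisesE[OF L l] obtain b2 where b2: "weight_vec L 0 b2" "\<And>t. act L (upper t) * b2 = b2 + t \<cdot>\<^sub>m l" by blast
  note [simp] = weight_vecD(1,2)[OF b2(1)]
  have Ab2: "act M (upper t) * (A * b2) = A * b2 + t \<cdot>\<^sub>m x" for t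
    using mat_assoc_rule2[OF rep_homD(3)[OF A, of "upper t"], of b2] by (simp add: b2 mm Al)
  show "\<exists>b. weight_vec M 0 b \<and> (\<forall>t. act M (upper t) * b = b + t \<cdot>\<^sub>m v)"
  proof (intro exI[of _ "b1 + 1 \<cdot>\<^sub>m (A * b2)"] conjI allI)
    show "weight_vec M 0 (b1 + 1 \<cdot>\<^sub>m (A * b2))"
      by (rule weight_vec_add[OF M b1(1) weight_vec_image[OF A algebraic_sub M b2(1)]])
    show "act M (upper t) * (b1 + 1 \<cdot>\<^sub>m (A * b2)) = b1 + 1 \<cdot>\<^sub>m (A * b2) + t \<cdot>\<^sub>m v" for t
      by (simp add: mm Ab2 v1) (rule eq_matI; simp add: x_def c2s algebra_simps del: index_mult_mat(1))
  qed
qed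

end

lemma rdim_zero_raises:
  assumes "is_rep SL2 M" "rdim M = 0"
  shows "raises M"
  unfolding raises_def
proof (intro allI impI)
  fix v assume "weight_vec M 2 v"
  note v = weight_vecD(1,2)[OF this]
  show "\<exists>b. weight_vec M 0 b \<and> (\<forall>t. act M (upper t) * b = b + t \<cdot>\<^sub>m v)"
    by (intro exI[of _ v] conjI allI, unfold weight_vec_def, intro conjI allI impI)
      (use v assms in \<open>auto intro!: eq_matI simp: is_rep_dims[OF assms(1)]\<close>)
qed

text \<open>The weight bound passes to submodules and quotients, so the hypothesis on
  \<open>F\<close> is applied only to members whose weights are at most 2.\<close>

lemma filtration_raises:
  fixes M :: "('k::alg_closed_field mat, 'k) rep"
  assumes c2: "CHAR('k) = 2" and "has_filtration SL2 F M" "algebraic_rep M" "weights_le M 2"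
    and F: "\<And>n. weights_le (F n) 2 \<Longrightarrow> raises (F n)"
  shows "raises M"
  using assms(2-4)
proof (induction rule: has_filtration.induct)
  case (zero M)
  then show ?case by (intro rdim_zero_raises)
next
  case (step L M n)
  from rep_extension_split[OF step.hyps(2)] obtain A B A' B' where s: "A \<in> rep_hom SL2 L M" "B \<in> rep_hom SL2 M (F n)"
    "dim_row A' = rdim L" "dim_col A' = rdim M" "dim_row B' = rdim M" "dim_col B' = rdim (F n)"
    "A' * A = 1\<^sub>m (rdim L)" "B * B' = 1\<^sub>m (rdim (F n))" "B * A = 0\<^sub>m (rdim (F n)) (rdim L)"
    "A * A' + B' * B = 1\<^sub>m (rdim M)" .
  interpret algebraic_extension L M "F n" A B A' B'
    by unfold_locales (use s step c2 in \<open>auto simp: rep_extension_def\<close>)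
  show ?case by (rule raises_extension[OF step.IH[OF algebraic_sub weights_sub] F[OF weights_quot]])
qed

lemma transpose_hom:
  assumes B: "B \<in> rep_hom SL2 M N" and M: "is_rep SL2 M" and N: "is_rep SL2 N"
  shows "transpose_mat B \<in> rep_hom SL2 (transpose_rep N) (transpose_rep M)"
proof (rule rep_homI)
  note d = rep_homD(1,2)[OF B]
  fix g :: "'a mat" assume "g \<in> carrier SL2"
  then have g: "transpose_mat g \<in> carrier SL2" by (rule transpose_in_SL2)
  note dg = d is_rep_dims[OF M g] is_rep_dims[OF N g]
  have "transpose_mat (B * act M (transpose_mat g)) = transpose_mat (act N (transpose_mat g) * B)"
    using rep_homD(3)[OF B g] by simp
  then show "transpose_mat B * act (transpose_rep N) g = act (transpose_rep M) g * transpose_mat B"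
    using dg by (simp add: transpose_mult_dims)
qed (use rep_homD(1,2)[OF B] in simp_all)

text \<open>Transposition reverses each extension: the transpose of \<open>F n\<close> becomes the
  submodule and that of \<open>L\<close> the quotient. The induction still runs along the original
  filtration.\<close>

lemma filtration_transpose_raises:
  fixes M :: "('k::alg_closed_field mat, 'k) rep"
  assumes c2: "CHAR('k) = 2" and "has_filtration SL2 F M" "algebraic_rep M" "weights_le M 2"
    and F: "\<And>n. weights_le (transpose_rep (F n)) 2 \<Longrightarrow> raises (transpose_rep (F n))"
  shows "raises (transpose_rep M)"
  using assms(2-4)
proof (induction rule: has_filtration.induct)
  case (zero M)
  then show ?case by (intro rdim_zero_raises is_rep_transpose) auto
next
  case (step L M n)
  from rep_extension_split[OF step.hyps(2)] obtain A B A' B' where s: "A \<in> rep_hom SL2 L M" "B \<in> rep_hom SL2 M (F n)"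
    "dim_row A' = rdim L" "dim_col A' = rdim M" "dim_row B' = rdim M" "dim_col B' = rdim (F n)"
    "A' * A = 1\<^sub>m (rdim L)" "B * B' = 1\<^sub>m (rdim (F n))" "B * A = 0\<^sub>m (rdim (F n)) (rdim L)"
    "A * A' + B' * B = 1\<^sub>m (rdim M)" .
  note d = rep_homD(1,2)[OF s(1)] rep_homD(1,2)[OF s(2)] s(3-6)
  from step.hyps(2) have R: "is_rep SL2 L" "is_rep SL2 M" "is_rep SL2 (F n)" by (auto simp: rep_extension_def)
  interpret algebraic_extension L M "F n" A B A' B'
    by unfold_locales (use s step c2 R in auto)
  interpret T: algebraic_extension "transpose_rep (F n)" "transpose_rep M" "transpose_rep L"
    "transpose_mat B" "transpose_mat A" "transpose_mat B'" "transpose_mat A'"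
  proof unfold_locales
    show "transpose_mat B' * transpose_mat B = 1\<^sub>m (rdim (transpose_rep (F n)))"
      using arg_cong[OF s(8), of transpose_mat] d by (simp add: transpose_mult_dims)
    show "transpose_mat A * transpose_mat A' = 1\<^sub>m (rdim (transpose_rep L))"
      using arg_cong[OF s(7), of transpose_mat] d by (simp add: transpose_mult_dims)
    show "transpose_mat A * transpose_mat B = 0\<^sub>m (rdim (transpose_rep L)) (rdim (transpose_rep (F n)))"
      using arg_cong[OF s(9), of transpose_mat] d by (simp add: transpose_mult_dims)
    have "transpose_mat (B' * B + A * A') = 1\<^sub>m (rdim M)"
      using s(10) d comm_add_mat[of "A * A'" "rdim M" "rdim M" "B' * B"] by (simp add: carrier_matI)
    then show "transpose_mat B * transpose_mat B' + transpose_mat A' * transpose_mat A = 1\<^sub>m (rdim (transpose_rep M))"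
      using d transpose_add[of "B' * B" "rdim M" "rdim M" "A * A'"] by (simp add: transpose_mult_dims carrier_matI)
    show "weights_le (transpose_rep M) 2" by (rule weights_le_transpose[OF step.prems])
  qed (use c2 d R step.prems s in \<open>auto intro: is_rep_transpose transpose_hom algebraic_rep_transpose\<close>)
  show ?case by (rule T.raises_extension[OF F[OF T.weights_sub] step.IH[OF algebraic_sub weights_sub]])
qed

subsection \<open>Weyl modules\<close>

lemma powi_eq_imp_zero:
  fixes x :: "'k::alg_closed_field"
  assumes "\<And>t. t \<noteq> 0 \<Longrightarrow> t powi a * x = t powi b * x" "a \<noteq> b"
  shows "x = 0"
  using fun_cong[OF laurent_coeffs_unique[OF laurent_coeffs_powi laurent_coeffs_powi assms(1)], of a] assms(2) by auto

text \<open>Shared by \<open>dual_weyl n\<close>, with weights \<open>n - 2 i\<close>, and the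
  transpose of \<open>weyl n\<close>, with weights \<open>2 i - n\<close>.\<close>

locale diagonal_torus =
  fixes M :: "('k::alg_closed_field mat, 'k) rep" and n :: nat and w :: "nat \<Rightarrow> int"
  assumes rdim: "rdim M = Suc n"
    and torus_dims: "\<And>t. t \<noteq> 0 \<Longrightarrow> dim_row (act M (torus t)) = Suc n" "\<And>t. t \<noteq> 0 \<Longrightarrow> dim_col (act M (torus t)) = Suc n"
    and torus_entry: "\<And>t i j. t \<noteq> 0 \<Longrightarrow> i \<le> n \<Longrightarrow> j \<le> n \<Longrightarrow> act M (torus t) $$ (i, j) = (if i = j then t powi w i else 0)"
begin

lemma torus_mult_entry:
  assumes "t \<noteq> 0" "i \<le> n" "dim_row v = Suc n" "dim_col v = 1"
  shows "(act M (torus t) * v) $$ (i, 0) = t powi w i * v $$ (i, 0)"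
proof -
  have "(act M (torus t) * v) $$ (i, 0) = (\<Sum>k<Suc n. (if i = k then t powi w i else 0) * v $$ (k, 0))"
    using assms torus_dims by (simp add: mat_mult_entry torus_entry del: index_mult_mat(1) sum.lessThan_Suc)
  also have "\<dots> = (\<Sum>k<Suc n. if i = k then t powi w i * v $$ (k, 0) else 0)"
    by (rule sum.cong) auto
  finally show ?thesis using assms by simp
qed

lemma weight_vec_iff:
  "weight_vec M m v \<longleftrightarrow> dim_row v = Suc n \<and> dim_col v = 1 \<and> (\<forall>i\<le>n. w i \<noteq> m \<longrightarrow> v $$ (i, 0) = 0)"
proof
  assume v: "weight_vec M m v"
  note d = weight_vecD(1,2)[OF v, unfolded rdim]
  have "v $$ (i, 0) = 0" if "i \<le> n" "w i \<noteq> m" for i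
  proof (rule powi_eq_imp_zero[OF _ that(2)])
    fix t :: 'k assume t: "t \<noteq> 0"
    have "(act M (torus t) * v) $$ (i, 0) = t powi m * v $$ (i, 0)"
      unfolding weight_vecD(3)[OF v t] using that d by simp
    then show "t powi w i * v $$ (i, 0) = t powi m * v $$ (i, 0)"
      unfolding torus_mult_entry[OF t that(1) d] .
  qed
  then show "dim_row v = Suc n \<and> dim_col v = 1 \<and> (\<forall>i\<le>n. w i \<noteq> m \<longrightarrow> v $$ (i, 0) = 0)" using d by simp
next
  assume v: "dim_row v = Suc n \<and> dim_col v = 1 \<and> (\<forall>i\<le>n. w i \<noteq> m \<longrightarrow> v $$ (i, 0) = 0)"
  show "weight_vec M m v" unfolding weight_vec_def
  proof (intro conjI allI impI)
    fix t :: 'k assume t: "t \<noteq> 0"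
    show "act M (torus t) * v = t powi m \<cdot>\<^sub>m v"
    proof (rule eq_matI)
      fix i j assume "i < dim_row (t powi m \<cdot>\<^sub>m v)" "j < dim_col (t powi m \<cdot>\<^sub>m v)"
      then have [simp]: "j = 0" and i: "i \<le> n" "i < Suc n" using v by auto
      then show "(act M (torus t) * v) $$ (i, j) = (t powi m \<cdot>\<^sub>m v) $$ (i, j)"
        using torus_mult_entry[OF t i(1), of v] v by (cases "w i = m") auto
    qed (use v t torus_dims in simp_all)
  qed (use v rdim in simp_all)
qed

lemma weights_leD':
  assumes "weights_le M m" "i \<le> n"
  shows "w i \<le> m"
proof (rule ccontr)
  assume "\<not> w i \<le> m"
  moreover have "weight_vec M (w i) (mat (Suc n) 1 (\<lambda>(j, _). if j = i then 1 else 0))"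
    by (auto simp: weight_vec_iff)
  ultimately have "mat (Suc n) 1 (\<lambda>(j, _). if j = i then 1 else 0) = (0\<^sub>m (Suc n) 1 :: 'k mat)"
    using weights_leD[OF assms(1)] rdim by simp
  from arg_cong[OF this, of "\<lambda>A. A $$ (i, 0)"] assms(2) show False by simp
qed

text \<open>\<open>p\<close> is the only index of weight 2, \<open>q\<close> has weight 0, and
  \<open>upper t\<close> sends the basis vector at \<open>q\<close> to itself plus \<open>t\<close>
  times the one at \<open>p\<close>. The condition is an implication, so it holds vacuously when
  weight 2 does not occur.\<close>

lemma raises_if:
  assumes "\<And>i. i \<le> n \<Longrightarrow> w i = 2 \<Longrightarrow> i = p \<and> q \<le> n \<and> w q = 0 \<and> p \<noteq> q \<and>
      (\<forall>t. \<forall>i\<le>n. act M (upper t) $$ (i, q) = (if i = q then 1 else if i = p then t else 0))"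
    and d: "\<And>t. dim_row (act M (upper t)) = Suc n" "\<And>t. dim_col (act M (upper t)) = Suc n"
  shows "raises M"
  unfolding raises_def
proof (intro allI impI)
  fix v assume "weight_vec M 2 v"
  then have v: "dim_row v = Suc n" "dim_col v = 1" "\<And>i. i \<le> n \<Longrightarrow> w i \<noteq> 2 \<Longrightarrow> v $$ (i, 0) = 0"
    by (auto simp: weight_vec_iff)
  show "\<exists>b. weight_vec M 0 b \<and> (\<forall>t. act M (upper t) * b = b + t \<cdot>\<^sub>m v)"
  proof (cases "\<exists>i\<le>n. w i = 2")
    case False
    then have "v = 0\<^sub>m (Suc n) 1" using v by (intro eq_matI) auto
    then show ?thesis
      by (intro exI[of _ "0\<^sub>m (Suc n) 1"]) (auto simp: weight_vec_iff mm d intro!: eq_matI)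
  next
    case True
    then have p: "p \<le> n" "w p = 2" "q \<le> n" "w q = 0" "p \<noteq> q"
      "\<And>t i. i \<le> n \<Longrightarrow> act M (upper t) $$ (i, q) = (if i = q then 1 else if i = p then t else 0)"
      using assms(1) by blast+
    have v0: "v $$ (i, 0) = 0" if "i \<le> n" "i \<noteq> p" for i using v(3)[OF that(1)] assms(1)[of i] that by blast
    define b where "b = mat (Suc n) 1 (\<lambda>(i, _). if i = q then v $$ (p, 0) else 0)"
    have "weight_vec M 0 b" using p by (auto simp: weight_vec_iff b_def)
    moreover have "act M (upper t) * b = b + t \<cdot>\<^sub>m v" for t
    proof (rule eq_matI)
      fix i j assume "i < dim_row (b + t \<cdot>\<^sub>m v)" "j < dim_col (b + t \<cdot>\<^sub>m v)"
      then have [simp]: "j = 0" and i: "i \<le> n" "i < Suc n" using v by auto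
      have "(act M (upper t) * b) $$ (i, 0) = (\<Sum>k<Suc n. if k = q then act M (upper t) $$ (i, k) * v $$ (p, 0) else 0)"
        using d i by (subst mat_mult_entry) (auto simp: b_def if_distrib[where f = "\<lambda>x. y * x" for y] cong: if_cong simp del: sum.lessThan_Suc)
      also have "\<dots> = act M (upper t) $$ (i, q) * v $$ (p, 0)" using p(3) by simp
      finally show "(act M (upper t) * b) $$ (i, j) = (b + t \<cdot>\<^sub>m v) $$ (i, j)"
        using i v p(6)[OF i(1), of t] v0[OF i(1)] p(5) by (auto simp: b_def)
    qed (use v d in \<open>simp_all add: b_def\<close>)
    ultimately show ?thesis by blast
  qed
qed

end

lemma dual_weyl_torus_entry:
  assumes "t \<noteq> 0" "i \<le> n" "j \<le> n"
  shows "act (dual_weyl n) (torus t) $$ (i, j) = (if i = j then t powi (int n - 2 * int i) else (0 :: 'k::field))"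
proof -
  have "[:0, inverse t:] ^ j = monom (inverse t ^ j) j"
    by (metis monom_0 monom_Suc monom_power mult.left_neutral One_nat_def)
  then have "[:t, 0:] ^ (n - j) * [:0, inverse t:] ^ j = Polynomial.smult (t ^ (n - j)) (monom (inverse t ^ j) j)"
    by (simp add: poly_const_pow)
  then have "act (dual_weyl n) (torus t) $$ (i, j) = (if i = j then t ^ (n - j) * inverse t ^ j else 0)"
    using assms by (simp add: dual_weyl_def)
  moreover have "t ^ (n - i) * inverse t ^ i = t powi (int n - 2 * int i)"
  proof -
    have "t ^ (n - i) = t powi (int n - int i)" using assms by (simp add: power_int_def nat_diff_distrib)
    moreover have "inverse t ^ i = t powi (- int i)" by (simp add: power_int_minus power_inverse)
    ultimately have "t ^ (n - i) * inverse t ^ i = t powi ((int n - int i) + (- int i))"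
      using power_int_add[of t "int n - int i" "- int i"] assms(1) by simp
    then show ?thesis by simp
  qed
  ultimately show ?thesis by auto
qed

lemma dual_weyl_dims [simp]:
  "rdim (dual_weyl n) = Suc n" "dim_row (act (dual_weyl n) g) = Suc n" "dim_col (act (dual_weyl n) g) = Suc n"
  by (simp_all add: dual_weyl_def)

text \<open>The bound forces \<open>n \<le> 2\<close>, and weight 2 occurs only at
  \<open>x^2\<close> in \<open>Sym^2 V\<close>. There \<open>upper t\<close> sends \<open>y\<close>
  to \<open>t x + y\<close>, so \<open>x y\<close> goes to \<open>x y + t x^2\<close>. The weight-0
  vector of a Weyl module would be raised with the factor \<open>2 = 0\<close> instead.\<close>

lemma raises_dual_weyl:
  assumes "weights_le (dual_weyl n :: ('k::alg_closed_field mat, 'k) rep) 2"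
  shows "raises (dual_weyl n :: ('k mat, 'k) rep)"
proof -
  interpret diagonal_torus "dual_weyl n :: ('k mat, 'k) rep" n "\<lambda>i. int n - 2 * int i"
    by unfold_locales (simp_all add: dual_weyl_torus_entry)
  have "int n \<le> 2" using weights_leD'[OF assms, of 0] by simp
  then have n: "n = 2 \<and> i = 0" if "int n - 2 * int i = 2" for i using that by auto
  show ?thesis
    by (rule raises_if[of 0 1], drule n) (auto simp: dual_weyl_def coeff_pCons split: nat.splits)
qed

lemma SL2_inv:
  assumes "g \<in> carrier SL2" "h \<in> carrier SL2" "h * g = 1\<^sub>m 2"
  shows "inv\<^bsub>SL2\<^esub> g = h"
  by (rule group.inv_equality[OF group_SL2]) (use assms in simp_all)

text \<open>The transpose of a Weyl module is the dual Weyl module twisted by inverse transposition.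
  As \<open>lower t\<close> is its own inverse, \<open>upper t\<close> acts as
  \<open>lower t\<close> does on \<open>dual_weyl n\<close>; the roles of \<open>x\<close> and
  \<open>y\<close> are exchanged, and \<open>x y\<close> goes to \<open>x y + t y^2\<close>.\<close>

lemma raises_transpose_weyl:
  assumes c2: "CHAR('k) = 2" and "weights_le (transpose_rep (weyl n) :: ('k::alg_closed_field mat, 'k) rep) 2"
  shows "raises (transpose_rep (weyl n) :: ('k mat, 'k) rep)"
proof -
  let ?M = "transpose_rep (weyl n) :: ('k mat, 'k) rep"
  have act: "act ?M g = act (dual_weyl n) (inv\<^bsub>SL2\<^esub> (transpose_mat g))" for g
    by (simp add: weyl_def rep_dual_def)
  have rd: "rdim ?M = Suc n" by (simp add: weyl_def rep_dual_def)
  have tor: "act ?M (torus t) = act (dual_weyl n) (torus (inverse t))" if "t \<noteq> 0" for t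
  proof -
    have "inv\<^bsub>SL2\<^esub> (torus t) = torus (inverse t)"
      by (rule SL2_inv) (use that in \<open>simp_all add: mat2_in_SL2 mat2_mult mat2_one\<close>)
    then show ?thesis unfolding act mat2_transpose by (rule arg_cong)
  qed
  have up: "act ?M (upper t) = act (dual_weyl n) (lower t)" for t
  proof -
    have "inv\<^bsub>SL2\<^esub> (lower t) = lower t"
      by (rule SL2_inv) (simp_all add: mat2_mult mat2_one[symmetric] mat2_inject char2_two[OF c2] char2_add_self[OF c2])
    then show ?thesis unfolding act mat2_transpose by (rule arg_cong)
  qed
  interpret diagonal_torus ?M n "\<lambda>i. 2 * int i - int n"
  proof unfold_locales
    fix t :: 'k and i j assume *: "t \<noteq> 0" "i \<le> n" "j \<le> n"
    have "inverse t powi (int n - 2 * int i) = t powi (2 * int i - int n)"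
      by (metis minus_diff_eq power_int_inverse power_int_minus)
    then show "act ?M (torus t) $$ (i, j) = (if i = j then t powi (2 * int i - int n) else 0)"
      unfolding tor[OF *(1)] using * dual_weyl_torus_entry[of "inverse t" i n j] by auto
  qed (simp_all add: rd tor del: transpose_rep_simps)
  have "int n \<le> 2" using weights_leD'[OF assms(2), of n] by simp
  then have n: "n = 2 \<and> i = 2" if "2 * int i - int n = 2" "i \<le> n" for i using that by auto
  show ?thesis
    by (rule raises_if[of 2 1], drule n, unfold up) (auto simp: dual_weyl_def coeff_pCons split: nat.splits)
qed

section \<open>The given tilting modules and the final decomposition\<close>

lemma is_weight_iff: "is_weight M m \<longleftrightarrow> (\<exists>v. weight_vec M m v \<and> v \<noteq> 0\<^sub>m (rdim M) 1)"
  if R: "is_rep SL2 M"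
proof
  have dt: "dim_row (act M (torus t)) = rdim M" "dim_col (act M (torus t)) = rdim M" if "t \<noteq> 0" for t
    using is_rep_dims[OF R, of "torus t"] that by auto
  {
    assume "is_weight M m"
    then obtain v where v: "v \<in> carrier_vec (rdim M)" "v \<noteq> 0\<^sub>v (rdim M)"
      "\<And>t. t \<noteq> 0 \<Longrightarrow> act M (torus t) *\<^sub>v v = (t powi m) \<cdot>\<^sub>v v" by (auto simp: is_weight_def)
    let ?v = "mat (rdim M) 1 (\<lambda>(i, _). v $ i)"
    have c: "col ?v 0 = v" using v(1) by (intro eq_vecI) auto
    have "weight_vec M m ?v" unfolding weight_vec_def
    proof (intro conjI allI impI mat_eq_columnsI)
      fix t j assume t: "t \<noteq> 0" and "j < dim_col (t powi m \<cdot>\<^sub>m ?v)"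
      then have [simp]: "j = 0" by simp
      have "col (act M (torus t) * ?v) 0 = t powi m \<cdot>\<^sub>v v"
        unfolding v(3)[OF t, symmetric] using t dt by (subst col_mult_dims) (simp_all only: c, simp_all)
      also have "\<dots> = col (t powi m \<cdot>\<^sub>m ?v) 0" using v(1) by (intro eq_vecI) auto
      finally show "col (act M (torus t) * ?v) j = col (t powi m \<cdot>\<^sub>m ?v) j" by simp
    qed (use dt in simp_all)
    moreover have "?v \<noteq> 0\<^sub>m (rdim M) 1"
    proof
      assume "?v = 0\<^sub>m (rdim M) 1"
      then have "v = col (0\<^sub>m (rdim M) 1) 0" using c by simp
      then show False using v(2) by simp
    qed
    ultimately show "\<exists>v. weight_vec M m v \<and> v \<noteq> 0\<^sub>m (rdim M) 1" by blast
  }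
  {
    assume "\<exists>v. weight_vec M m v \<and> v \<noteq> 0\<^sub>m (rdim M) 1"
    then obtain v where v: "weight_vec M m v" "v \<noteq> 0\<^sub>m (rdim M) 1" by blast
    note d = weight_vecD(1,2)[OF v(1)]
    show "is_weight M m" unfolding is_weight_def
    proof (intro bexI[of _ "col v 0"] conjI allI impI)
      show "col v 0 \<noteq> 0\<^sub>v (rdim M)"
      proof
        assume *: "col v 0 = 0\<^sub>v (rdim M)"
        have "v = 0\<^sub>m (rdim M) 1" by (rule mat_eq_columnsI) (use d * in auto)
        then show False using v(2) by simp
      qed
      fix t :: 'a assume t: "t \<noteq> 0"
      have "act M (torus t) *\<^sub>v col v 0 = col (act M (torus t) * v) 0"
        using d t dt by (subst col_mult_dims) simp_all
      also have "\<dots> = t powi m \<cdot>\<^sub>v col v 0" unfolding weight_vecD(3)[OF v(1) t] using d by (intro eq_vecI) auto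
      finally show "act M (torus t) *\<^sub>v col v 0 = t powi m \<cdot>\<^sub>v col v 0" .
    qed (use d in \<open>auto intro!: carrier_vecI\<close>)
  }
qed

lemma indecomposable_tilting_iso:
  fixes M :: "('k::alg_closed_field mat, 'k) rep"
  assumes c2: "CHAR('k) = 2" and i: "i \<in> {1, 2, 3}" and M: "indecomposable_tilting i M"
  shows "rep_iso SL2 M (small_tilting i)"
proof -
  have ind: "rep_indecomposable SL2 M" and hw: "highest_weight M (int i)" and til: "tilting M"
    using M by (simp_all add: indecomposable_tilting_def)
  then have alg: "algebraic_rep M" by (simp add: tilting_def SL2_module_algebraic)
  have wt: "weights_le M (int i)"
    using hw is_weight_iff[OF algebraic_repD[OF alg]] unfolding weights_le_def highest_weight_def by force
  from hw obtain v where v: "weight_vec M (int i) v" "v \<noteq> 0\<^sub>m (rdim M) 1"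
    using is_weight_iff[OF algebraic_repD[OF alg]] by (auto simp: highest_weight_def)
  from i consider "i = 1" | "i = 2" | "i = 3" by blast
  then show ?thesis
  proof cases
    case 1
    then show ?thesis using tilting_one_iso[OF c2 alg ind _ _ v(2)] wt v by simp
  next
    case 2
    then have w2: "weights_le M 2" using wt by simp
    \<comment> \<open>The dual Weyl filtration serves \<open>M\<close> and the Weyl filtration its
      transpose, since transposition turns Weyl modules into dual Weyl modules.\<close>
    have "raises M"
      by (rule filtration_raises[where F = dual_weyl, OF c2 _ alg w2 raises_dual_weyl]) (use til in \<open>simp_all add: tilting_def\<close>)
    moreover have "raises (transpose_rep M)"
      by (rule filtration_transpose_raises[where F = weyl, OF c2 _ alg w2 raises_transpose_weyl[OF c2]]) (use til in \<open>simp_all add: tilting_def\<close>)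
    ultimately show ?thesis using tilting_two_iso[OF c2 alg ind _ _ v(2)] wt v 2 by simp
  next
    case 3
    then show ?thesis using tilting_three_iso[OF c2 alg ind _ _ v(2)] wt v by simp
  qed
qed

lemma rep_iso_rdim:
  assumes "rep_iso G M N" "is_rep G M" "is_rep G N"
  shows "rdim M = rdim N"
proof -
  from rep_isoE[OF assms] obtain A B where A: "A \<in> rep_hom G M N" "B \<in> rep_hom G N M"
    "A * B = 1\<^sub>m (rdim N)" "B * A = 1\<^sub>m (rdim M)" .
  have "A \<in> carrier_mat (rdim N) (rdim M)" "B \<in> carrier_mat (rdim M) (rdim N)"
    using A(1,2) by (simp_all add: rep_hom_def)
  from square_if_inverse[OF this A(3,4)] show ?thesis by simp
qed

lemma kron2_one_right: "g \<in> carrier SL2 \<Longrightarrow> kronecker_mat g (1\<^sub>m 1) = g"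
  by (subst kron2; simp add: SL2_dims) (rule eq_matI; auto simp: SL2_dims less_2_cases_iff)

theorem corollary7p3p4:
  fixes E :: "'e monoid" and g1 g2 :: 'e
    and l1 l2 :: "'k::alg_closed_field"
    and \<phi> :: "'e \<Rightarrow> 'k mat"
    and T :: "nat \<Rightarrow> ('k mat, 'k) rep"
    and X :: "('e, 'k) rep"
  assumes char: "CHAR('k) = 2"
    and E: "group E" "E \<cong> integer_mod_group 2 \<times>\<times> integer_mod_group 2"
    and gens: "g1 \<in> carrier E" "g2 \<in> carrier E" "generate E {g1, g2} = carrier E"
    and indep: "\<forall>a\<in>{0, 1}. \<forall>b\<in>{0, 1}. a * l1 + b * l2 = 0 \<longrightarrow> a = 0 \<and> b = 0"
    and embedding: "\<phi> \<in> hom E SL2" "\<phi> g1 = mat2 1 0 l1 1" "\<phi> g2 = mat2 1 0 l2 1"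
    and T: "\<And>i. i \<in> {1, 2, 3} \<Longrightarrow> indecomposable_tilting i (T i)"
    and X: "is_rep E X"
  shows "\<exists>ns. set ns \<subseteq> {1, 2, 3} \<and>
           rep_iso E (rep_tensor (rep_restrict \<phi> (T 1)) X)
             (rep_direct_sum (map (\<lambda>i. rep_restrict \<phi> (T i)) ns))"
proof -
  interpret klein_embedding E g1 g2 l1 l2 \<phi>
    by (rule klein_embedding.intro) (fact assms)+
  let ?S = "\<lambda>i. rep_restrict \<phi> (T i)"
  have rep: "is_rep SL2 (T i)" if "i \<in> {1, 2, 3}" for i
    using T[OF that] by (simp add: indecomposable_tilting_def tilting_def SL2_module_def)
  have S: "is_rep E (?S i)" if "i \<in> {1, 2, 3}" for i
    by (rule is_rep_restrict[OF rep[OF that] embedding(1) E(1) group_SL2])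
  have iso: "rep_iso SL2 (T i) (small_tilting i)" if "i \<in> {1, 2, 3}" for i
    by (rule indecomposable_tilting_iso[OF char that T[OF that]])
  have S_iso: "rep_iso E (?S i) (rep_restrict \<phi> (small_tilting i))" if "i \<in> {1, 2, 3}" for i
    by (rule rep_iso_restrict[OF iso[OF that] embedding(1)])
  let ?V = "rep_restrict \<phi> natural_rep"
  have V: "is_rep E ?V" by (rule is_rep_restrict[OF is_rep_natural embedding(1) E(1) group_SL2])
  \<comment> \<open>The model of \<open>T 1\<close> is \<open>V\<close> tensored with the trivial
    module. Through it the claim moves to \<open>V \<otimes> X\<close>, where the explicit matrices
    are available.\<close>
  have "rep_iso SL2 (small_tilting 1 :: ('k mat, 'k) rep) natural_rep"
    by (rule rep_isoI[of "1\<^sub>m 2" _ _ _ "1\<^sub>m 2"])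
      (auto intro!: rep_homI simp: small_tilting_def second_factor_def mm SL2_dims kron2_dim kron2_one_right[simplified])
  then have "rep_iso SL2 (T 1) natural_rep"
    using rep_iso_trans[OF iso _ rep is_rep_small_tilting[OF char] is_rep_natural] by simp
  then have TV: "rep_iso E (?S 1) ?V" by (rule rep_iso_restrict[OF _ embedding(1)])
  then have "rdim (T 1) = 2"
    using rep_iso_rdim[OF TV S V] by simp
  then have tens: "rep_iso E (rep_tensor (?S 1) X) (rep_tensor ?V X)"
    by (intro rep_iso_tensor2[OF TV S V _ _ X]) simp_all
  have tV: "is_rep E (rep_tensor ?V X)" by (rule is_rep_tensor2[OF V _ X]) simp
  have tS: "is_rep E (rep_tensor (?S 1) X)" using \<open>rdim (T 1) = 2\<close> by (intro is_rep_tensor2[OF S _ X]) simp_all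
  from split_pair_imp_direct_sum[of ?S, OF S S_iso tV split_pair_natural_tensor[OF X]]
  obtain ns where ns: "set ns \<subseteq> {1, 2, 3}" "rep_iso E (rep_tensor ?V X) (rep_direct_sum (map ?S ns))" by blast
  have "is_rep E (rep_direct_sum (map ?S ns))" using ns(1) S by (intro is_rep_direct_sum) auto
  from rep_iso_trans[OF tens ns(2) tS tV this] ns(1) show ?thesis by blast
qed

end
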